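(* Let $(a,b)=\mathbb{R}_+=(0,\infty)$ and let $\tau=-\frac{d}{dx}\frac{d}{dP(x)}+q(x)$ with $P(x)=x+\nu(x)$, where $d\nu$ is a real signed Borel measure singular with respect to Lebesgue measure with $|d\nu|((0,c))<\infty$ for all $c>0$, and $q$ is real-valued with $q\in L^1(0,c)$ for all $c>0$. Assume that the topological support $\Sigma=\mathrm{supp}(d\nu)\subset\mathbb{R}_+$ satisfies at least one of the following conditions: (i) $\Sigma$ is bounded; (ii) $\Sigma$ has Lebesgue measure zero; (iii) $\Sigma$ has infinitely many gaps near $+\infty$ whose lengths do not tend to zero, i.e. there are $\varepsilon>0$ and a sequence $x_j\to\infty$ with $(x_j,x_j+\varepsilon)\cap\Sigma=\emptyset$ for every $j\in\mathbb{N}$. Let $\mathrm{H}_{\mathrm{D}}$ be the restriction of the maximal operator $\mathrm{H}$ of $\tau$ in $L^2(\mathbb{R}_+)$ to $\{f\in\mathrm{dom}(\mathrm{H}): f(0)=0\}$. If the minimal operator $\mathrm{H}_{\min}=\mathrm{H}_{\mathrm{D}}^*$ acting in $L^2(\mathbb{R}_+)$ is lower semibounded, then it is self-adjoint.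
   Context: $dP=dx+d\nu$. $AC_{\mathrm{loc}}((a,b);dP)$ is the set of functions $f$ which are locally of bounded variation and whose Borel measure $df$ is absolutely continuous with respect to $dP$; then $df=f^{[1]}\,dP$ with $f^{[1]}\in L^1_{\mathrm{loc}}((a,b);dP)$ the quasi-derivative of $f$ (left-continuous representatives of $f$ are used). Put $\mathfrak{D}=\{f\in AC_{\mathrm{loc}}((a,b);dP): f^{[1]}\in AC_{\mathrm{loc}}(a,b)\}$ and $\tau f=-(f^{[1]})'+qf$ for $f\in\mathfrak{D}$. The maximal operator is $\mathrm{H}f=\tau f$ with $\mathrm{dom}(\mathrm{H})=\{f\in L^2(a,b): f\in\mathfrak{D},\ \tau f\in L^2(a,b)\}$. The assumptions mean that $\tau$ is regular at $0$, so that the limit $f(0)=\lim_{x\downarrow0}f(x)$ exists for $f\in\mathrm{dom}(\mathrm{H})$. *)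

theory Defs
  imports "HOL-Analysis.Analysis"
begin

section \<open>Borel measures on \<open>(0,\<infinity>)\<close> with values in \<open>\<real>\<close> or \<open>\<complex>\<close>\<close>

definition rc_borel :: "real set set" where
  "rc_borel = {A \<in> sets borel. \<exists>c d. 0 < c \<and> A \<subseteq> {c..d}}"

text \<open>
  A signed or complex Borel measure on \<open>(0,\<infinity>)\<close> need not be defined on every Borel set: Lebesgue
  measure plus a signed measure with infinite positive and negative parts is not. Such a measure is
  therefore a countably additive function on the Borel sets with compact closure in \<open>(0,\<infinity>)\<close>; its
  values on other sets carry no information, and no definition below depends on them.
\<close>

definition is_charge :: "(real set \<Rightarrow> 'v::real_normed_vector) \<Rightarrow> bool" where
  "is_charge \<mu> \<longleftrightarrow>
     (\<forall>A::nat \<Rightarrow> real set. range A \<subseteq> rc_borel \<and> disjoint_family A \<and> (\<Union>n. A n) \<in> rc_borel \<longrightarrow>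
        (\<lambda>n. \<mu> (A n)) sums \<mu> (\<Union>n. A n))"

text \<open>
  Positive and negative part (Jordan decomposition) of a signed measure, as measures on \<open>borel\<close>
  carried by \<open>(0,\<infinity>)\<close>. The supremum is nonnegative because \<open>\<mu> {} = 0\<close>, so that the truncation of
  negative numbers by \<^const>\<open>ennreal\<close> is harmless.
\<close>

definition pos_part :: "(real set \<Rightarrow> real) \<Rightarrow> real measure" where
  "pos_part \<mu> =
     measure_of UNIV (sets borel) (\<lambda>A. SUP B\<in>{B \<in> rc_borel. B \<subseteq> A}. ennreal (\<mu> B))"

definition neg_part :: "(real set \<Rightarrow> real) \<Rightarrow> real measure" where
  "neg_part \<mu> = pos_part (\<lambda>A. - \<mu> A)"

definition total_var :: "(real set \<Rightarrow> real) \<Rightarrow> real set \<Rightarrow> ennreal" where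
  "total_var \<mu> A = emeasure (pos_part \<mu>) A + emeasure (neg_part \<mu>) A"

definition leb :: "real set \<Rightarrow> real" where
  "leb A = measure lborel A"

definition singular_leb :: "(real set \<Rightarrow> real) \<Rightarrow> bool" where
  "singular_leb \<mu> \<longleftrightarrow> (\<exists>N \<in> null_sets lborel. total_var \<mu> ({0<..} - N) = 0)"

definition charge_supp :: "(real set \<Rightarrow> real) \<Rightarrow> real set" where
  "charge_supp \<mu> = {x. 0 < x \<and> (\<forall>U. open U \<and> x \<in> U \<longrightarrow> total_var \<mu> U > 0)}"

definition charge_integral :: "(real set \<Rightarrow> real) \<Rightarrow> real set \<Rightarrow> (real \<Rightarrow> complex) \<Rightarrow> complex" where
  "charge_integral \<mu> A g = (LINT x:A|pos_part \<mu>. g x) - (LINT x:A|neg_part \<mu>. g x)"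

definition L1_loc :: "(real set \<Rightarrow> real) \<Rightarrow> (real \<Rightarrow> complex) \<Rightarrow> bool" where
  "L1_loc \<mu> g \<longleftrightarrow>
     (\<forall>c d. 0 < c \<longrightarrow> set_integrable (pos_part \<mu>) {c..d} g \<and> set_integrable (neg_part \<mu>) {c..d} g)"


section \<open>Absolute continuity with respect to a signed measure and quasi-derivatives\<close>

definition BV_loc :: "(real \<Rightarrow> complex) \<Rightarrow> bool" where
  "BV_loc f \<longleftrightarrow>
     (\<forall>c d. 0 < c \<longrightarrow>
        (\<exists>K. \<forall>(t::nat \<Rightarrow> real) n. mono t \<and> range t \<subseteq> {c..d} \<longrightarrow>
           (\<Sum>i<n. norm (f (t (Suc i)) - f (t i))) \<le> K))"

text \<open>
  \<open>df\<close> for a left-continuous \<open>f\<close>; the half-open intervals determine it on \<^const>\<open>rc_borel\<close>.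
\<close>

definition is_df :: "(real \<Rightarrow> complex) \<Rightarrow> (real set \<Rightarrow> complex) \<Rightarrow> bool" where
  "is_df f m \<longleftrightarrow> is_charge m \<and> (\<forall>c d. 0 < c \<and> c < d \<longrightarrow> m {c..<d} = f d - f c)"

definition AC_loc :: "(real set \<Rightarrow> real) \<Rightarrow> (real \<Rightarrow> complex) \<Rightarrow> bool" where
  "AC_loc \<mu> f \<longleftrightarrow>
     BV_loc f \<and> (\<forall>x>0. continuous (at_left x) f) \<and>
     (\<exists>m. is_df f m \<and> (\<forall>A\<in>rc_borel. total_var \<mu> A = 0 \<longrightarrow> m A = 0))"

text \<open>
  \<open>df = g d\<mu>\<close>. Such a \<open>g\<close> is unique up to sets of \<open>|\<mu>|\<close>-measure zero. For \<open>\<mu> = leb\<close> it is the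
  ordinary (almost everywhere) derivative of the locally absolutely continuous function \<open>f\<close>.
\<close>

definition quasi_deriv :: "(real set \<Rightarrow> real) \<Rightarrow> (real \<Rightarrow> complex) \<Rightarrow> (real \<Rightarrow> complex) \<Rightarrow> bool" where
  "quasi_deriv \<mu> f g \<longleftrightarrow>
     AC_loc \<mu> f \<and> L1_loc \<mu> g \<and>
     (\<exists>m. is_df f m \<and> (\<forall>A\<in>rc_borel. m A = charge_integral \<mu> A g))"


section \<open>Operators in \<open>L\<^sup>2(0,\<infinity>)\<close>\<close>

text \<open>
  Elements of \<open>L\<^sup>2\<close> are represented by functions, whose values outside \<open>(0,\<infinity>)\<close> are irrelevant, and
  operators by their graphs.
\<close>

type_synonym graph = "((real \<Rightarrow> complex) \<times> (real \<Rightarrow> complex)) set"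

definition L2 :: "(real \<Rightarrow> complex) set" where
  "L2 = {f. f \<in> borel_measurable (lebesgue_on {0<..}) \<and>
            integrable (lebesgue_on {0<..}) (\<lambda>x. (norm (f x))\<^sup>2)}"

definition ip :: "(real \<Rightarrow> complex) \<Rightarrow> (real \<Rightarrow> complex) \<Rightarrow> complex" where
  "ip f g = (LINT x|lebesgue_on {0<..}. f x * cnj (g x))"

definition L2_norm :: "(real \<Rightarrow> complex) \<Rightarrow> real" where
  "L2_norm f = sqrt (LINT x|lebesgue_on {0<..}. (norm (f x))\<^sup>2)"

definition adjoint_graph :: "graph \<Rightarrow> graph" where
  "adjoint_graph T = {(u, w). u \<in> L2 \<and> w \<in> L2 \<and> (\<forall>(f, h)\<in>T. ip h u = ip f w)}"

definition densely_defined :: "graph \<Rightarrow> bool" where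
  "densely_defined T \<longleftrightarrow> (\<forall>u\<in>L2. \<forall>\<epsilon>>0. \<exists>(f, h)\<in>T. L2_norm (\<lambda>x. u x - f x) < \<epsilon>)"

text \<open>
  The equality of graphs below also compares representatives; this is appropriate when \<open>T\<close> contains
  all representatives of its elements, as every adjoint does.
\<close>

definition self_adjoint :: "graph \<Rightarrow> bool" where
  "self_adjoint T \<longleftrightarrow> densely_defined T \<and> adjoint_graph T = T"

text \<open>For symmetric \<open>T\<close> the number \<open>ip h f\<close> is real.\<close>

definition lower_semibounded :: "graph \<Rightarrow> bool" where
  "lower_semibounded T \<longleftrightarrow> (\<exists>\<gamma>::real. \<forall>(f, h)\<in>T. \<gamma> * (L2_norm f)\<^sup>2 \<le> Re (ip h f))"


section \<open>The operators generated by \<open>\<tau> = - d/dx d/dP + q\<close>\<close>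

definition dP :: "(real set \<Rightarrow> real) \<Rightarrow> real set \<Rightarrow> real" where
  "dP \<nu> A = leb A + \<nu> A"

text \<open>
  \<open>f \<in> \<DD>\<close> and \<open>h = \<tau> f\<close> almost everywhere. The requirement \<open>f\<^sup>[\<^sup>1\<^sup>] \<in> AC_loc(0,\<infinity>)\<close> concerns the class
  \<open>f\<^sup>[\<^sup>1\<^sup>]\<close> modulo \<open>|dP|\<close>-null sets, hence the existence of a suitable representative \<open>g\<close>; it is unique
  on \<open>(0,\<infinity>)\<close>, since \<open>|dP|\<close>-null sets are Lebesgue null sets. \<open>k\<close> is the derivative of \<open>g\<close>.
\<close>

definition tau :: "(real set \<Rightarrow> real) \<Rightarrow> (real \<Rightarrow> real) \<Rightarrow> (real \<Rightarrow> complex) \<Rightarrow> (real \<Rightarrow> complex) \<Rightarrow> bool"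
  where
  "tau \<nu> q f h \<longleftrightarrow>
     (\<exists>g k. quasi_deriv (dP \<nu>) f g \<and> quasi_deriv leb g k \<and>
        (AE x in lebesgue_on {0<..}. h x = - k x + of_real (q x) * f x))"

definition H_max :: "(real set \<Rightarrow> real) \<Rightarrow> (real \<Rightarrow> real) \<Rightarrow> graph" where
  "H_max \<nu> q = {(f, h). f \<in> L2 \<and> h \<in> L2 \<and> tau \<nu> q f h}"

definition H_D :: "(real set \<Rightarrow> real) \<Rightarrow> (real \<Rightarrow> real) \<Rightarrow> graph" where
  "H_D \<nu> q = {(f, h) \<in> H_max \<nu> q. (f \<longlongrightarrow> 0) (at_right 0)}"

definition H_min :: "(real set \<Rightarrow> real) \<Rightarrow> (real \<Rightarrow> real) \<Rightarrow> graph" where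
  "H_min \<nu> q = adjoint_graph (H_D \<nu> q)"

end

theory Submission
  imports Defs
begin

text \<open>
  Variation of constants shows that the adjoint of the restriction \<open>T0\<close> of \<open>H\<^sub>D\<close> to functions vanishing
  near infinity is \<open>H\<^sub>D\<close> again. As \<open>T0\<close> is contained in \<open>H\<^sub>m\<^sub>i\<^sub>n\<close>, it remains to prove that \<open>H\<^sub>D\<close> is
  symmetric. Let \<open>\<gamma>\<close> be a lower bound of \<open>H\<^sub>m\<^sub>i\<^sub>n\<close>, put \<open>\<mu> = \<gamma> - 1\<close>, and let \<open>s\<close> be the real solution of
  \<open>\<tau> s = \<mu> s\<close> with \<open>s(0) = 0\<close> and \<open>s\<^sup>[\<^sup>1\<^sup>](0) = 1\<close>. If \<open>H\<^sub>D\<close> is not symmetric, then the Wronskian of two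
  elements of its domain has a nonzero limit at infinity, which forces \<open>s\<close> to be square integrable
  (Weyl). On the other hand, each of the conditions (i)-(iii) provides, for every \<open>X\<close>, a cutoff function
  \<open>\<phi>\<close> with \<open>\<phi> = 1\<close> on \<open>(0, X)\<close>, with \<open>\<bar>\<phi>'\<bar> \<le> K\<close> for some \<open>K\<close> independent of \<open>X\<close>, and with \<open>\<phi>'\<close> vanishing
  on the support of \<open>d\<nu>\<close>. Then \<open>\<phi> s\<close> belongs to \<open>T0\<close> and
  \<open>\<langle>\<tau>(\<phi> s), \<phi> s\<rangle> = \<mu> \<parallel>\<phi> s\<parallel>\<^sup>2 + \<integral>\<phi>'\<^sup>2 s\<^sup>2\<close>, so that \<open>\<parallel>\<phi> s\<parallel>\<^sup>2 \<le> K\<^sup>2 \<integral>\<^sub>X\<^sup>\<infinity> s\<^sup>2\<close>, and \<open>X \<rightarrow> \<infinity>\<close> gives the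
  contradiction \<open>s = 0\<close> (Wienholtz).
\<close>

section \<open>Charges\<close>

text \<open>The measure dP is signed, so the quadratic form of \<tau> has no positive leading part,
  and a cutoff must be chosen with care. The quasi-derivative of \<phi> s is \<phi> s^[1] + \<phi>'
  s dx/dP, where dx/dP is 0 on a null set carrying d\<nu> and 1 elsewhere; in general this has no
  absolutely continuous representative. Hence \<phi>' has to vanish on the support of d\<nu>, and
  the gaps must give \<phi> room to fall from 1 to 0 with a slope bounded uniformly in X.

  To avoid densities, \<tau> f = h is written as the system f = a + \<integral> g dP, g = b +
  \<integral> (q f - h) dx over (0, x), and integrals against dP are split along the Jordan parts.
  Finiteness of |d\<nu>| and integrability of q near 0 allow starting at 0. In every product that is
  differentiated one factor is a Lebesgue primitive, hence continuous, so atoms of dP leave no jump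
  terms.

  The choice \<mu> = \<gamma> - 1 leaves exactly one copy of the squared norm of \<phi> s.
  Singularity of d\<nu> makes f determine g; thus \<tau> is single-valued and \<open>T0\<close> is
  dense.\<close>

lemma rc_borelD: "A \<in> rc_borel \<Longrightarrow> A \<in> sets borel"
  by (simp add: rc_borel_def)

lemma rc_borel_subset: "A \<in> rc_borel \<Longrightarrow> B \<subseteq> A \<Longrightarrow> B \<in> sets borel \<Longrightarrow> B \<in> rc_borel"
  unfolding rc_borel_def by blast

lemma rc_borel_empty [simp]: "{} \<in> rc_borel"
  unfolding rc_borel_def by (simp, metis zero_less_one)

lemma rc_borel_Un: "A \<in> rc_borel \<Longrightarrow> B \<in> rc_borel \<Longrightarrow> A \<union> B \<in> rc_borel"
proof -
  assume "A \<in> rc_borel" "B \<in> rc_borel"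
  then obtain c d c' d' where "0 < c" "A \<subseteq> {c..d}" "0 < c'" "B \<subseteq> {c'..d'}"
    and "A \<in> sets borel" "B \<in> sets borel"
    unfolding rc_borel_def by blast
  then have "0 < min c c'" "A \<union> B \<subseteq> {min c c'..max d d'}" "A \<union> B \<in> sets borel"
    by (auto simp: min_le_iff_disj le_max_iff_disj)
  then show ?thesis unfolding rc_borel_def by blast
qed

lemma rc_borel_interval: "0 < c \<Longrightarrow> {c..<d} \<in> rc_borel"
proof -
  assume "0 < c"
  moreover have "{c..<d} \<subseteq> {c..d}" by auto
  moreover have "{c..<d} \<in> sets borel" by simp
  ultimately show ?thesis unfolding rc_borel_def by blast
qed

lemma rc_borel_pos: "A \<in> rc_borel \<Longrightarrow> A \<subseteq> {0<..}"
  unfolding rc_borel_def by (auto dest!: subsetD)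

lemma charge_empty:
  assumes "is_charge \<mu>" shows "\<mu> {} = 0"
proof -
  have "range (\<lambda>n::nat. {}::real set) \<subseteq> rc_borel" by auto
  then have "(\<lambda>n::nat. \<mu> {}) sums \<mu> {}"
    using assms[unfolded is_charge_def, rule_format, of "\<lambda>_. {}"] by (simp add: disjoint_family_on_def)
  then have "summable (\<lambda>n::nat. \<mu> {})" by (rule sums_summable)
  then show ?thesis by (simp add: summable_const_iff)
qed

lemma charge_Un:
  assumes "is_charge \<mu>" "A \<in> rc_borel" "B \<in> rc_borel" "A \<inter> B = {}"
  shows "\<mu> (A \<union> B) = \<mu> A + \<mu> B"
proof -
  define X where "X = (\<lambda>n::nat. if n = 0 then A else if n = 1 then B else {})"
  have U: "(\<Union>n. X n) = A \<union> B"
  proof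
    show "(\<Union>n. X n) \<subseteq> A \<union> B" unfolding X_def by (auto split: if_splits)
    have "A \<subseteq> X 0" "B \<subseteq> X 1" unfolding X_def by auto
    then show "A \<union> B \<subseteq> (\<Union>n. X n)" by blast
  qed
  have "range X \<subseteq> rc_borel" using assms unfolding X_def by auto
  moreover have "disjoint_family X" unfolding X_def disjoint_family_on_def using assms(4) by auto
  moreover have "(\<Union>n. X n) \<in> rc_borel" unfolding U using assms rc_borel_Un by blast
  ultimately have "(\<lambda>n. \<mu> (X n)) sums \<mu> (A \<union> B)"
    using assms(1) unfolding is_charge_def U[symmetric] by blast
  moreover have "(\<lambda>n. \<mu> (X n)) sums (\<Sum>n\<in>{0,1}. \<mu> (X n))"
    by (rule sums_finite) (auto simp: X_def charge_empty[OF assms(1)])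
  ultimately have "\<mu> (A \<union> B) = (\<Sum>n\<in>{0,1}. \<mu> (X n))" by (rule sums_unique2)
  then show ?thesis by (simp add: X_def)
qed

lemma charge_finite_UN:
  fixes n :: nat
  assumes "is_charge \<mu>" "\<And>i. i < n \<Longrightarrow> B i \<in> rc_borel" "disjoint_family_on B {..<n}"
  shows "(\<Union>i<n. B i) \<in> rc_borel \<and> \<mu> (\<Union>i<n. B i) = (\<Sum>i<n. \<mu> (B i))"
  using assms(2,3)
proof (induct n)
  case 0
  then show ?case using charge_empty[OF assms(1)] by simp
next
  case (Suc n)
  have IH: "(\<Union>i<n. B i) \<in> rc_borel" "\<mu> (\<Union>i<n. B i) = (\<Sum>i<n. \<mu> (B i))"
    using Suc.hyps Suc.prems by (auto simp: disjoint_family_on_def)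
  have "B n \<inter> (\<Union>i<n. B i) = {}" 
  proof -
    have "B n \<inter> B i = {}" if "i < n" for i
      using Suc.prems(2) that unfolding disjoint_family_on_def
      by (metis lessThan_iff less_Suc_eq less_irrefl)
    then show ?thesis by blast
  qed
  moreover have "(\<Union>i<Suc n. B i) = B n \<union> (\<Union>i<n. B i)" by (simp add: lessThan_Suc)
  ultimately show ?case
    using charge_Un[OF assms(1) _ IH(1), of "B n"] IH rc_borel_Un[OF _ IH(1), of "B n"] Suc.prems(1)[of n]
    by simp
qed

section \<open>Jordan parts of a charge\<close>

lemma sets_pos_part [simp, measurable_cong]: "sets (pos_part \<mu>) = sets borel"
  and sets_neg_part [simp, measurable_cong]: "sets (neg_part \<mu>) = sets borel"
  and space_pos_part [simp]: "space (pos_part \<mu>) = UNIV"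
  and space_neg_part [simp]: "space (neg_part \<mu>) = UNIV"
  unfolding pos_part_def neg_part_def
  using sets.sigma_sets_eq[of borel] sets.space_closed[of borel]
  by (simp_all add: sets_measure_of_conv space_measure_of_conv)

text \<open>\<open>measure_of\<close> returns the prescribed set function only if this is a measure,
  so countable additivity of the supremum has to be shown. For \<le>, a set inside the union is cut
  into its traces on the \<open>F i\<close>; for \<ge>, sets chosen inside finitely many
  \<open>F i\<close> are united to a set that is again in \<open>rc_borel\<close>.\<close>

lemma emeasure_pos_part:
  assumes \<mu>: "is_charge \<mu>" and A: "A \<in> sets borel"
  shows "emeasure (pos_part \<mu>) A = (SUP B\<in>{B \<in> rc_borel. B \<subseteq> A}. ennreal (\<mu> B))"
proof -
  define m where "m A = (SUP B\<in>{B \<in> rc_borel. B \<subseteq> A}. ennreal (\<mu> B))" for A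
  have upper: "ennreal (\<mu> B) \<le> m A" if "B \<in> rc_borel" "B \<subseteq> A" for A B
    unfolding m_def by (rule SUP_upper) (use that in auto)
  have m_empty: "m {} = 0"
  proof -
    have "{B \<in> rc_borel. B \<subseteq> {}} = {{}}" by auto
    then show ?thesis unfolding m_def using charge_empty[OF \<mu>] by simp
  qed
  have "countably_additive (sets borel) m"
    unfolding countably_additive_def
  proof (intro allI impI)
    fix F :: "nat \<Rightarrow> real set"
    assume F: "range F \<subseteq> sets borel" "disjoint_family F" "\<Union> (range F) \<in> sets borel"
    have "m (\<Union> (range F)) \<le> (\<Sum>i. m (F i))"
      unfolding m_def[of "\<Union> (range F)"]
    proof (rule SUP_least)
      fix B assume "B \<in> {B \<in> rc_borel. B \<subseteq> \<Union> (range F)}"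
      then have B: "B \<in> rc_borel" "B \<subseteq> \<Union> (range F)" by auto
      have BF: "B \<inter> F i \<in> rc_borel" for i
        using F(1) B(1) by (intro rc_borel_subset[OF B(1)]) (auto dest: rc_borelD)
      have U: "(\<Union>i. B \<inter> F i) = B" using B(2) by auto
      have "disjoint_family (\<lambda>i. B \<inter> F i)" using F(2) unfolding disjoint_family_on_def by blast
      then have s: "(\<lambda>i. \<mu> (B \<inter> F i)) sums \<mu> B"
        using \<mu> BF B(1) unfolding is_charge_def
        by (metis U image_subsetI)
      have "(\<lambda>n. ennreal (\<Sum>i<n. \<mu> (B \<inter> F i))) \<longlonglongrightarrow> ennreal (\<mu> B)"
        using s unfolding sums_def by (intro tendsto_ennrealI)
      moreover have "ennreal (\<Sum>i<n. \<mu> (B \<inter> F i)) \<le> (\<Sum>i. m (F i))" for n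
      proof -
        have "ennreal (\<Sum>i<n. \<mu> (B \<inter> F i)) \<le> ennreal (\<Sum>i<n. max 0 (\<mu> (B \<inter> F i)))"
          by (intro ennreal_leI sum_mono) auto
        also have "\<dots> = (\<Sum>i<n. ennreal (max 0 (\<mu> (B \<inter> F i))))"
          by (rule sum_ennreal[symmetric]) auto
        also have "\<dots> \<le> (\<Sum>i<n. m (F i))"
        proof (rule sum_mono)
          fix i show "ennreal (max 0 (\<mu> (B \<inter> F i))) \<le> m (F i)"
            using upper[OF BF[of i], of "F i"] by (auto simp: max_def)
        qed
        also have "\<dots> \<le> (\<Sum>i. m (F i))" by (rule sum_le_suminf) auto
        finally show ?thesis .
      qed
      ultimately show "ennreal (\<mu> B) \<le> (\<Sum>i. m (F i))"
        by (intro LIMSEQ_le_const2[of _ "ennreal (\<mu> B)"]) auto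
    qed
    moreover have "(\<Sum>i. m (F i)) \<le> m (\<Union> (range F))"
    proof (rule suminf_le_const)
      fix n
      show "(\<Sum>i<n. m (F i)) \<le> m (\<Union> (range F))"
      proof -
        define C where "C i = {B \<in> rc_borel. B \<subseteq> F i \<and> 0 \<le> \<mu> B}" for i
        have Cne: "C i \<noteq> {}" for i unfolding C_def using charge_empty[OF \<mu>]
          by (auto intro!: exI[of _ "{}"])
        have mC: "m (F i) = (SUP B\<in>C i. ennreal (\<mu> B))" for i
        proof (rule antisym)
          show "m (F i) \<le> (SUP B\<in>C i. ennreal (\<mu> B))"
            unfolding m_def
          proof (rule SUP_least)
            fix B assume B: "B \<in> {B \<in> rc_borel. B \<subseteq> F i}"
            show "ennreal (\<mu> B) \<le> (SUP B\<in>C i. ennreal (\<mu> B))"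
            proof (cases "0 \<le> \<mu> B")
              case True
              with B show ?thesis by (intro SUP_upper) (auto simp: C_def)
            next
              case False
              then show ?thesis by (simp add: ennreal_neg)
            qed
          qed
          show "(SUP B\<in>C i. ennreal (\<mu> B)) \<le> m (F i)"
            unfolding m_def by (rule SUP_subset_mono) (auto simp: C_def)
        qed
        \<comment> \<open>A sum of suprema is bounded once all sums of chosen members are. The
          suprema are resolved one at a time, and \<open>e\<close> carries the terms of larger index
          along.\<close>
        have *: "(\<Sum>i<k. m (F i)) + e \<le> M" 
          if "\<And>B. (\<And>i. i < k \<Longrightarrow> B i \<in> C i) \<Longrightarrow> ennreal (\<Sum>i<k. \<mu> (B i)) + e \<le> M" for k e M
          using that
        proof (induction k arbitrary: e)
          case 0
          then show ?case by simp
        next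
          case (Suc k)
          have "(\<Sum>i<k. m (F i)) + (m (F k) + e) \<le> M"
          proof (rule Suc.IH)
            fix B assume B: "\<And>i. i < k \<Longrightarrow> B i \<in> C i"
            have "ennreal (\<Sum>i<k. \<mu> (B i)) + e + m (F k) = (SUP b\<in>C k. ennreal (\<Sum>i<k. \<mu> (B i)) + e + ennreal (\<mu> b))"
              unfolding mC using Cne by (simp add: ennreal_SUP_add_right)
            also have "\<dots> \<le> M"
            proof (rule SUP_least)
              fix b assume b: "b \<in> C k"
              have nn: "0 \<le> (\<Sum>i<k. \<mu> (B i))" using B by (intro sum_nonneg) (auto simp: C_def)
              have "(\<Sum>i<Suc k. \<mu> ((B(k := b)) i)) = (\<Sum>i<k. \<mu> (B i)) + \<mu> b" by simp
              then have "ennreal ((\<Sum>i<k. \<mu> (B i)) + \<mu> b) + e \<le> M"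
              proof -
                have "(B(k := b)) i \<in> C i" if "i < Suc k" for i
                  using that B b by (auto simp: less_Suc_eq)
                from Suc.prems[OF this] show ?thesis by simp
              qed
              then show "ennreal (\<Sum>i<k. \<mu> (B i)) + e + ennreal (\<mu> b) \<le> M"
                using nn b by (simp add: C_def ac_simps)
            qed
            finally show "ennreal (\<Sum>i<k. \<mu> (B i)) + (m (F k) + e) \<le> M" by (simp add: ac_simps)
          qed
          then show ?case by (simp add: ac_simps)
        qed
        have "(\<Sum>i<n. m (F i)) + 0 \<le> m (\<Union> (range F))"
        proof (rule *)
          fix B assume B: "\<And>i. i < n \<Longrightarrow> B i \<in> C i"
          have "disjoint_family_on B {..<n}"
            using F(2) B unfolding disjoint_family_on_def C_def by (simp, blast)
          then have "(\<Union>i<n. B i) \<in> rc_borel" "\<mu> (\<Union>i<n. B i) = (\<Sum>i<n. \<mu> (B i))"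
            using charge_finite_UN[OF \<mu>, of n B] B unfolding C_def by auto
          moreover have "(\<Union>i<n. B i) \<subseteq> \<Union> (range F)" using B unfolding C_def by blast
          ultimately show "ennreal (\<Sum>i<n. \<mu> (B i)) + 0 \<le> m (\<Union> (range F))"
            using upper[of "\<Union>i<n. B i" "\<Union> (range F)"] by simp
        qed
        then show ?thesis by simp
      qed
    qed auto
    ultimately show "(\<Sum>i. m (F i)) = m (\<Union> (range F))" by simp
  qed
  moreover have "positive (sets borel) m" unfolding positive_def using m_empty by simp
  moreover have "sigma_algebra UNIV (sets (borel :: real measure))"
    using sets.sigma_algebra_axioms[of "borel :: real measure"] by simp
  ultimately show ?thesis
    unfolding pos_part_def m_def[symmetric] using A by (intro emeasure_measure_of_sigma)
qed

lemma is_charge_uminus: "is_charge \<mu> \<Longrightarrow> is_charge (\<lambda>A. - \<mu> A)"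
  unfolding is_charge_def by (intro allI impI sums_minus) auto

lemma emeasure_neg_part:
  assumes "is_charge \<mu>" "A \<in> sets borel"
  shows "emeasure (neg_part \<mu>) A = (SUP B\<in>{B \<in> rc_borel. B \<subseteq> A}. ennreal (- \<mu> B))"
  unfolding neg_part_def by (rule emeasure_pos_part[OF is_charge_uminus]) fact+

section \<open>Lebesgue measure and dP as charges\<close>

lemma rc_borel_finite_lborel: "A \<in> rc_borel \<Longrightarrow> emeasure lborel A < \<infinity>"
proof -
  assume "A \<in> rc_borel"
  then obtain c d where "A \<subseteq> {c..d}" "A \<in> sets borel" unfolding rc_borel_def by blast
  then have "emeasure lborel A \<le> emeasure lborel {c..d}" by (intro emeasure_mono) auto
  also have "\<dots> < \<infinity>" by (cases "c \<le> d") auto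
  finally show ?thesis .
qed

lemma ennreal_leb: "A \<in> rc_borel \<Longrightarrow> ennreal (leb A) = emeasure lborel A"
  unfolding leb_def using rc_borel_finite_lborel[of A]
  by (simp add: emeasure_eq_ennreal_measure less_top[symmetric])

lemma is_charge_leb: "is_charge leb"
  unfolding is_charge_def leb_def
proof (intro allI impI)
  fix A :: "nat \<Rightarrow> real set"
  assume "range A \<subseteq> rc_borel \<and> disjoint_family A \<and> (\<Union>n. A n) \<in> rc_borel"
  then show "(\<lambda>n. measure lborel (A n)) sums measure lborel (\<Union>n. A n)"
    using rc_borel_finite_lborel[of "\<Union>n. A n"]
    by (intro measure_UNION) (auto dest: rc_borelD)
qed

lemma is_charge_add: "is_charge \<mu> \<Longrightarrow> is_charge \<mu>' \<Longrightarrow> is_charge (\<lambda>A. \<mu> A + \<mu>' A)"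
  unfolding is_charge_def by (intro allI impI sums_add) auto

lemma is_charge_dP: "is_charge \<nu> \<Longrightarrow> is_charge (dP \<nu>)"
  using is_charge_add[OF is_charge_leb, of \<nu>] unfolding dP_def[abs_def] .

text \<open>The supremum is approached along the traces of \<open>A\<close> on the intervals
  [1/n, n], which lie in \<open>rc_borel\<close> and increase to the part of \<open>A\<close> in the
  half line.\<close>

lemma SUP_leb:
  assumes "A \<in> sets borel"
  shows "(SUP B\<in>{B \<in> rc_borel. B \<subseteq> A}. ennreal (leb B)) = emeasure lborel (A \<inter> {0<..})"
proof (rule antisym)
  show "(SUP B\<in>{B \<in> rc_borel. B \<subseteq> A}. ennreal (leb B)) \<le> emeasure lborel (A \<inter> {0<..})"
    using assms
    by (intro SUP_least) (auto simp: ennreal_leb dest: rc_borel_pos rc_borelD intro!: emeasure_mono)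
  define X where "X n = A \<inter> {1 / real (Suc n)..real (Suc n)}" for n
  have X: "X n \<in> rc_borel" for n
  proof -
    have "0 < 1 / real (Suc n)" "X n \<subseteq> {1 / real (Suc n)..real (Suc n)}" "X n \<in> sets borel"
      unfolding X_def using assms by auto
    then show ?thesis unfolding rc_borel_def by blast
  qed
  have "incseq X" unfolding X_def incseq_Suc_iff
  proof
    fix n
    have "1 / real (Suc (Suc n)) \<le> 1 / real (Suc n)" by (simp add: field_simps)
    then show "A \<inter> {1 / real (Suc n)..real (Suc n)} \<subseteq> A \<inter> {1 / real (Suc (Suc n))..real (Suc (Suc n))}"
      by (intro Int_mono atLeastatMost_subset_iff[THEN iffD2]) auto
  qed
  then have "(\<lambda>n. emeasure lborel (X n)) \<longlonglongrightarrow> emeasure lborel (\<Union>n. X n)"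
    using X by (intro Lim_emeasure_incseq) (auto dest: rc_borelD)
  moreover have "(\<Union>n. X n) = A \<inter> {0<..}"
  proof
    show "(\<Union>n. X n) \<subseteq> A \<inter> {0<..}" using X rc_borel_pos unfolding X_def by blast
    show "A \<inter> {0<..} \<subseteq> (\<Union>n. X n)"
    proof
      fix x assume x: "x \<in> A \<inter> {0<..}"
      obtain n where n: "max x (1/x) < real n" using reals_Archimedean2 by blast
      then have "x \<le> real (Suc n)" "1 / real (Suc n) \<le> x" using x by (auto simp: field_simps)
      then show "x \<in> (\<Union>n. X n)" unfolding X_def using x by auto
    qed
  qed
  ultimately have lim: "(\<lambda>n. emeasure lborel (X n)) \<longlonglongrightarrow> emeasure lborel (A \<inter> {0<..})" by simp
  show "emeasure lborel (A \<inter> {0<..}) \<le> (SUP B\<in>{B \<in> rc_borel. B \<subseteq> A}. ennreal (leb B))"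
  proof (rule LIMSEQ_le_const2[OF lim], intro exI allI impI)
    fix n
    have "ennreal (leb (X n)) \<le> (SUP B\<in>{B \<in> rc_borel. B \<subseteq> A}. ennreal (leb B))"
      by (rule SUP_upper) (use X in \<open>auto simp: X_def\<close>)
    then show "emeasure lborel (X n) \<le> (SUP B\<in>{B \<in> rc_borel. B \<subseteq> A}. ennreal (leb B))"
      by (simp add: ennreal_leb X)
  qed
qed

lemma emeasure_pos_part_leb:
  "A \<in> sets borel \<Longrightarrow> emeasure (pos_part leb) A = emeasure lborel (A \<inter> {0<..})"
  by (simp add: emeasure_pos_part is_charge_leb SUP_leb)

lemma emeasure_neg_part_leb: "A \<in> sets borel \<Longrightarrow> emeasure (neg_part leb) A = 0"
proof -
  assume A: "A \<in> sets borel"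
  have "emeasure (neg_part leb) A \<le> 0"
    unfolding emeasure_neg_part[OF is_charge_leb A]
    by (rule SUP_least) (simp add: leb_def ennreal_neg)
  then show ?thesis by simp
qed

lemma pos_part_negative_axis:
  assumes "is_charge \<mu>" "A \<in> sets borel" "A \<inter> {0<..} = {}"
  shows "emeasure (pos_part \<mu>) A = 0"
proof -
  have "B = {}" if "B \<in> rc_borel" "B \<subseteq> A" for B
    using that assms(3) rc_borel_pos by blast
  then have "{B \<in> rc_borel. B \<subseteq> A} = {{}}" by auto
  then show ?thesis unfolding emeasure_pos_part[OF assms(1,2)] by (simp add: charge_empty assms(1))
qed

lemma total_var_zeroD:
  assumes "is_charge \<mu>" "total_var \<mu> A = 0" "A \<in> sets borel" "B \<in> rc_borel" "B \<subseteq> A"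
  shows "\<mu> B = 0"
proof -
  have "ennreal (\<mu> B) \<le> emeasure (pos_part \<mu>) A"
    unfolding emeasure_pos_part[OF assms(1,3)] by (rule SUP_upper) (use assms in auto)
  moreover have "ennreal (- \<mu> B) \<le> emeasure (neg_part \<mu>) A"
    unfolding emeasure_neg_part[OF assms(1,3)] by (rule SUP_upper) (use assms in auto)
  ultimately have "ennreal (\<mu> B) = 0" "ennreal (- \<mu> B) = 0"
    using assms(2) unfolding total_var_def by auto
  then show ?thesis by (simp add: ennreal_eq_0_iff)
qed

text \<open>The Jordan parts are suprema over subsets in \<open>rc_borel\<close>, and on subsets of
  a |d\<nu>|-null set the charges \<open>dP \<nu>\<close> and \<open>leb\<close> have the same
  values.\<close>

lemma dP_parts_off_support:
  assumes \<nu>: "is_charge \<nu>" and tv: "total_var \<nu> A = 0" and A: "A \<in> sets borel"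
    and B: "B \<in> sets borel" "B \<subseteq> A" "B \<subseteq> {0<..}"
  shows "emeasure (pos_part (dP \<nu>)) B = emeasure lborel B"
    and "emeasure (neg_part (dP \<nu>)) B = 0"
proof -
  have eq: "dP \<nu> C = leb C" if "C \<in> {C \<in> rc_borel. C \<subseteq> B}" for C
    using total_var_zeroD[OF \<nu> tv A, of C] that B by (auto simp: dP_def)
  have "B \<inter> {0<..} = B" using B by auto
  then show "emeasure (pos_part (dP \<nu>)) B = emeasure lborel B"
    unfolding emeasure_pos_part[OF is_charge_dP[OF \<nu>] B(1)]
    using SUP_leb[OF B(1)] SUP_cong[OF refl, of "{C \<in> rc_borel. C \<subseteq> B}" "\<lambda>C. ennreal (dP \<nu> C)"
    "\<lambda>C. ennreal (leb C)"] eq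
      \<open>B \<inter> {0<..} = B\<close> by simp
  have "emeasure (neg_part (dP \<nu>)) B \<le> 0"
    unfolding emeasure_neg_part[OF is_charge_dP[OF \<nu>] B(1)]
  proof (rule SUP_least)
    fix C assume "C \<in> {C \<in> rc_borel. C \<subseteq> B}"
    then show "ennreal (- dP \<nu> C) \<le> 0" using eq[of C] by (simp add: leb_def ennreal_neg)
  qed
  then show "emeasure (neg_part (dP \<nu>)) B = 0" by simp
qed

text \<open>Finiteness up to the endpoint 0 is what lets all later primitives start at 0. Lebesgue
  measure adds nothing to the negative part.\<close>

lemma dP_parts_finite:
  assumes \<nu>: "is_charge \<nu>" and tv: "total_var \<nu> {0<..<c} < \<infinity>"
  shows "emeasure (pos_part (dP \<nu>)) {0<..<c} < \<infinity>" "emeasure (neg_part (dP \<nu>)) {0<..<c} < \<infinity>"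
proof -
  have fin: "emeasure (pos_part \<nu>) {0<..<c} < \<infinity>" "emeasure (neg_part \<nu>) {0<..<c} < \<infinity>"
    using tv unfolding total_var_def by (auto simp: less_top[symmetric])
  have "emeasure (pos_part (dP \<nu>)) {0<..<c} \<le> emeasure lborel {0<..<c} + emeasure (pos_part \<nu>) {0<..<c}"
    unfolding emeasure_pos_part[OF is_charge_dP[OF \<nu>] borel_open[OF open_greaterThanLessThan]]
  proof (rule SUP_least)
    fix B assume B: "B \<in> {B \<in> rc_borel. B \<subseteq> {0<..<c}}"
    have "ennreal (dP \<nu> B) \<le> ennreal (leb B + max 0 (\<nu> B))" unfolding dP_def by (intro ennreal_leI) auto
    also have "\<dots> = ennreal (leb B) + ennreal (max 0 (\<nu> B))" by (simp add: leb_def)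
    also have "\<dots> \<le> emeasure lborel {0<..<c} + emeasure (pos_part \<nu>) {0<..<c}"
    proof (rule add_mono)
      show "ennreal (leb B) \<le> emeasure lborel {0<..<c}"
        using B by (auto simp: ennreal_leb intro: emeasure_mono)
      have "ennreal (\<nu> B) \<le> emeasure (pos_part \<nu>) {0<..<c}"
        unfolding emeasure_pos_part[OF \<nu> borel_open[OF open_greaterThanLessThan]]
        by (rule SUP_upper) (use B in auto)
      then show "ennreal (max 0 (\<nu> B)) \<le> emeasure (pos_part \<nu>) {0<..<c}" by (auto simp: max_def)
    qed
    finally show "ennreal (dP \<nu> B) \<le> emeasure lborel {0<..<c} + emeasure (pos_part \<nu>) {0<..<c}" .
  qed
  also have "\<dots> < \<infinity>" using fin(1) by (cases "0 \<le> c") auto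
  finally show "emeasure (pos_part (dP \<nu>)) {0<..<c} < \<infinity>" .
  have "emeasure (neg_part (dP \<nu>)) {0<..<c} \<le> emeasure (neg_part \<nu>) {0<..<c}"
    unfolding emeasure_neg_part[OF is_charge_dP[OF \<nu>] borel_open[OF open_greaterThanLessThan]]
      emeasure_neg_part[OF \<nu> borel_open[OF open_greaterThanLessThan]]
    by (rule SUP_mono) (auto simp: dP_def leb_def intro!: ennreal_leI)
  then show "emeasure (neg_part (dP \<nu>)) {0<..<c} < \<infinity>" using fin(2) by simp
qed

text \<open>The complement of the support is a union of possibly uncountably many open null sets;
  Lindelof's theorem leaves countably many of them.\<close>

lemma total_var_off_charge_supp:
  assumes \<nu>: "is_charge \<nu>"
  shows "open ({0<..} - charge_supp \<nu>)" "total_var \<nu> ({0<..} - charge_supp \<nu>) = 0"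
proof -
  define \<U> where "\<U> = {U. open U \<and> total_var \<nu> U = 0}"
  have eq: "{0<..} - charge_supp \<nu> = {0<..} \<inter> \<Union>\<U>"
  proof -
    have "\<not> 0 < total_var \<nu> U \<longleftrightarrow> total_var \<nu> U = 0" for U by (rule not_gr_zero)
    then show ?thesis unfolding charge_supp_def \<U>_def by blast
  qed
  show "open ({0<..} - charge_supp \<nu>)"
    unfolding eq by (intro open_Int open_Union) (auto simp: \<U>_def)
  obtain \<V> where \<V>: "\<V> \<subseteq> \<U>" "countable \<V>" "\<Union>\<V> = \<Union>\<U>"
    using Lindelof[of \<U>] unfolding \<U>_def by auto
  have null: "U \<in> null_sets (pos_part \<nu>)" "U \<in> null_sets (neg_part \<nu>)" if "U \<in> \<V>" for U
    using that \<V>(1) unfolding \<U>_def total_var_def by (auto simp: null_sets_def)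
  have "\<Union>\<V> \<in> null_sets (pos_part \<nu>)" "\<Union>\<V> \<in> null_sets (neg_part \<nu>)"
    using null_sets_UN'[OF \<V>(2), of "\<lambda>U. U"] null by auto
  then have "{0<..} \<inter> \<Union>\<U> \<in> null_sets (pos_part \<nu>)" "{0<..} \<inter> \<Union>\<U> \<in> null_sets (neg_part \<nu>)"
    unfolding \<V>(3) by (intro null_set_Int1; simp)+
  then show "total_var \<nu> ({0<..} - charge_supp \<nu>) = 0" unfolding eq total_var_def
    by (simp add: null_setsD1)
qed

section \<open>Primitives\<close>

text \<open>The open interval omits an atom at \<open>x\<close>, which yields the left-continuous
  representative; increments are integrals over \<open>{c..<d}\<close>.\<close>

definition prim :: "real measure \<Rightarrow> (real \<Rightarrow> 'a::{banach, second_countable_topology}) \<Rightarrow> real \<Rightarrow> 'a" where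
  "prim N u x = (LINT t:{0<..<x}|N. u t)"

text \<open>Integrability down to 0, not only on compact subintervals of the half line, expresses
  regularity at 0.\<close>

definition loc :: "real measure \<Rightarrow> (real \<Rightarrow> 'a::{banach, second_countable_topology}) \<Rightarrow> bool" where
  "loc N u \<longleftrightarrow> (\<forall>c. set_integrable N {0<..<c} u)"

lemma locD: "loc N u \<Longrightarrow> set_integrable N {0<..<c} u"
  by (simp add: loc_def)

lemma prim_nonpos [simp]: "x \<le> 0 \<Longrightarrow> prim N u x = 0"
  by (simp add: prim_def set_lebesgue_integral_def)

lemma prim_cong: "(\<And>t. 0 < t \<Longrightarrow> t < x \<Longrightarrow> u t = v t) \<Longrightarrow> prim N u x = prim N v x"
  unfolding prim_def set_lebesgue_integral_def
  by (intro Bochner_Integration.integral_cong) (auto simp: indicator_def)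

lemma prim_vanishing:
  assumes "\<And>t. c \<le> t \<Longrightarrow> u t = 0" "c \<le> x"
  shows "prim N u x = prim N u c"
  unfolding prim_def set_lebesgue_integral_def
proof (intro Bochner_Integration.integral_cong refl)
  show "indicator {0<..<x} t *\<^sub>R u t = indicator {0<..<c} t *\<^sub>R u t" for t
    using assms(1)[of t] assms(2) by (auto simp: indicator_def)
qed

lemma prim_vanishing_lim:
  assumes "\<And>t. c \<le> t \<Longrightarrow> w t = 0"
  shows "(\<lambda>n. prim N w (real n)) \<longlonglongrightarrow> prim N w c"
proof (rule tendsto_eventually)
  obtain n0 where n0: "c < real n0" using reals_Archimedean2 by blast
  show "eventually (\<lambda>n. prim N w (real n) = prim N w c) sequentially"
    using eventually_ge_at_top[of n0]
  proof eventually_elim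
    fix n assume "n0 \<le> n"
    then show "prim N w (real n) = prim N w c" using n0 by (intro prim_vanishing assms) auto
  qed
qed

lemma borel_measurable_cnj: "f \<in> borel_measurable borel \<Longrightarrow> (\<lambda>x. cnj (f x)) \<in> borel_measurable borel"
  by (rule measurable_compose[of f borel borel cnj]) (auto intro!: borel_measurable_continuous_onI continuous_intros)

lemma prim_add: "loc N u \<Longrightarrow> loc N v \<Longrightarrow> prim N (\<lambda>t. u t + v t) x = prim N u x + prim N v x"
  unfolding prim_def loc_def by (intro set_integral_add) auto

lemma prim_diff: "loc N u \<Longrightarrow> loc N v \<Longrightarrow> prim N (\<lambda>t. u t - v t) x = prim N u x - prim N v x"
  unfolding prim_def loc_def by (intro set_integral_diff) auto

lemma prim_mult:
  fixes u :: "real \<Rightarrow> 'a::{real_normed_field, banach, second_countable_topology}"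
  shows "prim N (\<lambda>t. c * u t) x = c * prim N u x"
  unfolding prim_def by (rule set_integral_mult_right)

lemma prim_cnj: "prim N (\<lambda>t. cnj (u t)) x = cnj (prim N u x)"
proof -
  have "prim N (\<lambda>t. cnj (u t)) x = (LINT t|N. cnj (indicator {0<..<x} t *\<^sub>R u t))"
    unfolding prim_def set_lebesgue_integral_def by simp
  also have "\<dots> = cnj (prim N u x)"
    unfolding prim_def set_lebesgue_integral_def by (rule Bochner_Integration.integral_cnj)
  finally show ?thesis .
qed

lemma prim_of_real: "prim N (\<lambda>t. complex_of_real (u t)) x = of_real (prim N u x)"
  unfolding prim_def by (rule set_integral_complex_of_real)

lemma loc_add: "loc N u \<Longrightarrow> loc N v \<Longrightarrow> loc N (\<lambda>t. u t + v t)"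
  and loc_diff: "loc N u \<Longrightarrow> loc N v \<Longrightarrow> loc N (\<lambda>t. u t - v t)"
  unfolding loc_def by auto

lemma loc_mult:
  fixes u :: "real \<Rightarrow> 'a::{real_normed_field, banach, second_countable_topology}"
  shows "loc N u \<Longrightarrow> loc N (\<lambda>t. c * u t)"
  unfolding loc_def by auto

lemma loc_norm: "loc N u \<Longrightarrow> loc N (\<lambda>t. norm (u t))"
proof -
  assume "loc N u"
  then have "integrable N (\<lambda>t. norm (indicator {0<..<c} t *\<^sub>R u t))" for c
    unfolding loc_def set_integrable_def by (intro Bochner_Integration.integrable_norm) blast
  then show ?thesis unfolding loc_def set_integrable_def by simp
qed

lemma loc_cnj: "loc N u \<Longrightarrow> loc N (\<lambda>t. cnj (u t))"
proof -
  assume "loc N u"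
  then have "integrable N (\<lambda>t. cnj (indicator {0<..<c} t *\<^sub>R u t))" for c
    unfolding loc_def set_integrable_def by (simp only: complex_integrable_cnj)
  then show ?thesis unfolding loc_def set_integrable_def by simp
qed

lemma loc_of_real: "loc N u \<Longrightarrow> loc N (\<lambda>t. complex_of_real (u t))"
  unfolding loc_def using complex_of_real_integrable_eq
  by (simp add: set_integrable_def scaleR_conv_of_real flip: of_real_mult)

lemma prim_incr:
  assumes u: "loc N u" and N: "sets N = sets borel" and cd: "0 < c" "c \<le> d"
  shows "prim N u d - prim N u c = (LINT t:{c..<d}|N. u t)"
proof -
  have "set_integrable N {0<..<c} u" "set_integrable N {c..<d} u"
    using u N cd by (auto intro!: locD intro: set_integrable_subset[OF locD[OF u, of d]])
  moreover have "{0<..<d} = {0<..<c} \<union> {c..<d}" "{0<..<c} \<inter> {c..<d} = {}" using cd by auto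
  ultimately show ?thesis unfolding prim_def by (simp add: set_integral_Un)
qed

lemma prim_real_mono:
  fixes u v :: "real \<Rightarrow> real"
  assumes "loc N u" "loc N v" "\<And>t. 0 < t \<Longrightarrow> t < x \<Longrightarrow> u t \<le> v t"
  shows "prim N u x \<le> prim N v x"
  unfolding prim_def by (rule set_integral_mono) (use assms in \<open>auto simp: loc_def\<close>)

lemma prim_nonneg:
  fixes u :: "real \<Rightarrow> real"
  assumes "\<And>t. 0 < t \<Longrightarrow> t < x \<Longrightarrow> 0 \<le> u t"
  shows "0 \<le> prim N u x"
  unfolding prim_def set_lebesgue_integral_def
  by (rule Bochner_Integration.integral_nonneg) (use assms in \<open>auto simp: indicator_def\<close>)

lemma prim_mono_bound:
  fixes u :: "real \<Rightarrow> real"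
  assumes "loc N u" "sets N = sets borel" "\<And>t. 0 < t \<Longrightarrow> 0 \<le> u t" "x \<le> y"
  shows "prim N u x \<le> prim N u y"
  unfolding prim_def set_lebesgue_integral_def
proof (rule integral_mono)
  show "integrable N (\<lambda>t. indicator {0<..<x} t *\<^sub>R u t)"
    "integrable N (\<lambda>t. indicator {0<..<y} t *\<^sub>R u t)"
    using locD[OF assms(1)] unfolding set_integrable_def by auto
  show "indicator {0<..<x} t *\<^sub>R u t \<le> indicator {0<..<y} t *\<^sub>R u t" for t
    using assms(3)[of t] assms(4) by (auto simp: indicator_def)
qed

lemma prim_norm: "norm (prim N u x) \<le> prim N (\<lambda>t. norm (u t)) x"
proof -
  have "norm (prim N u x) \<le> (LINT t|N. norm (indicator {0<..<x} t *\<^sub>R u t))"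
    unfolding prim_def set_lebesgue_integral_def by (rule integral_norm_bound)
  then show ?thesis unfolding prim_def set_lebesgue_integral_def by simp
qed

lemma prim_bounded:
  assumes "loc N u" "sets N = sets borel" "x \<le> c"
  shows "norm (prim N u x) \<le> prim N (\<lambda>t. norm (u t)) c"
  using prim_norm prim_mono_bound[OF loc_norm[OF assms(1)] assms(2) _ assms(3)]
  by (rule order_trans) simp

lemma loc_bound:
  fixes w :: "real \<Rightarrow> real"
  assumes "loc N w" and N: "sets N = sets borel" and "u \<in> borel_measurable borel"
    and "\<And>c. \<exists>K. \<forall>t. 0 < t \<longrightarrow> t < c \<longrightarrow> norm (u t) \<le> K * \<bar>w t\<bar>"
  shows "loc N u"
  unfolding loc_def
proof
  fix c
  obtain K where K: "\<And>t. 0 < t \<Longrightarrow> t < c \<Longrightarrow> norm (u t) \<le> K * \<bar>w t\<bar>" using assms(4)[of c] by auto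
  have "set_integrable N {0<..<c} (\<lambda>t. K * w t)" using locD[OF assms(1)] by auto
  then show "set_integrable N {0<..<c} u"
  proof (rule set_integrable_bound)
    have [measurable]: "u \<in> borel_measurable N" using assms(3) N by (simp cong: measurable_cong_sets)
    have [measurable]: "{0<..<c} \<in> sets N" using N by simp
    show "set_borel_measurable N {0<..<c} u" unfolding set_borel_measurable_def by measurable
    show "AE t in N. t \<in> {0<..<c} \<longrightarrow> norm (u t) \<le> norm (K * w t)"
    proof (intro AE_I2 impI)
      fix t assume "t \<in> {0<..<c}"
      then have "norm (u t) \<le> K * \<bar>w t\<bar>" using K by auto
      also have "\<dots> \<le> \<bar>K\<bar> * \<bar>w t\<bar>" by (intro mult_right_mono) auto
      finally show "norm (u t) \<le> norm (K * w t)" by (simp add: abs_mult)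
    qed
  qed
qed

text \<open>Finite mass of the intervals says nothing about the negative axis, so sigma-finiteness,
  on which Fubini's theorem rests, is asked for separately.\<close>

definition loc_finite :: "real measure \<Rightarrow> bool" where
  "loc_finite N \<longleftrightarrow> sets N = sets borel \<and> sigma_finite_measure N \<and> (\<forall>c. emeasure N {0<..<c} < \<infinity>)"

lemma loc_finite_lborel: "loc_finite lborel"
  unfolding loc_finite_def using lborel.sigma_finite_measure_axioms
  by (auto, case_tac "0 \<le> c", auto)

lemma loc_finiteD: "loc_finite N \<Longrightarrow> sets N = sets borel" "loc_finite N \<Longrightarrow> sigma_finite_measure N"
  unfolding loc_finite_def by auto

lemma loc_const: "loc_finite N \<Longrightarrow> loc N (\<lambda>_. k)"
  unfolding loc_def loc_finite_def set_integrable_def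
  by (intro allI integrable_scaleR_left integrable_real_indicator) auto

lemma loc_locally_bounded:
  assumes N: "loc_finite N" and "u \<in> borel_measurable borel"
    and "\<And>c. \<exists>K. \<forall>t. 0 < t \<longrightarrow> t < c \<longrightarrow> norm (u t) \<le> K"
  shows "loc N u"
  by (rule loc_bound[OF loc_const[OF N, of "1::real"]]) (use assms loc_finiteD in auto)

lemma prim_const: "loc_finite N \<Longrightarrow> prim N (\<lambda>_. k) x = measure N {0<..<x} *\<^sub>R k"
  unfolding prim_def set_lebesgue_integral_def loc_finite_def
  by (subst integral_scaleR_left) auto

lemma borel_measurable_prim:
  assumes N: "loc_finite N" and [measurable]: "u \<in> borel_measurable borel"
  shows "prim N u \<in> borel_measurable borel"
proof -
  interpret sigma_finite_measure N using N by (rule loc_finiteD)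
  have s [measurable_cong]: "sets N = sets borel" using N by (rule loc_finiteD)
  have "(\<lambda>x. LINT t|N. (if 0 < t \<and> t < x then u t else 0)) \<in> borel_measurable borel"
    by measurable
  also have "(\<lambda>x. LINT t|N. (if 0 < t \<and> t < x then u t else 0)) = prim N u"
    unfolding prim_def set_lebesgue_integral_def
    by (intro ext Bochner_Integration.integral_cong) (auto simp: indicator_def)
  finally show ?thesis .
qed

lemma prim_dominated_convergence:
  fixes w :: "real \<Rightarrow> real"
  assumes N: "sets N = sets borel" and w: "loc N w"
    and s: "\<And>n. s n \<in> borel_measurable borel" and u: "u \<in> borel_measurable borel"
    and lim: "\<And>t. 0 < t \<Longrightarrow> t < x \<Longrightarrow> (\<lambda>n. s n t) \<longlonglongrightarrow> u t"
    and bd: "\<And>n t. 0 < t \<Longrightarrow> t < x \<Longrightarrow> norm (s n t) \<le> w t"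
  shows "(\<lambda>n. prim N (s n) x) \<longlonglongrightarrow> prim N u x"
  unfolding prim_def set_lebesgue_integral_def
proof (rule integral_dominated_convergence)
  have [measurable]: "u \<in> borel_measurable N" "\<And>n. s n \<in> borel_measurable N" "{0<..<x} \<in> sets N"
    using s u N by (simp_all cong: measurable_cong_sets)
  show "(\<lambda>t. indicator {0<..<x} t *\<^sub>R u t) \<in> borel_measurable N"
    "\<And>n. (\<lambda>t. indicator {0<..<x} t *\<^sub>R s n t) \<in> borel_measurable N" by measurable
  show "integrable N (\<lambda>t. indicator {0<..<x} t *\<^sub>R w t)" using locD[OF w] unfolding set_integrable_def .
  show "AE t in N. (\<lambda>n. indicator {0<..<x} t *\<^sub>R s n t) \<longlonglongrightarrow> indicator {0<..<x} t *\<^sub>R u t"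
    using lim by (auto simp: indicator_def)
  show "AE t in N. norm (indicator {0<..<x} t *\<^sub>R s n t) \<le> indicator {0<..<x} t *\<^sub>R w t" for n
    using bd by (auto simp: indicator_def)
qed

text \<open>Integration by parts is Fubini's theorem on the square (0, x) \<times> (0, x), split
  along the diagonal. As one of the two measures is Lebesgue measure, the diagonal is a null set and
  atoms of \<open>N\<close> leave no jump term.\<close>

lemma prim_product:
  fixes u k :: "real \<Rightarrow> 'a::{real_normed_field, banach, second_countable_topology}"
  assumes N: "loc_finite N" and u: "loc N u" and k: "loc lborel k"
  shows "loc N (\<lambda>s. u s * prim lborel k s)"
    and "loc lborel (\<lambda>t. prim N u t * k t)"
    and "prim N u x * prim lborel k x = prim N (\<lambda>s. u s * prim lborel k s) x + prim lborel (\<lambda>t. prim N u t * k t) x"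
proof -
  interpret N: sigma_finite_measure N using N by (rule loc_finiteD)
  interpret pair_sigma_finite N "lborel :: real measure" ..
  have sN [measurable_cong]: "sets N = sets borel" using N by (rule loc_finiteD)
  have main: "set_integrable N {0<..<x} (\<lambda>s. u s * prim lborel k s) \<and>
     set_integrable lborel {0<..<x} (\<lambda>t. prim N u t * k t) \<and>
     prim N u x * prim lborel k x = prim N (\<lambda>s. u s * prim lborel k s) x + prim lborel (\<lambda>t. prim N u t * k t) x" for x
  proof -
    define u' where "u' s = indicator {0<..<x} s *\<^sub>R u s" for s
    define k' where "k' t = indicator {0<..<x} t *\<^sub>R k t" for t
    have u': "integrable N u'" using locD[OF u, of x] unfolding u'_def set_integrable_def .
    have k': "integrable lborel k'" using locD[OF k, of x] unfolding k'_def set_integrable_def .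
    have [measurable]: "u' \<in> borel_measurable borel" "k' \<in> borel_measurable borel"
      using borel_measurable_integrable[OF u'] borel_measurable_integrable[OF k'] measurable_cong_sets[OF sN refl]
      by simp_all
    have h: "integrable (N \<Otimes>\<^sub>M lborel) (\<lambda>(s, t). u' s * k' t)"
    proof (rule Fubini_integrable)
      show "(\<lambda>(s, t). u' s * k' t) \<in> borel_measurable (N \<Otimes>\<^sub>M lborel)" by measurable
      show "integrable N (\<lambda>s. LINT t|lborel. norm (case (s, t) of (s, t) \<Rightarrow> u' s * k' t))"
        using u' k' by (simp add: norm_mult)
      show "AE s in N. integrable lborel (\<lambda>t. case (s, t) of (s, t) \<Rightarrow> u' s * k' t)"
        using k' by simp
    qed
    have h1: "integrable (N \<Otimes>\<^sub>M lborel) (\<lambda>(s, t). if s < t then u' s * k' t else 0)"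
      by (rule Bochner_Integration.integrable_bound[OF h]) (auto split: if_splits)
    have h2: "integrable (N \<Otimes>\<^sub>M lborel) (\<lambda>(s, t). if s < t then 0 else u' s * k' t)"
      by (rule Bochner_Integration.integrable_bound[OF h]) (auto split: if_splits)
    have in1: "(LINT s|N. (if s < t then u' s * k' t else 0)) = indicator {0<..<x} t *\<^sub>R (prim N u t * k t)" for t
    proof (cases "0 < t \<and> t < x")
      case True
      have "(LINT s|N. (if s < t then u' s * k' t else 0)) = (LINT s|N. (indicator {0<..<t} s *\<^sub>R u s) * k t)"
        using True by (intro Bochner_Integration.integral_cong) (auto simp: u'_def k'_def indicator_def)
      also have "\<dots> = (LINT s|N. indicator {0<..<t} s *\<^sub>R u s) * k t" by (rule integral_mult_left_zero)
      finally show ?thesis using True unfolding prim_def set_lebesgue_integral_def by simp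
    next
      case False
      then have "(if s < t then u' s * k' t else 0) = 0" for s by (auto simp: k'_def)
      with False show ?thesis by simp
    qed
    have in2: "(LINT t|lborel. (if s < t then 0 else u' s * k' t)) = indicator {0<..<x} s *\<^sub>R (u s * prim lborel k s)" for s
    proof (cases "0 < s \<and> s < x")
      case True
      have "(LINT t|lborel. (if s < t then 0 else u' s * k' t)) = (LINT t|lborel. u s * (indicator {0<..<s} t *\<^sub>R k t))"
      proof (rule integral_cong_AE)
        have eq: "indicator {0<..<s} t *\<^sub>R k t = indicator {0<..<s} t *\<^sub>R k' t" for t
          using True by (auto simp: k'_def indicator_def)
        show "(\<lambda>t. u s * (indicator {0<..<s} t *\<^sub>R k t)) \<in> borel_measurable lborel"
          unfolding eq by measurable
        \<comment> \<open>The inner integral runs over t \<le> s, the primitive over t < s; they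
          differ at one point.\<close>
        have "AE t in lborel. t \<noteq> s" by (rule AE_lborel_singleton)
        then show "AE t in lborel. (if s < t then 0 else u' s * k' t) = u s * (indicator {0<..<s} t *\<^sub>R k t)"
          by eventually_elim (use True in \<open>auto simp: u'_def k'_def indicator_def\<close>)
      qed simp
      also have "\<dots> = u s * (LINT t|lborel. indicator {0<..<s} t *\<^sub>R k t)"
        by (rule integral_mult_right_zero)
      finally show ?thesis using True unfolding prim_def set_lebesgue_integral_def by simp
    next
      case False
      then have "(if s < t then 0 else u' s * k' t) = 0" for t by (auto simp: u'_def)
      with False show ?thesis by simp
    qed
    have "prim N u x * prim lborel k x = (LINT s|N. u' s) * (LINT t|lborel. k' t)"
      unfolding prim_def set_lebesgue_integral_def u'_def k'_def by simp
    also have "\<dots> = (LINT s|N. u' s * (LINT t|lborel. k' t))"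
      by (rule integral_mult_left_zero[symmetric])
    also have "\<dots> = (LINT s|N. (LINT t|lborel. u' s * k' t))"
      by simp
    also have "\<dots> = (LINT p|(N \<Otimes>\<^sub>M lborel). (case p of (s, t) \<Rightarrow> u' s * k' t))"
      using integral_fst'[OF h] by simp
    also have "\<dots> = (LINT p|(N \<Otimes>\<^sub>M lborel). (case p of (s, t) \<Rightarrow> if s < t then u' s * k' t else 0)
         + (case p of (s, t) \<Rightarrow> if s < t then 0 else u' s * k' t))"
      by (intro Bochner_Integration.integral_cong) auto
    also have "\<dots> = (LINT p|(N \<Otimes>\<^sub>M lborel). (case p of (s, t) \<Rightarrow> if s < t then u' s * k' t else 0))
         + (LINT p|(N \<Otimes>\<^sub>M lborel). (case p of (s, t) \<Rightarrow> if s < t then 0 else u' s * k' t))"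
      by (rule Bochner_Integration.integral_add[OF h1 h2])
    also have "\<dots> = (LINT t|lborel. LINT s|N. (if s < t then u' s * k' t else 0))
         + (LINT s|N. LINT t|lborel. (if s < t then 0 else u' s * k' t))"
      using integral_snd[OF h1] integral_fst'[OF h2] by simp
    finally have eq: "prim N u x * prim lborel k x = prim N (\<lambda>s. u s * prim lborel k s) x + prim lborel (\<lambda>t. prim N u t * k t) x"
      unfolding in1 in2 by (simp add: prim_def set_lebesgue_integral_def)
    have "set_integrable lborel {0<..<x} (\<lambda>t. prim N u t * k t)"
      using integrable_snd[OF h1] unfolding in1 set_integrable_def .
    moreover have "set_integrable N {0<..<x} (\<lambda>s. u s * prim lborel k s)"
      using integrable_fst'[OF h2] unfolding prod.case in2 set_integrable_def .
    ultimately show ?thesis using eq by blast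
  qed
  then show "loc N (\<lambda>s. u s * prim lborel k s)" "loc lborel (\<lambda>t. prim N u t * k t)"
    "prim N u x * prim lborel k x = prim N (\<lambda>s. u s * prim lborel k s) x + prim lborel (\<lambda>t. prim N u t * k t) x"
    unfolding loc_def by blast+
qed

text \<open>The chain rule for powers of a primitive, by induction with \<open>prim_product\<close>.
  It produces the factorials in the Volterra iteration.\<close>

lemma prim_power:
  fixes r :: "real \<Rightarrow> real"
  assumes r: "loc lborel r"
  shows "loc lborel (\<lambda>t. r t * prim lborel r t ^ n)"
    and "prim lborel (\<lambda>t. r t * prim lborel r t ^ n) x = prim lborel r x ^ Suc n / real (Suc n)"
proof -
  have "loc lborel (\<lambda>t. r t * prim lborel r t ^ n) \<and>
     (\<forall>x. prim lborel (\<lambda>t. r t * prim lborel r t ^ n) x = prim lborel r x ^ Suc n / real (Suc n))"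
  proof (induction n)
    case 0
    then show ?case using r by simp
  next
    case (Suc n)
    let ?R = "prim lborel r"
    let ?u = "\<lambda>t. real (Suc n) * (r t * ?R t ^ n)"
    have u: "loc lborel ?u" using Suc.IH by (intro loc_mult) auto
    have pu: "prim lborel ?u t = ?R t ^ Suc n" for t using Suc.IH
      by (simp add: prim_mult del: of_nat_Suc)
    have 1: "loc lborel (\<lambda>t. ?R t ^ Suc n * r t)"
      using prim_product(2)[OF loc_finite_lborel u r] unfolding pu .
    have eq: "?u s * ?R s = real (Suc n) * (?R s ^ Suc n * r s)" for s by simp
    have "?R x ^ Suc n * ?R x = prim lborel (\<lambda>s. ?u s * ?R s) x + prim lborel (\<lambda>t. ?R t ^ Suc n * r t) x" for x
      using prim_product(3)[OF loc_finite_lborel u r, of x] unfolding pu .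
    then have "?R x ^ Suc n * ?R x = real (Suc n) * prim lborel (\<lambda>t. ?R t ^ Suc n * r t) x + prim lborel (\<lambda>t. ?R t ^ Suc n * r t) x" for x
      unfolding eq prim_mult .
    then have "?R x ^ Suc (Suc n) = real (Suc (Suc n)) * prim lborel (\<lambda>t. ?R t ^ Suc n * r t) x" for x
      by (simp add: algebra_simps)
    then show ?case using 1 by (simp add: mult.commute[of _ "r _"] field_simps)
  qed
  then show "loc lborel (\<lambda>t. r t * prim lborel r t ^ n)"
    "prim lborel (\<lambda>t. r t * prim lborel r t ^ n) x = prim lborel r x ^ Suc n / real (Suc n)" by auto
qed

section \<open>The integral system\<close>

locale sl_system =
  fixes M1 M2 :: "real measure" and q :: "real \<Rightarrow> real"
  assumes M1: "loc_finite M1" and M2: "loc_finite M2"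
    and q_meas [measurable]: "q \<in> borel_measurable borel" and q_loc: "loc lborel q"
begin

text \<open>\<open>M1\<close> and \<open>M2\<close> stand for the positive and the negative part of
  dP, so this is the integral of \<open>g\<close> against dP over (0, x).\<close>

definition IP :: "(real \<Rightarrow> complex) \<Rightarrow> real \<Rightarrow> complex" where
  "IP g x = prim M1 g x - prim M2 g x"

definition locP :: "(real \<Rightarrow> complex) \<Rightarrow> bool" where
  "locP g \<longleftrightarrow> loc M1 g \<and> loc M2 g"

definition var :: "real \<Rightarrow> real" where
  "var c = measure M1 {0<..<c} + measure M2 {0<..<c}"

definition locally_bounded :: "(real \<Rightarrow> complex) \<Rightarrow> bool" where
  "locally_bounded g \<longleftrightarrow> g \<in> borel_measurable borel \<and> (\<forall>c. \<exists>K. \<forall>t. 0 < t \<longrightarrow> t \<le> c \<longrightarrow> norm (g t) \<le> K)"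

text \<open>The equation \<tau> f = h as a first-order system: \<open>g\<close> is the
  quasi-derivative of \<open>f\<close>, and \<open>a\<close>, \<open>b\<close> are the limits of
  \<open>f\<close> and \<open>g\<close> at 0. Asking for the primitives at every \<open>x\<close>
  fixes the left-continuous representatives.\<close>

definition sol :: "(real \<Rightarrow> complex) \<Rightarrow> (real \<Rightarrow> complex) \<Rightarrow> (real \<Rightarrow> complex) \<Rightarrow> complex \<Rightarrow> complex \<Rightarrow> bool" where
  "sol h f g a b \<longleftrightarrow> h \<in> borel_measurable borel \<and> loc lborel h
     \<and> f \<in> borel_measurable borel \<and> loc lborel (\<lambda>t. of_real (q t) * f t)
     \<and> (\<forall>x. f x = a + IP g x) \<and> (\<forall>x. g x = b + prim lborel (\<lambda>t. of_real (q t) * f t - h t) x)"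

lemma q_loc_complex: "loc lborel (\<lambda>t. complex_of_real (q t))"
  using q_loc by (rule loc_of_real)

lemma locally_bounded_locP: "locally_bounded g \<Longrightarrow> locP g"
  unfolding locP_def locally_bounded_def
  by (meson M1 M2 loc_locally_bounded less_imp_le)

lemma locally_bounded_loc: "locally_bounded g \<Longrightarrow> loc lborel g"
  unfolding locally_bounded_def
  by (meson loc_finite_lborel loc_locally_bounded less_imp_le)

lemma locally_bounded_prim:
  assumes N: "loc_finite N" and "loc N u" "u \<in> borel_measurable borel"
  shows "locally_bounded (prim N u)"
  unfolding locally_bounded_def
  using borel_measurable_prim[OF N assms(3)] prim_bounded[OF assms(2) loc_finiteD(1)[OF N]] by blast

lemma locally_bounded_add: 
  assumes "locally_bounded f" "locally_bounded g" shows "locally_bounded (\<lambda>x. f x + g x)"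
proof -
  have "\<exists>K. \<forall>t. 0 < t \<longrightarrow> t \<le> c \<longrightarrow> norm (f t + g t) \<le> K" for c
  proof -
    obtain K K' where "\<forall>t. 0 < t \<longrightarrow> t \<le> c \<longrightarrow> norm (f t) \<le> K" "\<forall>t. 0 < t \<longrightarrow> t \<le> c \<longrightarrow> norm (g t) \<le> K'"
      using assms unfolding locally_bounded_def by meson
    then show ?thesis by (intro exI[of _ "K + K'"]) (auto intro: norm_triangle_le add_mono)
  qed
  then show ?thesis using assms unfolding locally_bounded_def by auto
qed

lemma locally_bounded_mult: 
  assumes "locally_bounded f" "locally_bounded g" shows "locally_bounded (\<lambda>x. f x * g x)"
proof -
  have "\<exists>K. \<forall>t. 0 < t \<longrightarrow> t \<le> c \<longrightarrow> norm (f t * g t) \<le> K" for c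
  proof -
    obtain K K' where "\<forall>t. 0 < t \<longrightarrow> t \<le> c \<longrightarrow> norm (f t) \<le> K" "\<forall>t. 0 < t \<longrightarrow> t \<le> c \<longrightarrow> norm (g t) \<le> K'"
      using assms unfolding locally_bounded_def by meson
    then show ?thesis
      by (intro exI[of _ "K * K'"]) (auto simp: norm_mult intro!: mult_mono intro: order_trans[OF norm_ge_zero])
  qed
  then show ?thesis using assms unfolding locally_bounded_def by auto
qed

lemma locally_bounded_const: "locally_bounded (\<lambda>_. k)"
  unfolding locally_bounded_def by auto

lemma locally_bounded_cnj: "locally_bounded f \<Longrightarrow> locally_bounded (\<lambda>x. cnj (f x))"
  unfolding locally_bounded_def by (auto intro: borel_measurable_cnj)

lemma loc_times_locally_bounded:
  fixes u :: "real \<Rightarrow> complex"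
  assumes "loc lborel u" "u \<in> borel_measurable borel" "locally_bounded f"
  shows "loc lborel (\<lambda>t. u t * f t)"
proof (rule loc_bound[OF loc_norm[OF assms(1)]])
  show "(\<lambda>t. u t * f t) \<in> borel_measurable borel" using assms unfolding locally_bounded_def by auto
  show "\<exists>K. \<forall>t. 0 < t \<longrightarrow> t < c \<longrightarrow> norm (u t * f t) \<le> K * \<bar>norm (u t)\<bar>" for c
  proof -
    obtain K where "\<forall>t. 0 < t \<longrightarrow> t \<le> c \<longrightarrow> norm (f t) \<le> K" using assms(3) unfolding locally_bounded_def
      by meson
    then show ?thesis
      by (intro exI[of _ K]) (auto simp: norm_mult mult.commute[of K] intro!: mult_left_mono)
  qed
qed simp

lemma locally_bounded_IP: "locally_bounded g \<Longrightarrow> locally_bounded (IP g)"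
proof -
  assume g: "locally_bounded g"
  have gm: "g \<in> borel_measurable borel" and l: "loc M1 g" "loc M2 g"
    using g locally_bounded_locP[OF g] unfolding locally_bounded_def locP_def by auto
  have "locally_bounded (prim M1 g)" by (rule locally_bounded_prim[OF M1 l(1) gm])
  moreover have "locally_bounded (\<lambda>x. (-1) * prim M2 g x)"
    by (rule locally_bounded_mult[OF locally_bounded_const locally_bounded_prim[OF M2 l(2) gm]])
  ultimately have "locally_bounded (\<lambda>x. prim M1 g x + (-1) * prim M2 g x)"
    by (rule locally_bounded_add)
  then show ?thesis unfolding IP_def[abs_def] by simp
qed

lemma IP_add: "locP u \<Longrightarrow> locP v \<Longrightarrow> IP (\<lambda>t. u t + v t) x = IP u x + IP v x"
  and IP_diff: "locP u \<Longrightarrow> locP v \<Longrightarrow> IP (\<lambda>t. u t - v t) x = IP u x - IP v x"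
  and IP_mult: "IP (\<lambda>t. c * u t) x = c * IP u x"
  and IP_cnj: "IP (\<lambda>t. cnj (u t)) x = cnj (IP u x)"
  unfolding IP_def locP_def by (simp_all add: prim_add prim_diff prim_mult prim_cnj algebra_simps)

lemma IP_cong: "(\<And>t. 0 < t \<Longrightarrow> t < x \<Longrightarrow> u t = v t) \<Longrightarrow> IP u x = IP v x"
  unfolding IP_def using prim_cong[of x u v] by metis

lemma var_nonneg: "0 \<le> var c" unfolding var_def by simp

lemma var_mono: assumes "c \<le> d" shows "var c \<le> var d"
proof -
  have "measure N {0<..<c} \<le> measure N {0<..<d}" if "loc_finite N" for N
    using that assms unfolding loc_finite_def measure_def 
    by (intro enn2real_mono emeasure_mono) (auto simp: less_top[symmetric])
  from this[OF M1] this[OF M2] show ?thesis unfolding var_def by simp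
qed

lemma IP_bound:
  assumes "locP u" and K: "\<And>t. 0 < t \<Longrightarrow> t < x \<Longrightarrow> norm (u t) \<le> K"
  shows "norm (IP u x) \<le> var x * K"
proof -
  have *: "norm (prim N u x) \<le> measure N {0<..<x} * K" if "loc_finite N" "loc N u" for N
  proof -
    have "norm (prim N u x) \<le> prim N (\<lambda>t. norm (u t)) x" by (rule prim_norm)
    also have "\<dots> \<le> prim N (\<lambda>_. K) x" 
      using that by (intro prim_real_mono loc_norm loc_const K)
    finally show ?thesis using prim_const[OF that(1), of K x] by simp
  qed
  have "norm (IP u x) \<le> norm (prim M1 u x) + norm (prim M2 u x)" unfolding IP_def
    by (rule norm_triangle_ineq4)
  also have "\<dots> \<le> measure M1 {0<..<x} * K + measure M2 {0<..<x} * K"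
    using assms(1) M1 M2 unfolding locP_def by (intro add_mono *) auto
  finally show ?thesis unfolding var_def by (simp add: algebra_simps)
qed

text \<open>This is d(F G) = G u dP + F k dx. It is \<open>prim_product\<close> for
  \<open>M1\<close> minus the same for \<open>M2\<close>, after splitting off the constants
  \<open>a\<close> and \<open>b\<close>.\<close>

lemma IP_product:
  assumes F: "\<And>x. F x = a + IP u x" and u: "locP u"
    and G: "\<And>x. G x = b + prim lborel k x" and k: "loc lborel k"
  shows "locP (\<lambda>s. u s * G s)" "loc lborel (\<lambda>t. F t * k t)"
    and "F x * G x = a * b + IP (\<lambda>s. u s * G s) x + prim lborel (\<lambda>t. F t * k t) x"
proof -
  have u12: "loc M1 u" "loc M2 u" using u unfolding locP_def by auto
  note p1 = prim_product[OF M1 u12(1) k] and p2 = prim_product[OF M2 u12(2) k]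
  have ug: "loc N (\<lambda>s. u s * G s) \<and> prim N (\<lambda>s. u s * G s) x = b * prim N u x + prim N (\<lambda>s. u s * prim lborel k s) x"
    if "loc N u" "loc N (\<lambda>s. u s * prim lborel k s)" for N x
  proof -
    have "(\<lambda>s. u s * G s) = (\<lambda>s. b * u s + u s * prim lborel k s)" unfolding G
      by (simp add: algebra_simps)
    then show ?thesis using that loc_mult[OF that(1), of b] by (simp add: loc_add prim_add prim_mult)
  qed
  show "locP (\<lambda>s. u s * G s)" unfolding locP_def using ug u12 p1 p2 by blast
  have eq: "(\<lambda>t. F t * k t) = (\<lambda>t. (a * k t + prim M1 u t * k t) - prim M2 u t * k t)"
    unfolding F IP_def by (simp add: algebra_simps)
  show "loc lborel (\<lambda>t. F t * k t)" unfolding eq using p1 p2 k by (intro loc_diff loc_add loc_mult)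
  have "prim lborel (\<lambda>t. F t * k t) x = a * prim lborel k x + prim lborel (\<lambda>t. prim M1 u t * k t) x - prim lborel (\<lambda>t. prim M2 u t * k t) x"
    unfolding eq using p1 p2 k by (simp add: prim_diff prim_add loc_add loc_mult prim_mult)
  then show "F x * G x = a * b + IP (\<lambda>s. u s * G s) x + prim lborel (\<lambda>t. F t * k t) x"
    using ug[OF u12(1) p1(1), of x] ug[OF u12(2) p2(1), of x] p1(3)[of x] p2(3)[of x]
    unfolding F G IP_def by (simp add: algebra_simps)
qed

lemma leb_product:
  fixes u k :: "real \<Rightarrow> complex"
  assumes F: "\<And>x. F x = a + prim lborel u x" and u: "loc lborel u"
    and G: "\<And>x. G x = b + prim lborel k x" and k: "loc lborel k"
  shows "loc lborel (\<lambda>s. u s * G s)" "loc lborel (\<lambda>t. F t * k t)"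
    and "F x * G x = a * b + prim lborel (\<lambda>s. u s * G s + F s * k s) x"
proof -
  note p = prim_product[OF loc_finite_lborel u k]
  have 1: "(\<lambda>s. u s * G s) = (\<lambda>s. b * u s + u s * prim lborel k s)" unfolding G
    by (simp add: algebra_simps)
  have 2: "(\<lambda>t. F t * k t) = (\<lambda>t. a * k t + prim lborel u t * k t)" unfolding F
    by (simp add: algebra_simps)
  show l: "loc lborel (\<lambda>s. u s * G s)" "loc lborel (\<lambda>t. F t * k t)"
    unfolding 1 2 using p u k by (auto intro!: loc_add loc_mult)
  have "prim lborel (\<lambda>s. u s * G s + F s * k s) x = prim lborel (\<lambda>s. u s * G s) x + prim lborel (\<lambda>s. F s * k s) x"
    using l by (rule prim_add)
  also have "\<dots> = b * prim lborel u x + a * prim lborel k x + prim lborel u x * prim lborel k x"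
    unfolding 1 2 p(3) using p u k by (simp add: prim_add loc_mult prim_mult)
  finally show "F x * G x = a * b + prim lborel (\<lambda>s. u s * G s + F s * k s) x"
    unfolding F G by (simp add: algebra_simps)
qed

subsection \<open>Volterra equations\<close>

text \<open>Picard iteration. On (0, c) the inner integral is at most \<open>var c\<close> times the
  supremum of the integrand, so smallness has to come from the outer Lebesgue integral alone: the
  n-th iterate is at most \<open>B * (var c * R)^n / n!\<close>, with \<open>R\<close> the primitive
  of |q|. Atoms of dP, however large, do no harm.\<close>

lemma volterra_exists:
  assumes G0: "locally_bounded G0"
  shows "\<exists>g. locally_bounded g \<and> (\<forall>x. g x = G0 x + prim lborel (\<lambda>t. of_real (q t) * IP g t) x)"
proof -
  define K where "K g x = prim lborel (\<lambda>t. of_real (q t) * IP g t) x" for g x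
  define Kn where "Kn n = (K ^^ n) G0" for n
  have Kn0: "Kn 0 = G0" and KnS: "Kn (Suc n) = K (Kn n)" for n by (simp_all add: Kn_def)
  define R where "R = prim lborel (\<lambda>t. \<bar>q t\<bar>)"
  have absq: "loc lborel (\<lambda>t. \<bar>q t\<bar>)" using loc_norm[OF q_loc] by simp
  have qIP: "loc lborel (\<lambda>t. of_real (q t) * IP g t)"
    "(\<lambda>t. of_real (q t) * IP g t) \<in> borel_measurable borel"
    if "locally_bounded g" for g
    using locally_bounded_IP[OF that] q_loc_complex
    by (auto intro!: loc_times_locally_bounded simp: locally_bounded_def)
  have lbK: "locally_bounded (K g)" if "locally_bounded g" for g
    unfolding K_def using qIP[OF that] by (intro locally_bounded_prim loc_finite_lborel)
  have lb: "locally_bounded (Kn n)" for n by (induction n) (auto simp: Kn0 KnS G0 lbK)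
  have R_mono: "R x \<le> R y" if "x \<le> y" for x y
    unfolding R_def using absq that by (intro prim_mono_bound) auto
  have R0: "0 \<le> R x" for x unfolding R_def by (rule prim_nonneg) auto
  have bound: "norm (Kn n x) \<le> B * (var c * R x) ^ n / fact n"
    if B: "\<And>t. 0 < t \<Longrightarrow> t \<le> c \<Longrightarrow> norm (G0 t) \<le> B" and x: "0 < x" "x \<le> c" for B c n x
    using x
  proof (induction n arbitrary: x)
    case 0
    then show ?case using B by (simp add: Kn0)
  next
    case (Suc n)
    have B0: "0 \<le> B" using B[OF Suc.prems] norm_ge_zero order_trans by blast
    \<comment> \<open>\<open>D\<close> gathers the factors independent of t, so that
      \<open>prim_power\<close> applies to |q| R^n.\<close>
    define D where "D = var c * B * var c ^ n / fact n"
    have D0: "0 \<le> D" unfolding D_def using B0 var_nonneg[of c] by simp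
    have IPb: "norm (IP (Kn n) t) \<le> D * R t ^ n" if t: "0 < t" "t < x" for t
    proof -
      have "norm (IP (Kn n) t) \<le> var t * (B * (var c * R t) ^ n / fact n)"
      proof (rule IP_bound[OF locally_bounded_locP[OF lb]])
        fix s assume s: "0 < s" "s < t"
        have "norm (Kn n s) \<le> B * (var c * R s) ^ n / fact n" using s t Suc.prems by (intro Suc.IH) auto
        also have "\<dots> \<le> B * (var c * R t) ^ n / fact n"
          using R_mono[of s t] s var_nonneg[of c] R0 B0
          by (intro divide_right_mono mult_left_mono power_mono mult_nonneg_nonneg) auto
        finally show "norm (Kn n s) \<le> B * (var c * R t) ^ n / fact n" .
      qed
      also have "\<dots> \<le> var c * (B * (var c * R t) ^ n / fact n)"
        using t Suc.prems B0 R0 var_nonneg[of c] by (intro mult_right_mono var_mono) auto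
      finally show ?thesis unfolding D_def by (simp add: power_mult_distrib algebra_simps)
    qed
    have "norm (Kn (Suc n) x) \<le> prim lborel (\<lambda>t. norm (of_real (q t) * IP (Kn n) t)) x"
      unfolding KnS K_def by (rule prim_norm)
    also have "\<dots> \<le> prim lborel (\<lambda>t. D * (\<bar>q t\<bar> * R t ^ n)) x"
    proof (rule prim_real_mono)
      show "loc lborel (\<lambda>t. norm (of_real (q t) * IP (Kn n) t))" using qIP(1)[OF lb] by (rule loc_norm)
      show "loc lborel (\<lambda>t. D * (\<bar>q t\<bar> * R t ^ n))"
        unfolding R_def by (rule loc_mult[OF prim_power(1)[OF absq]])
      fix t assume t: "0 < t" "t < x"
      have "norm (of_real (q t) * IP (Kn n) t) = \<bar>q t\<bar> * norm (IP (Kn n) t)" by (simp add: norm_mult)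
      also have "\<dots> \<le> \<bar>q t\<bar> * (D * R t ^ n)" using IPb[OF t] by (intro mult_left_mono) auto
      finally show "norm (of_real (q t) * IP (Kn n) t) \<le> D * (\<bar>q t\<bar> * R t ^ n)"
        by (simp add: algebra_simps)
    qed
    also have "\<dots> = D * (R x ^ Suc n / real (Suc n))"
      unfolding prim_mult R_def prim_power(2)[OF absq] ..
    also have "\<dots> = B * (var c * R x) ^ Suc n / fact (Suc n)"
      unfolding D_def by (simp add: power_mult_distrib divide_simps)
    finally show ?case .
  qed
  \<comment> \<open>The bounds on the iterates hold for positive arguments; at x \<le> 0 all
    primitives vanish and the equation reads g = G0.\<close>
  define g where "g x = (if 0 < x then (\<Sum>n. Kn n x) else G0 x)" for x
  have summ: "summable (\<lambda>n. norm (Kn n x))" if x: "0 < x" for x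
  proof -
    obtain B where B: "\<And>t. 0 < t \<Longrightarrow> t \<le> x \<Longrightarrow> norm (G0 t) \<le> B" using G0 unfolding locally_bounded_def
      by meson
    have "summable (\<lambda>n. B * ((var x * R x) ^ n /\<^sub>R fact n))"
      by (intro summable_mult summable_exp_generic)
    then show ?thesis
      by (rule summable_comparison_test'[where N = 0]) (use bound[OF B x order_refl] in \<open>simp add: field_simps\<close>)
  qed
  have partial: "norm (\<Sum>n<m. Kn n x) \<le> B * exp (var c * R c)" 
    if B: "\<And>t. 0 < t \<Longrightarrow> t \<le> c \<Longrightarrow> norm (G0 t) \<le> B" and x: "0 < x" "x \<le> c" for B c m x
  proof -
    have B0: "0 \<le> B" using B[OF x] norm_ge_zero order_trans by blast
    have "norm (\<Sum>n<m. Kn n x) \<le> (\<Sum>n<m. B * ((var c * R c) ^ n /\<^sub>R fact n))"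
    proof (rule sum_norm_le)
      fix n
      have "norm (Kn n x) \<le> B * (var c * R x) ^ n / fact n" by (rule bound[OF B x])
      also have "\<dots> \<le> B * (var c * R c) ^ n / fact n"
          using R_mono[OF x(2)] var_nonneg[of c] R0 B0
          by (intro divide_right_mono mult_left_mono power_mono mult_nonneg_nonneg) auto
      finally show "norm (Kn n x) \<le> B * ((var c * R c) ^ n /\<^sub>R fact n)" by (simp add: field_simps)
    qed
    also have "\<dots> \<le> (\<Sum>n. B * ((var c * R c) ^ n /\<^sub>R fact n))"
      using B0 R0 var_nonneg[of c] by (intro sum_le_suminf summable_mult summable_exp_generic) auto
    also have "\<dots> = B * exp (var c * R c)"
      unfolding exp_def by (rule suminf_mult[OF summable_exp_generic])
    finally show ?thesis .
  qed
  have lim: "(\<lambda>m. \<Sum>n<m. Kn n x) \<longlonglongrightarrow> g x" if "0 < x" for x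
    using summable_LIMSEQ[OF summable_norm_cancel[OF summ[OF that]]] that by (simp add: g_def)
  have Sm: "(\<lambda>x. \<Sum>n<m. Kn n x) \<in> borel_measurable borel" for m
    using lb unfolding locally_bounded_def by (intro borel_measurable_sum) auto
  have gm: "g \<in> borel_measurable borel"
  proof -
    have [measurable]: "\<And>n. Kn n \<in> borel_measurable borel" "G0 \<in> borel_measurable borel"
      using lb G0 unfolding locally_bounded_def by auto
    show ?thesis unfolding g_def[abs_def] by measurable
  qed
  have gb: "norm (g x) \<le> B * exp (var c * R c)" 
    if B: "\<And>t. 0 < t \<Longrightarrow> t \<le> c \<Longrightarrow> norm (G0 t) \<le> B" and x: "0 < x" "x \<le> c" for B c x
    using partial[OF B x] by (intro tendsto_upperbound[OF tendsto_norm[OF lim[OF x(1)]]]) auto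
  have lbg: "locally_bounded g"
    unfolding locally_bounded_def
  proof (intro conjI allI gm)
    fix c
    obtain B where B: "\<And>t. 0 < t \<Longrightarrow> t \<le> c \<Longrightarrow> norm (G0 t) \<le> B" using G0 unfolding locally_bounded_def
      by meson
    show "\<exists>K. \<forall>t. 0 < t \<longrightarrow> t \<le> c \<longrightarrow> norm (g t) \<le> K" using gb[OF B] by blast
  qed
  define S where "S m x = (\<Sum>n<m. Kn n x)" for m x
  have lbS: "locally_bounded (S m)" for m
    unfolding S_def by (induction m) (auto intro!: locally_bounded_add lb locally_bounded_const)
  have K_add: "K (\<lambda>x. u x + v x) x = K u x + K v x" if "locally_bounded u" "locally_bounded v" for u v x
    unfolding K_def
    using that qIP[OF that(1)] qIP[OF that(2)] IP_add[OF locally_bounded_locP locally_bounded_locP, OF that]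
    by (simp add: distrib_left prim_add)
  have S_eq: "S (Suc m) x = G0 x + K (S m) x" for m x
  proof (induction m)
    case 0
    have "IP (S 0) t = 0" for t unfolding S_def IP_def by (simp add: prim_def set_lebesgue_integral_def)
    then show ?case unfolding K_def
      by (simp add: S_def Kn0) (simp add: prim_def set_lebesgue_integral_def)
  next
    case (Suc m)
    have "K (S (Suc m)) x = K (S m) x + K (Kn m) x"
      using K_add[OF lbS lb, of m m x] by (simp add: S_def[abs_def])
    moreover have "S (Suc (Suc m)) x = S (Suc m) x + Kn (Suc m) x" by (simp add: S_def)
    ultimately show ?case using Suc by (simp add: KnS)
  qed
  have "g x = G0 x + K g x" for x
  proof (cases "0 < x")
    case False
    then show ?thesis by (simp add: g_def K_def)
  next
    case True
    obtain B where B: "\<And>t. 0 < t \<Longrightarrow> t \<le> x \<Longrightarrow> norm (G0 t) \<le> B" using G0 unfolding locally_bounded_def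
      by meson
    define C where "C = B * exp (var x * R x)"
    have SC: "norm (S m t) \<le> C" if "0 < t" "t \<le> x" for t m
      unfolding S_def C_def using partial[OF B] that by auto
    \<comment> \<open>Passing to the limit takes dominated convergence twice, first inside
      \<open>IP\<close> with a constant bound, then in the outer integral with a multiple of
      |q|.\<close>
    have IPlim: "(\<lambda>m. IP (S m) t) \<longlonglongrightarrow> IP g t" if "t \<le> x" for t
      unfolding IP_def
      by (intro tendsto_diff prim_dominated_convergence[where w="\<lambda>_. C"] loc_finiteD(1) loc_const M1 M2 gm)
         (use Sm lim SC that in \<open>auto simp: S_def[abs_def]\<close>)
    have "(\<lambda>m. K (S m) x) \<longlonglongrightarrow> K g x"
      unfolding K_def
    proof (rule prim_dominated_convergence[where w="\<lambda>t. (var x * C) * \<bar>q t\<bar>"])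
      show "loc lborel (\<lambda>t. (var x * C) * \<bar>q t\<bar>)" using absq by (rule loc_mult)
      show "\<And>m. (\<lambda>t. of_real (q t) * IP (S m) t) \<in> borel_measurable borel" using qIP(2)[OF lbS] .
      show "(\<lambda>t. of_real (q t) * IP g t) \<in> borel_measurable borel" using qIP(2)[OF lbg] .
      show "(\<lambda>m. of_real (q t) * IP (S m) t) \<longlonglongrightarrow> of_real (q t) * IP g t" if "t < x" for t
        using that by (intro tendsto_mult_left IPlim) auto
      show "norm (of_real (q t) * IP (S m) t) \<le> (var x * C) * \<bar>q t\<bar>" if t: "0 < t" "t < x" for m t
      proof -
        have C0: "0 \<le> C" using SC[OF True order_refl] norm_ge_zero order_trans by blast
        have "norm (IP (S m) t) \<le> var t * C"
          using SC t by (intro IP_bound locally_bounded_locP lbS) auto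
        also have "\<dots> \<le> var x * C" using C0 t by (intro mult_right_mono var_mono) auto
        finally have "\<bar>q t\<bar> * norm (IP (S m) t) \<le> \<bar>q t\<bar> * (var x * C)" by (intro mult_left_mono) auto
        then show ?thesis by (simp add: norm_mult algebra_simps)
      qed
    qed simp
    then have "(\<lambda>m. S (Suc m) x) \<longlonglongrightarrow> G0 x + K g x" unfolding S_eq by (intro tendsto_add tendsto_const)
    moreover have "(\<lambda>m. S (Suc m) x) \<longlonglongrightarrow> g x" using LIMSEQ_Suc[OF lim[OF True]] unfolding S_def .
    ultimately show ?thesis by (rule LIMSEQ_unique[symmetric])
  qed
  then show ?thesis using lbg unfolding K_def by blast
qed

text \<open>Inserting f = a + \<integral> g dP into the second equation leaves a Volterra equation
  for \<open>g\<close> alone; \<open>G0\<close> gathers what does not involve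
  \<open>g\<close>.\<close>

lemma sol_exists:
  assumes h: "h \<in> borel_measurable borel" "loc lborel h"
  shows "\<exists>f g. sol h f g a b"
proof -
  define G0 where "G0 x = b + prim lborel (\<lambda>t. of_real (q t) * a - h t) x" for x
  have qa: "loc lborel (\<lambda>t. of_real (q t) * a)" using loc_mult[OF q_loc_complex, of a]
    by (simp add: mult.commute)
  have "locally_bounded G0"
    unfolding G0_def using h qa
    by (intro locally_bounded_add locally_bounded_const locally_bounded_prim loc_finite_lborel loc_diff) auto
  then obtain g where g: "locally_bounded g"
    "\<And>x. g x = G0 x + prim lborel (\<lambda>t. of_real (q t) * IP g t) x"
    using volterra_exists by blast
  define f where "f x = a + IP g x" for x
  have lf: "locally_bounded f" unfolding f_def using g(1)
    by (intro locally_bounded_add locally_bounded_const locally_bounded_IP)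
  have qI: "loc lborel (\<lambda>t. of_real (q t) * IP g t)"
    using locally_bounded_IP[OF g(1)] q_loc_complex by (intro loc_times_locally_bounded) auto
  have "g x = b + prim lborel (\<lambda>t. of_real (q t) * f t - h t) x" for x
  proof -
    have "(\<lambda>t. of_real (q t) * f t - h t) = (\<lambda>t. (of_real (q t) * a - h t) + of_real (q t) * IP g t)"
      unfolding f_def by (simp add: algebra_simps)
    then show ?thesis unfolding g(2)[of x] G0_def using qI qa h by (simp add: prim_add loc_diff)
  qed
  moreover have "loc lborel (\<lambda>t. of_real (q t) * f t)"
    using lf q_loc_complex by (intro loc_times_locally_bounded) auto
  ultimately have "sol h f g a b" unfolding sol_def using h lf f_def by (simp add: locally_bounded_def)
  then show ?thesis by blast
qed

end

section \<open>Square integrable functions\<close>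

definition sqint :: "'a measure \<Rightarrow> ('a \<Rightarrow> complex) \<Rightarrow> bool" where
  "sqint M f \<longleftrightarrow> f \<in> borel_measurable M \<and> integrable M (\<lambda>x. (norm (f x))\<^sup>2)"

definition nsq :: "'a measure \<Rightarrow> ('a \<Rightarrow> complex) \<Rightarrow> real" where
  "nsq M f = (LINT x|M. (norm (f x))\<^sup>2)"

lemma nsq_nonneg: "0 \<le> nsq M f"
  unfolding nsq_def by simp

lemma sqint_mult: "sqint M f \<Longrightarrow> sqint M (\<lambda>x. c * f x)"
  unfolding sqint_def by (auto simp: norm_mult power_mult_distrib)

lemma nsq_mult: "nsq M (\<lambda>x. c * f x) = (norm c)\<^sup>2 * nsq M f"
  unfolding nsq_def by (simp add: norm_mult power_mult_distrib)

lemma sqint_add: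
  assumes "sqint M f" "sqint M g" shows "sqint M (\<lambda>x. f x + g x)"
proof -
  have [measurable]: "f \<in> borel_measurable M" "g \<in> borel_measurable M" using assms unfolding sqint_def
    by auto
  have "integrable M (\<lambda>x. 2 * (norm (f x))\<^sup>2 + 2 * (norm (g x))\<^sup>2)"
    using assms unfolding sqint_def by auto
  then have "integrable M (\<lambda>x. (norm (f x + g x))\<^sup>2)"
  proof (rule Bochner_Integration.integrable_bound)
    show "AE x in M. norm ((norm (f x + g x))\<^sup>2) \<le> norm (2 * (norm (f x))\<^sup>2 + 2 * (norm (g x))\<^sup>2)"
    proof (rule AE_I2)
      fix x
      have "(norm (f x + g x))\<^sup>2 \<le> (norm (f x) + norm (g x))\<^sup>2"
        by (intro power_mono norm_triangle_ineq) auto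
      also have "\<dots> \<le> 2 * (norm (f x))\<^sup>2 + 2 * (norm (g x))\<^sup>2"
        using sum_squares_ge_zero[of "norm (f x) - norm (g x)" 0]
        by (simp add: power2_eq_square algebra_simps)
      finally show "norm ((norm (f x + g x))\<^sup>2) \<le> norm (2 * (norm (f x))\<^sup>2 + 2 * (norm (g x))\<^sup>2)" by simp
    qed
  qed measurable
  then show ?thesis unfolding sqint_def by simp
qed

lemma sqint_diff: "sqint M f \<Longrightarrow> sqint M g \<Longrightarrow> sqint M (\<lambda>x. f x - g x)"
  using sqint_add[OF _ sqint_mult[of M g "-1"], of f] by simp

lemma sqint_zero: "sqint M (\<lambda>_. 0)"
  unfolding sqint_def by simp

lemma integrable_sqint_norms:
  assumes "sqint M f" "sqint M g"
  shows "integrable M (\<lambda>x. norm (f x) * norm (g x))"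
proof -
  have [measurable]: "f \<in> borel_measurable M" "g \<in> borel_measurable M" using assms unfolding sqint_def
    by auto
  have "integrable M (\<lambda>x. (norm (f x))\<^sup>2 + (norm (g x))\<^sup>2)"
    using assms unfolding sqint_def by auto
  then show ?thesis
  proof (rule Bochner_Integration.integrable_bound)
    show "AE x in M. norm (norm (f x) * norm (g x)) \<le> norm ((norm (f x))\<^sup>2 + (norm (g x))\<^sup>2)"
    proof (rule AE_I2)
      fix x
      have "2 * (norm (f x) * norm (g x)) \<le> (norm (f x))\<^sup>2 + (norm (g x))\<^sup>2"
        using sum_squares_ge_zero[of "norm (f x) - norm (g x)" 0]
        by (simp add: power2_eq_square algebra_simps)
      moreover have "0 \<le> norm (f x) * norm (g x)" by simp
      ultimately show "norm (norm (f x) * norm (g x)) \<le> norm ((norm (f x))\<^sup>2 + (norm (g x))\<^sup>2)"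
        unfolding real_norm_def by linarith
    qed
  qed measurable
qed

lemma sqint_mult_integrable:
  assumes "sqint M f" "sqint M g"
  shows "integrable M (\<lambda>x. f x * g x)"
proof -
  have [measurable]: "f \<in> borel_measurable M" "g \<in> borel_measurable M" using assms unfolding sqint_def
    by auto
  show ?thesis
    by (rule Bochner_Integration.integrable_bound[OF integrable_sqint_norms[OF assms]]) (auto simp: norm_mult)
qed

lemma sqint_cnj: "sqint M f \<Longrightarrow> sqint M (\<lambda>x. cnj (f x))"
  unfolding sqint_def
  by (auto intro!: measurable_compose[of f M borel cnj] borel_measurable_continuous_onI continuous_intros)

lemma cauchy_schwarz_norms:
  assumes f: "sqint M f" and g: "sqint M g"
  shows "(LINT x|M. norm (f x) * norm (g x))\<^sup>2 \<le> nsq M f * nsq M g"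
proof -
  define a where "a = (LINT x|M. norm (f x) * norm (g x))"
  have a0: "0 \<le> a" unfolding a_def by simp
  have int: "integrable M (\<lambda>x. (norm (f x))\<^sup>2)" "integrable M (\<lambda>x. (norm (g x))\<^sup>2)"
    using f g unfolding sqint_def by auto
  have key: "2 * t * a \<le> t\<^sup>2 * nsq M f + nsq M g" for t
  proof -
    have "0 \<le> (LINT x|M. (t * norm (f x) - norm (g x))\<^sup>2)" by simp
    also have "\<dots> = (LINT x|M. t\<^sup>2 * (norm (f x))\<^sup>2 - 2 * t * (norm (f x) * norm (g x)) + (norm (g x))\<^sup>2)"
      by (intro Bochner_Integration.integral_cong) (auto simp: power2_eq_square algebra_simps)
    also have "\<dots> = t\<^sup>2 * nsq M f - 2 * t * a + nsq M g"
      unfolding nsq_def a_def using int integrable_sqint_norms[OF f g]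
      by (simp add: Bochner_Integration.integral_diff Bochner_Integration.integral_add)
    finally show ?thesis by simp
  qed
  show ?thesis
  proof (cases "nsq M f = 0")
    case True
    have "a = 0"
    proof (rule ccontr)
      assume "a \<noteq> 0"
      then have "0 < a" using a0 by simp
      \<comment> \<open>For this value of t the left side of \<open>key\<close> becomes
        \<open>nsq M g + 1\<close>.\<close>
      with key[of "(nsq M g + 1) / (2 * a)"] True show False by (simp add: field_simps)
    qed
    then show ?thesis using nsq_nonneg[of M] by (simp add: a_def[symmetric])
  next
    case False
    then have p: "0 < nsq M f" using nsq_nonneg[of M f] by simp
    from key[of "a / nsq M f"] have "2 * (a\<^sup>2 / nsq M f) \<le> a\<^sup>2 / nsq M f + nsq M g"
      using p by (simp add: power2_eq_square)
    then have "a\<^sup>2 / nsq M f \<le> nsq M g" by simp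
    then show ?thesis using p by (simp add: a_def[symmetric] field_simps)
  qed
qed

lemma cauchy_schwarz:
  assumes "sqint M f" "sqint M g"
  shows "(norm (LINT x|M. f x * g x))\<^sup>2 \<le> nsq M f * nsq M g"
proof -
  have "norm (LINT x|M. f x * g x) \<le> (LINT x|M. norm (f x * g x))" by (rule integral_norm_bound)
  then have "(norm (LINT x|M. f x * g x))\<^sup>2 \<le> (LINT x|M. norm (f x) * norm (g x))\<^sup>2"
    by (intro power_mono) (auto simp: norm_mult)
  also have "\<dots> \<le> nsq M f * nsq M g" by (rule cauchy_schwarz_norms[OF assms])
  finally show ?thesis .
qed

lemma nsq_add:
  assumes f: "sqint M f" and g: "sqint M g"
  shows "nsq M (\<lambda>x. f x + g x) = nsq M f + 2 * Re (LINT x|M. f x * cnj (g x)) + nsq M g"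
proof -
  have int: "integrable M (\<lambda>x. (norm (f x))\<^sup>2)" "integrable M (\<lambda>x. (norm (g x))\<^sup>2)"
    using f g unfolding sqint_def by auto
  have fg: "integrable M (\<lambda>x. f x * cnj (g x))" by (rule sqint_mult_integrable[OF f sqint_cnj[OF g]])
  have eq: "(norm (f x + g x))\<^sup>2 = (norm (f x))\<^sup>2 + 2 * Re (f x * cnj (g x)) + (norm (g x))\<^sup>2" for x
    unfolding cmod_power2 by (simp add: power2_eq_square algebra_simps)
  show ?thesis
    unfolding nsq_def eq using int integrable_Re[OF fg] fg
    by (simp add: Bochner_Integration.integral_add del: times_complex.sel)
qed

lemma nsq_triangle:
  assumes f: "sqint M f" and g: "sqint M g"
  shows "sqrt (nsq M (\<lambda>x. f x + g x)) \<le> sqrt (nsq M f) + sqrt (nsq M g)"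
proof (rule real_le_lsqrt)
  have "\<bar>Re (LINT x|M. f x * cnj (g x))\<bar>\<^sup>2 \<le> (norm (LINT x|M. f x * cnj (g x)))\<^sup>2"
    by (intro power_mono abs_Re_le_cmod) auto
  also have "\<dots> \<le> nsq M f * nsq M (\<lambda>x. cnj (g x))" by (rule cauchy_schwarz[OF f sqint_cnj[OF g]])
  also have "nsq M (\<lambda>x. cnj (g x)) = nsq M g" unfolding nsq_def by simp
  finally have "Re (LINT x|M. f x * cnj (g x)) \<le> sqrt (nsq M f * nsq M g)"
    by (intro real_le_rsqrt) simp
  then show "nsq M (\<lambda>x. f x + g x) \<le> (sqrt (nsq M f) + sqrt (nsq M g))\<^sup>2"
    unfolding nsq_add[OF f g] using nsq_nonneg[of M f] nsq_nonneg[of M g]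
    by (simp add: power2_sum real_sqrt_mult)
qed (use nsq_nonneg[of M f] nsq_nonneg[of M g] in auto)

lemma nsq_zero_AE:
  assumes "sqint M f" "nsq M f = 0" shows "AE x in M. f x = 0"
proof -
  have "AE x in M. (norm (f x))\<^sup>2 = 0"
    using assms integral_nonneg_eq_0_iff_AE[of M "\<lambda>x. (norm (f x))\<^sup>2"] unfolding sqint_def nsq_def
    by simp
  then show ?thesis by simp
qed

text \<open>Riesz-Fischer. Multiplication by a nowhere vanishing square integrable \<open>w\<close>
  turns a Cauchy sequence for \<open>nsq\<close> into one in L1, which has a subsequence converging
  almost everywhere; Fatou's lemma then gives convergence for \<open>nsq\<close>.\<close>

lemma sqint_complete:
  fixes s :: "nat \<Rightarrow> 'a \<Rightarrow> complex"
  assumes M: "sigma_finite_measure M" and s: "\<And>n. sqint M (s n)"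
    and cauchy: "\<And>e. 0 < e \<Longrightarrow> \<exists>N. \<forall>i\<ge>N. \<forall>j\<ge>N. nsq M (\<lambda>x. s i x - s j x) < e"
  shows "\<exists>f. sqint M f \<and> (\<lambda>n. nsq M (\<lambda>x. s n x - f x)) \<longlonglongrightarrow> 0"
proof -
  interpret sigma_finite_measure M by (rule M)
  obtain v :: "'a \<Rightarrow> real" where v [measurable]: "v \<in> borel_measurable M" and v0: "\<And>x. 0 < v x" and vint: "integrable M v"
    using obtain_positive_integrable_function by metis
  \<comment> \<open>The square of \<open>w\<close> is the integrable function \<open>v\<close>;
    positivity of \<open>v\<close> allows dividing by \<open>w\<close> afterwards.\<close>
  define w where "w x = complex_of_real (sqrt (v x))" for x
  have w: "sqint M w" unfolding sqint_def w_def using vint v0 by (simp add: less_imp_le)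
  have w0: "w x \<noteq> 0" for x unfolding w_def using v0[of x] by simp
  have [measurable]: "s n \<in> borel_measurable M" for n using s unfolding sqint_def by auto
  have L1: "integrable M (\<lambda>x. s n x * w x)" for n by (rule sqint_mult_integrable[OF s w])
  have c1: "\<exists>N. \<forall>i\<ge>N. \<forall>j\<ge>N. (LINT x|M. norm (s i x * w x - s j x * w x)) < e" if e: "0 < e" for e
  proof -
    have "0 < e\<^sup>2 / (nsq M w + 1)" using e nsq_nonneg[of M w] by simp
    then obtain N where N: "\<And>i j. i \<ge> N \<Longrightarrow> j \<ge> N \<Longrightarrow> nsq M (\<lambda>x. s i x - s j x) < e\<^sup>2 / (nsq M w + 1)"
      using cauchy by blast
    have "(LINT x|M. norm (s i x * w x - s j x * w x)) < e" if ij: "i \<ge> N" "j \<ge> N" for i j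
    proof -
      have "(LINT x|M. norm (s i x * w x - s j x * w x)) = (LINT x|M. norm (s i x - s j x) * norm (w x))"
        by (intro Bochner_Integration.integral_cong) (auto simp: norm_mult[symmetric] algebra_simps)
      moreover have "(LINT x|M. norm (s i x - s j x) * norm (w x))\<^sup>2 \<le> nsq M (\<lambda>x. s i x - s j x) * nsq M w"
        by (rule cauchy_schwarz_norms[OF sqint_diff[OF s s] w])
      moreover have "nsq M (\<lambda>x. s i x - s j x) * nsq M w \<le> nsq M (\<lambda>x. s i x - s j x) * (nsq M w + 1)"
        using nsq_nonneg[of M] by (intro mult_left_mono) auto
      moreover have "\<dots> < e\<^sup>2" using N[OF ij] nsq_nonneg[of M w] by (simp add: field_simps)
      ultimately have "(LINT x|M. norm (s i x * w x - s j x * w x))\<^sup>2 < e\<^sup>2" by simp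
      then show ?thesis using e by (rule power2_less_imp_less[OF _ less_imp_le])
    qed
    then show ?thesis by blast
  qed
  obtain r where r: "strict_mono r" and AEc: "AE x in M. Cauchy (\<lambda>i. s (r i) x * w x)"
    using cauchy_L1_AE_cauchy_subseq[of M "\<lambda>n x. s n x * w x", OF L1 c1] by blast
  define f where "f x = lim (\<lambda>i. s (r i) x)" for x
  have [measurable]: "f \<in> borel_measurable M" unfolding f_def by measurable
  have AEl: "AE x in M. (\<lambda>i. s (r i) x) \<longlonglongrightarrow> f x"
    using AEc
  proof eventually_elim
    fix x assume "Cauchy (\<lambda>i. s (r i) x * w x)"
    then have "convergent (\<lambda>i. s (r i) x * w x)" by (simp add: Cauchy_convergent_iff)
    then have "convergent (\<lambda>i. s (r i) x * w x * inverse (w x))"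
      by (rule convergent_mult[OF _ convergent_const])
    moreover have "s (r i) x * w x * inverse (w x) = s (r i) x" for i using w0[of x] by simp
    ultimately have "convergent (\<lambda>i. s (r i) x)" by (simp only:)
    then show "(\<lambda>i. s (r i) x) \<longlonglongrightarrow> f x" unfolding f_def by (simp add: convergent_LIMSEQ_iff)
  qed
  \<comment> \<open>Fatou along the subsequence: the squared distance to \<open>f\<close> is at most
    the liminf of those to the \<open>s (r i)\<close>.\<close>
  have close: "sqint M (\<lambda>x. s n x - f x) \<and> nsq M (\<lambda>x. s n x - f x) \<le> e"
    if e: "0 < e" and n: "\<And>j. j \<ge> N \<Longrightarrow> nsq M (\<lambda>x. s n x - s j x) < e" for e N n
  proof -
    have "(\<integral>\<^sup>+x. ennreal ((norm (s n x - f x))\<^sup>2) \<partial>M) = (\<integral>\<^sup>+x. liminf (\<lambda>i. ennreal ((norm (s n x - s (r i) x))\<^sup>2)) \<partial>M)"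
    proof (rule nn_integral_cong_AE)
      show "AE x in M. ennreal ((norm (s n x - f x))\<^sup>2) = liminf (\<lambda>i. ennreal ((norm (s n x - s (r i) x))\<^sup>2))"
        using AEl
      proof eventually_elim
        fix x assume "(\<lambda>i. s (r i) x) \<longlonglongrightarrow> f x"
        then have "(\<lambda>i. ennreal ((norm (s n x - s (r i) x))\<^sup>2)) \<longlonglongrightarrow> ennreal ((norm (s n x - f x))\<^sup>2)"
          by (intro tendsto_ennrealI tendsto_intros)
        then show "ennreal ((norm (s n x - f x))\<^sup>2) = liminf (\<lambda>i. ennreal ((norm (s n x - s (r i) x))\<^sup>2))"
          by (intro lim_imp_Liminf[symmetric]) auto
      qed
    qed
    also have "\<dots> \<le> liminf (\<lambda>i. (\<integral>\<^sup>+x. ennreal ((norm (s n x - s (r i) x))\<^sup>2) \<partial>M))"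
      by (rule nn_integral_liminf) measurable
    also have "\<dots> = liminf (\<lambda>i. ennreal (nsq M (\<lambda>x. s n x - s (r i) x)))"
    proof -
      have "(\<integral>\<^sup>+x. ennreal ((norm (s n x - s (r i) x))\<^sup>2) \<partial>M) = ennreal (nsq M (\<lambda>x. s n x - s (r i) x))" for i
        unfolding nsq_def using sqint_diff[OF s s, of n "r i"] unfolding sqint_def
        by (intro nn_integral_eq_integral) auto
      then show ?thesis by simp
    qed
    also have "\<dots> \<le> liminf (\<lambda>i. ennreal e)"
    proof (rule Liminf_mono)
      have "eventually (\<lambda>i. i \<ge> N) sequentially" by (rule eventually_ge_at_top)
      then show "eventually (\<lambda>i. ennreal (nsq M (\<lambda>x. s n x - s (r i) x)) \<le> ennreal e) sequentially"
      proof eventually_elim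
        fix i assume "N \<le> i"
        then have "N \<le> r i" using seq_suble[OF r, of i] by simp
        from n[OF this] show "ennreal (nsq M (\<lambda>x. s n x - s (r i) x)) \<le> ennreal e"
          by (intro ennreal_leI) simp
      qed
    qed
    also have "\<dots> = ennreal e" by (simp add: Liminf_const)
    finally have fin: "(\<integral>\<^sup>+x. ennreal ((norm (s n x - f x))\<^sup>2) \<partial>M) \<le> ennreal e" .
    have int: "integrable M (\<lambda>x. (norm (s n x - f x))\<^sup>2)"
      by (rule integrableI_bounded) (use fin in \<open>auto simp: less_top[symmetric] top_unique\<close>)
    then have "ennreal (nsq M (\<lambda>x. s n x - f x)) \<le> ennreal e"
      using fin unfolding nsq_def by (subst nn_integral_eq_integral[symmetric]) auto
    then show ?thesis using int e unfolding sqint_def by auto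
  qed
  obtain N1 where N1: "\<And>i j. i \<ge> N1 \<Longrightarrow> j \<ge> N1 \<Longrightarrow> nsq M (\<lambda>x. s i x - s j x) < 1"
    using cauchy[of 1] by auto
  have "sqint M (\<lambda>x. s N1 x - f x)" using close[of 1 N1 N1] N1 by auto
  from sqint_diff[OF s[of N1] this] have "sqint M f" by simp
  moreover have "(\<lambda>n. nsq M (\<lambda>x. s n x - f x)) \<longlonglongrightarrow> 0"
  proof (rule LIMSEQ_I)
    fix e :: real assume e: "0 < e"
    obtain N where N: "\<And>i j. i \<ge> N \<Longrightarrow> j \<ge> N \<Longrightarrow> nsq M (\<lambda>x. s i x - s j x) < e / 2"
      using cauchy[of "e / 2"] e by auto
    have "norm (nsq M (\<lambda>x. s n x - f x) - 0) < e" if "n \<ge> N" for n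
      using close[of "e/2" N n] N[OF that] e nsq_nonneg[of M "\<lambda>x. s n x - f x"] by auto
    then show "\<exists>no. \<forall>n\<ge>no. norm (nsq M (\<lambda>x. s n x - f x) - 0) < e" by blast
  qed
  ultimately show ?thesis by blast
qed

text \<open>The projection theorem for a subspace that need not be closed. A minimizing sequence for
  the squared distance \<open>d\<close> is Cauchy by the parallelogram law; the residual of its
  limit is orthogonal to \<open>S\<close>, hence zero, so that d = 0.\<close>

lemma dense_if_orthogonal_trivial:
  assumes M: "sigma_finite_measure M" and S: "\<And>f. f \<in> S \<Longrightarrow> sqint M f" and zero: "(\<lambda>_. 0) \<in> S"
    and lin: "\<And>f g c. f \<in> S \<Longrightarrow> g \<in> S \<Longrightarrow> (\<lambda>x. f x + c * g x) \<in> S"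
    and orth: "\<And>u. sqint M u \<Longrightarrow> (\<And>f. f \<in> S \<Longrightarrow> (LINT x|M. u x * cnj (f x)) = 0) \<Longrightarrow> AE x in M. u x = 0"
    and u: "sqint M u" and e: "0 < e"
  shows "\<exists>f\<in>S. nsq M (\<lambda>x. u x - f x) < e"
proof -
  define D where "D = (\<lambda>f. nsq M (\<lambda>x. u x - f x)) ` S"
  define d where "d = Inf D"
  have Dne: "D \<noteq> {}" unfolding D_def using zero by auto
  have bdd: "bdd_below D" unfolding D_def by (rule bdd_belowI[of _ 0]) (auto intro: nsq_nonneg)
  have dle: "d \<le> nsq M (\<lambda>x. u x - f x)" if "f \<in> S" for f
    unfolding d_def by (rule cInf_lower[OF _ bdd]) (use that in \<open>auto simp: D_def\<close>)
  have d0: "0 \<le> d" unfolding d_def by (rule cInf_greatest[OF Dne]) (auto simp: D_def intro: nsq_nonneg)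
  have "\<exists>f\<in>S. nsq M (\<lambda>x. u x - f x) < d + 1 / real (Suc n)" for n
    using cInf_lessD[OF Dne, of "d + 1 / real (Suc n)"] unfolding d_def[symmetric]
    by (auto simp: D_def simp del: of_nat_Suc)
  then obtain s where s: "\<And>n. s n \<in> S" "\<And>n. nsq M (\<lambda>x. u x - s n x) < d + 1 / real (Suc n)" by metis
  have us: "sqint M (\<lambda>x. u x - s n x)" for n using u S s by (intro sqint_diff) auto
  have par: "nsq M (\<lambda>x. s i x - s j x) \<le> 2 / real (Suc i) + 2 / real (Suc j)" for i j
  proof -
    let ?a = "\<lambda>x. u x - s i x" and ?b = "\<lambda>x. u x - s j x"
    define p where "p = Re (LINT x|M. ?a x * cnj (?b x))"
    have 1: "nsq M (\<lambda>x. ?a x + ?b x) = nsq M ?a + 2 * p + nsq M ?b"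
      unfolding p_def by (rule nsq_add[OF us us])
    have eq: "?a x * cnj ((-1) * ?b x) = (-1) * (?a x * cnj (?b x))" for x by (simp add: algebra_simps)
    have "nsq M (\<lambda>x. ?a x + (-1) * ?b x) = nsq M ?a + 2 * Re (LINT x|M. ?a x * cnj ((-1) * ?b x)) + nsq M (\<lambda>x. (-1) * ?b x)"
      by (rule nsq_add[OF us sqint_mult[OF us]])
    also have "(LINT x|M. ?a x * cnj ((-1) * ?b x)) = (-1) * (LINT x|M. ?a x * cnj (?b x))"
      unfolding eq by (rule integral_mult_right_zero)
    finally have 2: "nsq M (\<lambda>x. s j x - s i x) = nsq M ?a - 2 * p + nsq M ?b"
      unfolding nsq_mult p_def by simp
    have 3: "nsq M (\<lambda>x. s i x - s j x) = nsq M (\<lambda>x. s j x - s i x)"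
      unfolding nsq_def by (simp add: norm_minus_commute)
    \<comment> \<open>The midpoint lies in \<open>S\<close>, so the squared norm of \<open>u\<close>
      minus it is at least \<open>d\<close>; this bounds \<open>?a + ?b\<close> from below.\<close>
    have mid: "(\<lambda>x. (1/2) * (s i x + 1 * s j x)) \<in> S"
      using lin[OF zero lin[OF s(1)[of i] s(1)[of j], of 1], of "1/2"] by simp
    have "4 * d \<le> 4 * nsq M (\<lambda>x. u x - (1/2) * (s i x + 1 * s j x))" using dle[OF mid] by simp
    also have "\<dots> = nsq M (\<lambda>x. 2 * (u x - (1/2) * (s i x + 1 * s j x)))" unfolding nsq_mult by simp
    also have "\<dots> = nsq M (\<lambda>x. ?a x + ?b x)" by (simp add: algebra_simps)
    finally show ?thesis using 1 2 3 s(2)[of i] s(2)[of j] by simp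
  qed
  have "\<exists>N. \<forall>i\<ge>N. \<forall>j\<ge>N. nsq M (\<lambda>x. s i x - s j x) < e" if e: "0 < e" for e
  proof -
    obtain N where N: "4 / e < real N" using reals_Archimedean2 by blast
    have "nsq M (\<lambda>x. s i x - s j x) < e" if "i \<ge> N" "j \<ge> N" for i j
    proof -
      have "2 / real (Suc k) < e / 2" if "k \<ge> N" for k
      proof -
        have "4 / e < real (Suc k)" using N that by simp
        then show ?thesis using e by (simp add: field_simps)
      qed
      from this[OF that(1)] this[OF that(2)] par[of i j] show ?thesis by simp
    qed
    then show ?thesis by blast
  qed
  then obtain F where F: "sqint M F" "(\<lambda>n. nsq M (\<lambda>x. s n x - F x)) \<longlonglongrightarrow> 0"
    using sqint_complete[OF M, of s] S s(1) by blast
  define r where "r x = u x - F x" for x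
  have r: "sqint M r" unfolding r_def by (rule sqint_diff[OF u F(1)])
  have sF: "sqint M (\<lambda>x. s n x - F x)" for n using S s F by (intro sqint_diff) auto
  have lim0: "(\<lambda>n. sqrt (nsq M (\<lambda>x. s n x - F x))) \<longlonglongrightarrow> 0"
    using tendsto_real_sqrt[OF F(2)] by simp
  \<comment> \<open>The limit \<open>F\<close> need not lie in \<open>S\<close>, so the inequality
    is shown for \<open>s n + c f\<close> and passed to the limit.\<close>
  have lower: "d \<le> nsq M (\<lambda>x. r x - c * f x)" if f: "f \<in> S" for f c
  proof -
    have "sqrt d \<le> sqrt (nsq M (\<lambda>x. r x - c * f x)) + sqrt (nsq M (\<lambda>x. s n x - F x))" for n
    proof -
      have "d \<le> nsq M (\<lambda>x. u x - (s n x + c * f x))" by (rule dle[OF lin[OF s(1) f]])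
      then have "sqrt d \<le> sqrt (nsq M (\<lambda>x. (r x - c * f x) + (-1) * (s n x - F x)))"
        unfolding r_def by (simp add: algebra_simps)
      also have "\<dots> \<le> sqrt (nsq M (\<lambda>x. r x - c * f x)) + sqrt (nsq M (\<lambda>x. (-1) * (s n x - F x)))"
        by (rule nsq_triangle[OF sqint_diff[OF r sqint_mult[OF S[OF f]]] sqint_mult[OF sF]])
      finally show ?thesis unfolding nsq_mult by simp
    qed
    moreover have "(\<lambda>n. sqrt (nsq M (\<lambda>x. r x - c * f x)) + sqrt (nsq M (\<lambda>x. s n x - F x))) \<longlonglongrightarrow> sqrt (nsq M (\<lambda>x. r x - c * f x)) + 0"
      by (intro tendsto_add tendsto_const lim0)
    ultimately have "sqrt d \<le> sqrt (nsq M (\<lambda>x. r x - c * f x))" 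
      by (intro LIMSEQ_le_const[of _ "sqrt (nsq M (\<lambda>x. r x - c * f x))"]) auto
    then show ?thesis by simp
  qed
  have rd: "nsq M r \<le> d"
  proof -
    have "sqrt (nsq M r) \<le> sqrt (d + 1 / real (Suc n)) + sqrt (nsq M (\<lambda>x. s n x - F x))" for n
    proof -
      have "sqrt (nsq M (\<lambda>x. (u x - s n x) + (s n x - F x))) \<le> sqrt (nsq M (\<lambda>x. u x - s n x)) + sqrt (nsq M (\<lambda>x. s n x - F x))"
        by (rule nsq_triangle[OF us sF])
      moreover have "sqrt (nsq M (\<lambda>x. u x - s n x)) \<le> sqrt (d + 1 / real (Suc n))"
        by (intro real_sqrt_le_mono less_imp_le s)
      moreover have "sqrt (nsq M r) = sqrt (nsq M (\<lambda>x. (u x - s n x) + (s n x - F x)))" unfolding r_def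
        by simp
      ultimately show ?thesis by linarith
    qed
    moreover have "(\<lambda>n. sqrt (d + 1 / real (Suc n)) + sqrt (nsq M (\<lambda>x. s n x - F x))) \<longlonglongrightarrow> sqrt (d + 0) + 0"
      by (intro tendsto_add tendsto_const lim0 tendsto_real_sqrt LIMSEQ_Suc[OF lim_1_over_n])
    ultimately have "sqrt (nsq M r) \<le> sqrt (d + 0) + 0"
      by (intro LIMSEQ_le_const[of _ "sqrt (d + 0) + 0"]) auto
    then show ?thesis by simp
  qed
  have "AE x in M. r x = 0"
  proof (rule orth[OF r])
    fix f assume f: "f \<in> S"
    define p where "p = (LINT x|M. r x * cnj (f x))"
    \<comment> \<open>Minimizing over multiples of \<open>f\<close> suggests 1 /
      \<open>nsq M f\<close>; the added 1 guards against division by zero and still gives t *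
      \<open>nsq M f\<close> \<le> 1.\<close>
    define t where "t = 1 / (nsq M f + 1)"
    define c where "c = of_real t * p"
    have nf: "0 \<le> nsq M f" by (rule nsq_nonneg)
    have t0: "0 < t" "t * nsq M f \<le> 1" unfolding t_def using nf by (auto simp: field_simps)
    have "nsq M (\<lambda>x. r x + (- c) * f x) = nsq M r + 2 * Re (LINT x|M. r x * cnj ((- c) * f x)) + nsq M (\<lambda>x. (- c) * f x)"
      by (rule nsq_add[OF r sqint_mult[OF S[OF f]]])
    also have "(LINT x|M. r x * cnj ((- c) * f x)) = - cnj c * p"
      unfolding p_def by (subst integral_mult_right_zero[symmetric]) (simp add: algebra_simps)
    also have "Re (- cnj c * p) = - t * (norm p)\<^sup>2"
      unfolding c_def by (simp add: cmod_power2) (simp add: power2_eq_square algebra_simps)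
    also have "nsq M (\<lambda>x. (- c) * f x) = t\<^sup>2 * (norm p)\<^sup>2 * nsq M f"
      unfolding nsq_mult c_def by (simp add: norm_mult power_mult_distrib)
    finally have "2 * t * (norm p)\<^sup>2 \<le> t\<^sup>2 * (norm p)\<^sup>2 * nsq M f"
      using lower[OF f, of c] rd by simp
    also have "\<dots> = t * (norm p)\<^sup>2 * (t * nsq M f)" by (simp add: power2_eq_square)
    also have "\<dots> \<le> t * (norm p)\<^sup>2 * 1" using t0 by (intro mult_left_mono) auto
    finally have "t * (norm p)\<^sup>2 \<le> 0" by simp
    then have "(norm p)\<^sup>2 \<le> 0" using t0(1) by (simp add: mult_le_0_iff)
    then show "(LINT x|M. r x * cnj (f x)) = 0" unfolding p_def by simp
  qed
  then have "nsq M r = (LINT x|M. 0)"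
    unfolding nsq_def using r unfolding sqint_def by (intro integral_cong_AE) auto
  then have "d \<le> 0" using lower[OF zero, of 0] by simp
  then have "Inf D < e" using e unfolding d_def by simp
  then show ?thesis using cInf_lessD[OF Dne] unfolding D_def by blast
qed

context sl_system
begin

section \<open>Solutions of the integral system\<close>

lemma solD:
  assumes "sol h f g a b"
  shows "h \<in> borel_measurable borel" "loc lborel h" "f \<in> borel_measurable borel"
    "loc lborel (\<lambda>t. of_real (q t) * f t)" "f x = a + IP g x"
    "g x = b + prim lborel (\<lambda>t. of_real (q t) * f t - h t) x"
  using assms unfolding sol_def by blast+

lemma sol_q: 
  assumes "sol h f g a b"
  shows "loc lborel (\<lambda>t. of_real (q t) * f t - h t)"
    "(\<lambda>t. of_real (q t) * f t - h t) \<in> borel_measurable borel"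
proof -
  have [measurable]: "h \<in> borel_measurable borel" "f \<in> borel_measurable borel"
    using solD(1,3)[OF assms] .
  show "loc lborel (\<lambda>t. of_real (q t) * f t - h t)"
    by (rule loc_diff[OF solD(4)[OF assms] solD(2)[OF assms]])
  show "(\<lambda>t. of_real (q t) * f t - h t) \<in> borel_measurable borel" by measurable
qed

lemma sol_locally_bounded:
  assumes s: "sol h f g a b"
  shows "locally_bounded f" "locally_bounded g"
proof -
  have geq: "g = (\<lambda>x. b + prim lborel (\<lambda>t. of_real (q t) * f t - h t) x)" and feq: "f = (\<lambda>x. a + IP g x)"
    using s unfolding sol_def by blast+
  show g: "locally_bounded g" 
    by (subst geq) (intro locally_bounded_add locally_bounded_const locally_bounded_prim loc_finite_lborel sol_q[OF s])
  show "locally_bounded f" 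
    by (subst feq) (intro locally_bounded_add locally_bounded_const locally_bounded_IP g)
qed

lemma sol_lincomb:
  assumes s1: "sol h1 f1 g1 a1 b1" and s2: "sol h2 f2 g2 a2 b2"
  shows "sol (\<lambda>t. h1 t + c * h2 t) (\<lambda>t. f1 t + c * f2 t) (\<lambda>t. g1 t + c * g2 t) (a1 + c * a2) (b1 + c * b2)"
  unfolding sol_def
proof (intro conjI allI)
  have q: "(\<lambda>t. of_real (q t) * (f1 t + c * f2 t)) = (\<lambda>t. of_real (q t) * f1 t + c * (of_real (q t) * f2 t))"
    by (simp add: algebra_simps)
  show "loc lborel (\<lambda>t. of_real (q t) * (f1 t + c * f2 t))"
    unfolding q using s1 s2 unfolding sol_def by (intro loc_add loc_mult) auto
  show "loc lborel (\<lambda>t. h1 t + c * h2 t)" using s1 s2 unfolding sol_def by (intro loc_add loc_mult) auto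
  note lP = locally_bounded_locP[OF sol_locally_bounded(2)[OF s1]] locally_bounded_locP[OF sol_locally_bounded(2)[OF s2]]
  have "locP (\<lambda>t. c * g2 t)" using lP(2) loc_mult unfolding locP_def by blast
  then show "f1 x + c * f2 x = a1 + c * a2 + IP (\<lambda>t. g1 t + c * g2 t) x" for x
    using lP solD(5)[OF s1, of x] solD(5)[OF s2, of x] by (simp add: IP_add IP_mult algebra_simps)
  have k: "(\<lambda>t. of_real (q t) * (f1 t + c * f2 t) - (h1 t + c * h2 t)) =
      (\<lambda>t. (of_real (q t) * f1 t - h1 t) + c * (of_real (q t) * f2 t - h2 t))" by (simp add: algebra_simps)
  have geq: "g1 x = b1 + prim lborel (\<lambda>t. of_real (q t) * f1 t - h1 t) x"
    "g2 x = b2 + prim lborel (\<lambda>t. of_real (q t) * f2 t - h2 t) x" for x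
    using s1 s2 unfolding sol_def by blast+
  show "g1 x + c * g2 x = b1 + c * b2 + prim lborel (\<lambda>t. of_real (q t) * (f1 t + c * f2 t) - (h1 t + c * h2 t)) x" for x
    unfolding k prim_add[OF sol_q(1)[OF s1] loc_mult[OF sol_q(1)[OF s2]]] prim_mult
    using geq[of x] by (simp add: algebra_simps)
qed (use solD(1,3)[OF s1] solD(1,3)[OF s2] in auto)

lemma sol_cnj:
  assumes s: "sol h f g a b"
  shows "sol (\<lambda>t. cnj (h t)) (\<lambda>t. cnj (f t)) (\<lambda>t. cnj (g t)) (cnj a) (cnj b)"
  unfolding sol_def
proof (intro conjI allI)
  have q: "(\<lambda>t. of_real (q t) * cnj (f t)) = (\<lambda>t. cnj (of_real (q t) * f t))" by simp
  show "loc lborel (\<lambda>t. of_real (q t) * cnj (f t))" "loc lborel (\<lambda>t. cnj (h t))"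
    unfolding q using s unfolding sol_def by (intro loc_cnj, simp)+
  have feq: "f x = a + IP g x" and geq: "g x = b + prim lborel (\<lambda>t. of_real (q t) * f t - h t) x" for x
    using s unfolding sol_def by blast+
  show "cnj (f x) = cnj a + IP (\<lambda>t. cnj (g t)) x" for x
    unfolding IP_cnj using feq[of x] by simp
  have k: "(\<lambda>t. of_real (q t) * cnj (f t) - cnj (h t)) = (\<lambda>t. cnj (of_real (q t) * f t - h t))" by simp
  show "cnj (g x) = cnj b + prim lborel (\<lambda>t. of_real (q t) * cnj (f t) - cnj (h t)) x" for x
    unfolding k prim_cnj using geq[of x] by simp
qed (use solD(1,3)[OF s] in \<open>auto intro: borel_measurable_cnj\<close>)

text \<open>The product rule for f1 g2 and for f2 g1 gives the same integral of g1 g2 against dP. It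
  cancels in the Wronskian, as do the terms with \<open>q\<close>.\<close>

lemma sol_green:
  assumes s1: "sol h1 f1 g1 a1 b1" and s2: "sol h2 f2 g2 a2 b2"
  shows "loc lborel (\<lambda>t. f2 t * h1 t - f1 t * h2 t)"
    and "f1 x * g2 x - f2 x * g1 x = a1 * b2 - a2 * b1 + prim lborel (\<lambda>t. f2 t * h1 t - f1 t * h2 t) x"
proof -
  have eqs: "f1 x = a1 + IP g1 x" "f2 x = a2 + IP g2 x"
      "g1 x = b1 + prim lborel (\<lambda>t. of_real (q t) * f1 t - h1 t) x" 
      "g2 x = b2 + prim lborel (\<lambda>t. of_real (q t) * f2 t - h2 t) x" for x
    using s1 s2 unfolding sol_def by blast+
  note lP = locally_bounded_locP[OF sol_locally_bounded(2)[OF s1]] locally_bounded_locP[OF sol_locally_bounded(2)[OF s2]]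
  note p1 = IP_product[OF eqs(1) lP(1) eqs(4) sol_q(1)[OF s2]]
  note p2 = IP_product[OF eqs(2) lP(2) eqs(3) sol_q(1)[OF s1]]
  have k: "(\<lambda>t. f2 t * h1 t - f1 t * h2 t) = (\<lambda>t. f1 t * (of_real (q t) * f2 t - h2 t) - f2 t * (of_real (q t) * f1 t - h1 t))"
    by (simp add: algebra_simps)
  show "loc lborel (\<lambda>t. f2 t * h1 t - f1 t * h2 t)"
    unfolding k using p1(2) p2(2) by (rule loc_diff)
  have "IP (\<lambda>s. g1 s * g2 s) x = IP (\<lambda>s. g2 s * g1 s) x" by (simp add: mult.commute)
  then show "f1 x * g2 x - f2 x * g1 x = a1 * b2 - a2 * b1 + prim lborel (\<lambda>t. f2 t * h1 t - f1 t * h2 t) x"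
    unfolding k prim_diff[OF p1(2) p2(2)] p1(3)[of x] p2(3)[of x] by simp
qed

text \<open>Vanishing of both components at \<open>c\<close> permits the cut: an atom of dP at
  \<open>c\<close> adds only a multiple of g c = 0 to \<open>f\<close>.\<close>

lemma sol_truncate:
  assumes s: "sol h f g a b" and c: "0 < c" "f c = 0" "g c = 0"
  shows "sol (\<lambda>t. if t < c then h t else 0) (\<lambda>t. if t \<le> c then f t else 0) (\<lambda>t. if t \<le> c then g t else 0) a b"
    (is "sol ?h ?f ?g a b")
proof -
  have eqs: "f x = a + IP g x" "g x = b + prim lborel (\<lambda>t. of_real (q t) * f t - h t) x" for x
    using s unfolding sol_def by blast+
  have [measurable]: "h \<in> borel_measurable borel" "f \<in> borel_measurable borel" using s unfolding sol_def
    by auto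
  have lbf: "locally_bounded ?f"
    unfolding locally_bounded_def
  proof (intro conjI allI)
    fix d
    obtain K where K: "\<And>t. 0 < t \<Longrightarrow> t \<le> d \<Longrightarrow> norm (f t) \<le> K"
      using sol_locally_bounded(1)[OF s] unfolding locally_bounded_def by meson
    show "\<exists>K. \<forall>t. 0 < t \<longrightarrow> t \<le> d \<longrightarrow> norm (?f t) \<le> K"
      by (intro exI[of _ "max K 0"]) (auto simp: le_max_iff_disj K)
  qed measurable
  have hl: "loc lborel ?h"
  proof (rule loc_bound[OF loc_norm[of lborel h]])
    show "loc lborel h" using s unfolding sol_def by blast
    show "\<exists>K. \<forall>t. 0 < t \<longrightarrow> t < d \<longrightarrow> norm (?h t) \<le> K * \<bar>norm (h t)\<bar>" for d by (intro exI[of _ 1]) auto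
  qed auto
  have 1: "?f x = a + IP ?g x" for x
  proof (cases "x \<le> c")
    case True
    have "IP ?g x = IP g x" by (rule IP_cong) (use True in auto)
    then show ?thesis using eqs(1)[of x] True by simp
  next
    case False
    have "IP ?g x = IP ?g c"
      unfolding IP_def using prim_vanishing[of c ?g x] c False by (auto simp: order_antisym_conv)
    also have "\<dots> = IP g c" by (rule IP_cong) auto
    finally show ?thesis using eqs(1)[of c] c False by simp
  qed
  let ?k = "\<lambda>t. of_real (q t) * ?f t - ?h t" and ?u = "\<lambda>t. of_real (q t) * f t - h t"
  have 2: "?g x = b + prim lborel ?k x" for x
  proof (cases "x \<le> c")
    case True
    have "prim lborel ?k x = prim lborel ?u x" by (rule prim_cong) (use True in auto)
    then show ?thesis using eqs(2)[of x] True by simp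
  next
    case False
    have "prim lborel ?k x = prim lborel ?k c"
    proof (rule prim_vanishing)
      show "?k t = 0" if "c \<le> t" for t using that c by (cases "t = c") auto
    qed (use False in simp)
    also have "\<dots> = prim lborel ?u c" by (rule prim_cong) auto
    finally show ?thesis using eqs(2)[of c] c False by simp
  qed
  have "loc lborel (\<lambda>t. of_real (q t) * ?f t)"
    by (intro loc_times_locally_bounded q_loc_complex lbf) auto
  moreover have "?h \<in> borel_measurable borel" "?f \<in> borel_measurable borel" by measurable
  ultimately show ?thesis unfolding sol_def using hl 1 2 by blast
qed

text \<open>By Green's identity, the orthogonality of \<open>h\<close> to \<open>s\<close> makes the
  Wronskian of \<open>s\<close> and of the solution with zero initial data vanish at
  \<open>c\<close>. A multiple of \<open>s\<close> then cancels both components there, which changes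
  the initial slope but not the initial value 0.\<close>

lemma sol_zero_init_compact:
  assumes s: "sol (\<lambda>_. 0) s \<sigma> 0 1" and h: "h \<in> borel_measurable borel" "loc lborel h" and c: "0 < c"
    and hs: "prim lborel (\<lambda>t. h t * s t) c = 0"
  shows "\<exists>f g b. sol (\<lambda>t. if t < c then h t else 0) f g 0 b \<and> (\<forall>t>c. f t = 0 \<and> g t = 0)"
proof -
  obtain p \<pi> where p: "sol h p \<pi> 0 0" using sol_exists[OF h] by blast
  obtain s1 \<sigma>1 where s1: "sol (\<lambda>_. 0) s1 \<sigma>1 1 0"
    using sol_exists[of "\<lambda>_. 0" 1 0] loc_const[OF loc_finite_lborel, of 0] by auto
  have "p c * \<sigma> c - s c * \<pi> c = prim lborel (\<lambda>t. s t * h t - p t * 0) c"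
    using sol_green(2)[OF p s, of c] by simp
  also have "\<dots> = 0" using hs by (simp add: mult.commute)
  finally have 1: "p c * \<sigma> c = s c * \<pi> c" by simp
  \<comment> \<open>The Wronskian with a second solution is constant and nonzero, so
    \<open>s\<close> and \<sigma> do not vanish together at \<open>c\<close>.\<close>
  have "s c * \<sigma>1 c - s1 c * \<sigma> c = - 1"
    using sol_green(2)[OF s s1, of c] by (simp add: prim_def set_lebesgue_integral_def)
  then have 2: "s c \<noteq> 0 \<or> \<sigma> c \<noteq> 0" by auto
  obtain \<beta> where \<beta>: "p c + \<beta> * s c = 0" "\<pi> c + \<beta> * \<sigma> c = 0"
  proof (cases "s c = 0")
    case True
    then have "\<sigma> c \<noteq> 0" "p c = 0" using 1 2 by auto
    then show ?thesis using True that[of "- \<pi> c / \<sigma> c"] by simp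
  next
    case False
    then show ?thesis using 1 that[of "- p c / s c"] by (simp add: field_simps)
  qed
  have "sol (\<lambda>t. h t + \<beta> * 0) (\<lambda>t. p t + \<beta> * s t) (\<lambda>t. \<pi> t + \<beta> * \<sigma> t) (0 + \<beta> * 0) (0 + \<beta> * 1)"
    by (rule sol_lincomb[OF p s])
  then have "sol h (\<lambda>t. p t + \<beta> * s t) (\<lambda>t. \<pi> t + \<beta> * \<sigma> t) 0 \<beta>" by simp
  from sol_truncate[OF this c] \<beta> show ?thesis by fastforce
qed

end

section \<open>The space of square integrable functions on the half line\<close>

abbreviation half_line :: "real measure" where "half_line \<equiv> lebesgue_on {0<..}"

lemma L2_iff_sqint: "f \<in> L2 \<longleftrightarrow> sqint half_line f"
  unfolding L2_def sqint_def by simp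

lemma L2_norm_nsq: "(L2_norm f)\<^sup>2 = nsq half_line f" "L2_norm f = sqrt (nsq half_line f)"
  unfolding L2_norm_def nsq_def by simp_all

lemma half_line_measurable_set: "{0<..} \<inter> space lebesgue \<in> sets (lebesgue :: real measure)"
  using lebesgue_openin[of UNIV "{0<..}"] by (simp add: borel_open)

lemma sigma_finite_half_line: "sigma_finite_measure half_line"
proof (rule sigma_finite_measure_restrict_space)
  show "sigma_finite_measure (lebesgue :: real measure)"
  proof
    define A where "A = range (\<lambda>n::nat. {- real n..real n})"
    have "countable A" "A \<subseteq> sets lebesgue" "\<forall>a\<in>A. emeasure lebesgue a \<noteq> \<infinity>" unfolding A_def by auto
    moreover have "\<Union>A = (UNIV :: real set)"
    proof -
      have "x \<in> \<Union>A" for x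
      proof -
        obtain n where "\<bar>x\<bar> < real n" using reals_Archimedean2 by blast
        then have "x \<in> {- real n..real n}" by auto
        then show ?thesis unfolding A_def by blast
      qed
      then show ?thesis by blast
    qed
    ultimately show "\<exists>A. countable A \<and> A \<subseteq> sets (lebesgue :: real measure) \<and> \<Union> A = space lebesgue \<and> (\<forall>a\<in>A. emeasure lebesgue a \<noteq> \<infinity>)"
      by auto
  qed
  show "{0<..} \<in> sets (lebesgue :: real measure)" using half_line_measurable_set by simp
qed

lemma measurable_half_line: "f \<in> borel_measurable borel \<Longrightarrow> f \<in> borel_measurable half_line"
  by (intro measurable_restrict_space1) (simp add: measurable_completion)

lemma AE_half_line: "(AE x in half_line. P x) \<longleftrightarrow> (AE x in lborel. 0 < x \<longrightarrow> P x)"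
  using AE_restrict_space_iff[OF half_line_measurable_set, of P] by (simp add: AE_completion_iff)

lemma integral_half_line:
  fixes f :: "real \<Rightarrow> 'a::{banach, second_countable_topology}"
  assumes f: "f \<in> borel_measurable borel"
  shows "integrable half_line f \<longleftrightarrow> set_integrable lborel {0<..} f"
    and "integral\<^sup>L half_line f = (LINT x:{0<..}|lborel. f x)"
proof -
  have m: "(\<lambda>x. indicator {0<..} x *\<^sub>R f x) \<in> borel_measurable lborel" using f by simp
  show "integrable half_line f \<longleftrightarrow> set_integrable lborel {0<..} f"
    unfolding set_integrable_def integrable_restrict_space[OF half_line_measurable_set]
    by (rule integrable_completion[OF m])
  show "integral\<^sup>L half_line f = (LINT x:{0<..}|lborel. f x)"
    unfolding set_lebesgue_integral_def integral_restrict_space[OF half_line_measurable_set]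
    by (rule integral_completion[OF m])
qed

text \<open>Elements of \<open>L2\<close> are only Lebesgue measurable on the half line, whereas
  \<open>sol\<close> asks for Borel functions.\<close>

lemma half_line_borel_rep:
  fixes f :: "real \<Rightarrow> complex"
  assumes f: "f \<in> borel_measurable half_line"
  shows "\<exists>f'. f' \<in> borel_measurable borel \<and> (\<forall>x\<le>0. f' x = 0) \<and> (AE x in half_line. f x = f' x)"
proof -
  have m: "(\<lambda>x. indicator {0<..} x *\<^sub>R f x) \<in> borel_measurable lebesgue"
    using f borel_measurable_restrict_space_iff[OF half_line_measurable_set, of f] by simp
  have "(\<lambda>x. Re (indicator {0<..} x *\<^sub>R f x)) \<in> borel_measurable lebesgue"
    "(\<lambda>x. Im (indicator {0<..} x *\<^sub>R f x)) \<in> borel_measurable lebesgue"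
    by (rule measurable_compose[OF m], simp)+
  then obtain r i where r: "r \<in> borel_measurable lborel"
    "AE x in lborel. Re (indicator {0<..} x *\<^sub>R f x) = r x"
    and i: "i \<in> borel_measurable lborel" "AE x in lborel. Im (indicator {0<..} x *\<^sub>R f x) = i x"
    using completion_ex_borel_measurable_real by blast
  define f' where "f' x = (if 0 < x then Complex (r x) (i x) else 0)" for x
  have [measurable]: "r \<in> borel_measurable borel" "i \<in> borel_measurable borel" using r i by simp_all
  have "f' \<in> borel_measurable borel"
    unfolding f'_def Complex_eq by measurable
  moreover have "AE x in lborel. 0 < x \<longrightarrow> f x = f' x"
    using r(2) i(2) by eventually_elim (auto simp: f'_def complex_eq_iff)
  ultimately show ?thesis unfolding AE_half_line by (intro exI[of _ f']) (auto simp: f'_def)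
qed

lemma sqint_cong_AE:
  assumes "f \<in> borel_measurable M" "g \<in> borel_measurable M" "AE x in M. f x = g x"
  shows "sqint M f \<longleftrightarrow> sqint M g" "nsq M f = nsq M g"
proof -
  have ae: "AE x in M. (norm (f x))\<^sup>2 = (norm (g x))\<^sup>2" using assms(3) by eventually_elim simp
  show "sqint M f \<longleftrightarrow> sqint M g"
    unfolding sqint_def using assms(1,2) integrable_cong_AE[OF _ _ ae] by simp
  show "nsq M f = nsq M g"
    unfolding nsq_def by (rule integral_cong_AE) (use assms ae in auto)
qed

lemma ip_cong_AE:
  assumes "f \<in> borel_measurable half_line" "f' \<in> borel_measurable half_line"
    "AE x in half_line. f x = f' x"
    and "g \<in> borel_measurable half_line" "g' \<in> borel_measurable half_line"
      "AE x in half_line. g x = g' x"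
  shows "ip f g = ip f' g'"
proof -
  have c: "(\<lambda>x. cnj (u x)) \<in> borel_measurable half_line" if "u \<in> borel_measurable half_line" for u
    by (rule measurable_compose[OF that]) (intro borel_measurable_continuous_onI continuous_intros)
  show ?thesis unfolding ip_def
  proof (rule integral_cong_AE)
    show "AE x in half_line. f x * cnj (g x) = f' x * cnj (g' x)"
      using assms(3,6) by eventually_elim simp
  qed (use assms c in auto)
qed

lemma L2_measurable: "f \<in> L2 \<Longrightarrow> f \<in> borel_measurable half_line"
  unfolding L2_def by simp

lemma ip_cnj: "cnj (ip f g) = ip g f"
  unfolding ip_def Bochner_Integration.integral_cnj[symmetric] by (simp add: mult.commute)

lemma integral_half_line_lim:
  fixes w :: "real \<Rightarrow> 'a::{banach, second_countable_topology}"
  assumes w: "w \<in> borel_measurable borel" "integrable half_line w"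
  shows "loc lborel w" "(\<lambda>n. prim lborel w (real n)) \<longlonglongrightarrow> integral\<^sup>L half_line w"
proof -
  have s: "set_integrable lborel {0<..} w" using w integral_half_line(1) by blast
  show "loc lborel w" unfolding loc_def using s by (auto intro: set_integrable_subset)
  have U: "(\<Union>n. {0<..<real n}) = {0<..}" by (auto intro: reals_Archimedean2)
  have "(\<lambda>n. LINT x:{0<..<real n}|lborel. w x) \<longlonglongrightarrow> (LINT x:(\<Union>n. {0<..<real n})|lborel. w x)"
    by (rule set_integral_cont_up) (use s U in \<open>auto simp: incseq_def\<close>)
  then show "(\<lambda>n. prim lborel w (real n)) \<longlonglongrightarrow> integral\<^sup>L half_line w"
    unfolding U prim_def integral_half_line(2)[OF w(1)] .
qed

lemma L2_loc:
  assumes u: "u \<in> borel_measurable borel" "u \<in> L2"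
  shows "loc lborel (\<lambda>t. (norm (u t))\<^sup>2)" "loc lborel u"
proof -
  have [measurable]: "u \<in> borel_measurable borel" by (rule u)
  show l2: "loc lborel (\<lambda>t. (norm (u t))\<^sup>2)"
    by (rule integral_half_line_lim) (use u in \<open>auto simp: L2_def\<close>)
  show "loc lborel u"
  proof (rule loc_bound[OF loc_add[OF loc_const[OF loc_finite_lborel, of "1::real"] l2]])
    show "\<exists>K. \<forall>t. 0 < t \<longrightarrow> t < c \<longrightarrow> norm (u t) \<le> K * \<bar>1 + (norm (u t))\<^sup>2\<bar>" for c
    proof (intro exI[of _ 1] allI impI)
      fix t
      have "0 \<le> (norm (u t) - 1/2)\<^sup>2" by simp
      then have "norm (u t) \<le> 1 + (norm (u t))\<^sup>2" by (simp add: power2_eq_square algebra_simps)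
      then show "norm (u t) \<le> 1 * \<bar>1 + (norm (u t))\<^sup>2\<bar>" by simp
    qed
  qed (use u in auto)
qed

lemma ip_lim:
  assumes u: "u \<in> borel_measurable borel" "u \<in> L2" and v: "v \<in> borel_measurable borel" "v \<in> L2"
  shows "loc lborel (\<lambda>t. u t * cnj (v t))" "(\<lambda>n. prim lborel (\<lambda>t. u t * cnj (v t)) (real n)) \<longlonglongrightarrow> ip u v"
proof -
  have i: "integrable half_line (\<lambda>t. u t * cnj (v t))"
    using u v sqint_mult_integrable sqint_cnj unfolding L2_iff_sqint by blast
  have [measurable]: "u \<in> borel_measurable borel" by (rule u)
  have m: "(\<lambda>t. u t * cnj (v t)) \<in> borel_measurable borel"
    by (intro borel_measurable_times u(1) measurable_compose[OF v(1)] borel_measurable_continuous_onI continuous_intros)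
  show "loc lborel (\<lambda>t. u t * cnj (v t))" "(\<lambda>n. prim lborel (\<lambda>t. u t * cnj (v t)) (real n)) \<longlonglongrightarrow> ip u v"
    using integral_half_line_lim[OF m i] unfolding ip_def by auto
qed

lemma prim_cauchy_schwarz:
  fixes s w :: "real \<Rightarrow> complex"
  assumes s: "s \<in> borel_measurable borel" "loc lborel (\<lambda>t. (norm (s t))\<^sup>2)"
    and w: "w \<in> borel_measurable borel" "loc lborel (\<lambda>t. (norm (w t))\<^sup>2)"
  shows "(norm (prim lborel (\<lambda>t. s t * w t) x))\<^sup>2 \<le> prim lborel (\<lambda>t. (norm (s t))\<^sup>2) x * prim lborel (\<lambda>t. (norm (w t))\<^sup>2) x"
proof -
  define tr where "tr u t = indicator {0<..<x} t *\<^sub>R u t" for u :: "real \<Rightarrow> complex" and t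
  have sq: "(norm (tr u t))\<^sup>2 = indicator {0<..<x} t *\<^sub>R (norm (u t))\<^sup>2" for u t
    unfolding tr_def by (auto simp: indicator_def)
  have si: "sqint lborel (tr u)" if "u \<in> borel_measurable borel" "loc lborel (\<lambda>t. (norm (u t))\<^sup>2)" for u
    unfolding sqint_def sq using that locD[OF that(2), of x] unfolding set_integrable_def tr_def[abs_def]
    by auto
  have ns: "nsq lborel (tr u) = prim lborel (\<lambda>t. (norm (u t))\<^sup>2) x" for u
    unfolding nsq_def sq prim_def set_lebesgue_integral_def ..
  have "(LINT t|lborel. tr s t * tr w t) = prim lborel (\<lambda>t. s t * w t) x"
    unfolding prim_def set_lebesgue_integral_def
    by (intro Bochner_Integration.integral_cong) (auto simp: tr_def indicator_def)
  then show ?thesis using cauchy_schwarz[OF si[OF s] si[OF w]] unfolding ns by simp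
qed

context sl_system
begin

lemma locally_bounded_compact_L2:
  assumes f: "locally_bounded f" and z: "\<And>t. c < t \<Longrightarrow> f t = 0"
  shows "f \<in> L2"
proof -
  obtain K where K: "\<And>t. 0 < t \<Longrightarrow> t \<le> c \<Longrightarrow> norm (f t) \<le> K" using f unfolding locally_bounded_def by meson
  have [measurable]: "f \<in> borel_measurable borel" using f unfolding locally_bounded_def by simp
  have "set_integrable lborel {0<..} (\<lambda>t. (norm (f t))\<^sup>2)"
    unfolding set_integrable_def
  proof (rule Bochner_Integration.integrable_bound)
    show "integrable lborel (\<lambda>t. indicator {0<..<c+1} t *\<^sub>R K\<^sup>2)"
      using locD[OF loc_const[OF loc_finite_lborel, of "K\<^sup>2"], of "c+1"] unfolding set_integrable_def .
    show "AE t in lborel. norm (indicator {0<..} t *\<^sub>R (norm (f t))\<^sup>2) \<le> norm (indicator {0<..<c+1} t *\<^sub>R K\<^sup>2)"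
    proof (rule AE_I2)
      fix t
      show "norm (indicator {0<..} t *\<^sub>R (norm (f t))\<^sup>2) \<le> norm (indicator {0<..<c+1} t *\<^sub>R K\<^sup>2)"
        using z[of t] K[of t] by (cases "t \<le> c") (auto simp: indicator_def intro: power_mono)
    qed
  qed measurable
  then have "integrable half_line (\<lambda>t. (norm (f t))\<^sup>2)" by (subst integral_half_line) auto
  then show ?thesis unfolding L2_def using measurable_half_line[of f] by simp
qed

text \<open>\<open>D0\<close> is \<^const>\<open>H_D\<close> for Borel representatives, with \<open>f(0) = 0\<close> built into the integral
  equation; \<open>T0\<close> is its restriction to functions vanishing near infinity.\<close>

definition T0 :: graph where
  "T0 = {(f, h). \<exists>g b c. 0 < c \<and> sol h f g 0 b \<and> (\<forall>t>c. f t = 0 \<and> g t = 0) \<and> (\<forall>t\<ge>c. h t = 0) \<and> h \<in> L2}"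

definition D0 :: graph where
  "D0 = {(f, h). \<exists>g b. sol h f g 0 b \<and> f \<in> L2 \<and> h \<in> L2}"

lemma T0_subset_D0: "T0 \<subseteq> D0"
  unfolding T0_def D0_def using locally_bounded_compact_L2 sol_locally_bounded(1) by blast

lemma D0_borel: "(f, h) \<in> D0 \<Longrightarrow> f \<in> borel_measurable borel \<and> f \<in> L2 \<and> h \<in> borel_measurable borel \<and> h \<in> L2"
  unfolding D0_def sol_def by blast

text \<open>Both initial values are 0, so the endpoint 0 contributes nothing to the Wronskian, and
  square integrability gives its limit at infinity.\<close>

lemma D0_green:
  assumes s1: "sol h1 f1 g1 0 b1" and 1: "f1 \<in> L2" "h1 \<in> L2" and s2: "sol h2 f2 g2 0 b2" and 2: "f2 \<in> L2"
    "h2 \<in> L2"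
  shows "(\<lambda>n. f1 (real n) * cnj (g2 (real n)) - cnj (f2 (real n)) * g1 (real n)) \<longlonglongrightarrow> ip h1 f2 - ip f1 h2"
proof -
  have m: "h1 \<in> borel_measurable borel" "f1 \<in> borel_measurable borel" "h2 \<in> borel_measurable borel"
    "f2 \<in> borel_measurable borel"
    using solD(1,3)[OF s1] solD(1,3)[OF s2] by auto
  note l1 = ip_lim[OF m(1) 1(2) m(4) 2(1)] and l2 = ip_lim[OF m(2) 1(1) m(3) 2(2)]
  have eq: "f1 x * cnj (g2 x) - cnj (f2 x) * g1 x = prim lborel (\<lambda>t. h1 t * cnj (f2 t)) x - prim lborel (\<lambda>t. f1 t * cnj (h2 t)) x" for x
    using sol_green(2)[OF s1 sol_cnj[OF s2], of x] prim_diff[OF l1(1) l2(1), of x]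
    by (simp add: mult.commute[of "cnj _"])
  show ?thesis unfolding eq by (intro tendsto_diff l1 l2)
qed

text \<open>The Wronskian vanishes near infinity. This will place \<open>T0\<close> inside
  \<open>H_min\<close>.\<close>

lemma T0_symmetric:
  assumes fh: "(f, h) \<in> T0" and FH: "(F, H) \<in> D0"
  shows "ip H f = ip F h"
proof -
  obtain g b c where s: "sol h f g 0 b" and c: "\<And>t. t > c \<Longrightarrow> f t = 0" "\<And>t. t > c \<Longrightarrow> g t = 0"
    using fh unfolding T0_def by blast
  obtain G B where S: "sol H F G 0 B" "F \<in> L2" "H \<in> L2" using FH unfolding D0_def by blast
  have fh2: "f \<in> L2" "h \<in> L2" using fh T0_subset_D0 D0_borel by blast+
  have "(\<lambda>n. F (real n) * cnj (g (real n)) - cnj (f (real n)) * G (real n)) \<longlonglongrightarrow> ip H f - ip F h"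
    by (rule D0_green[OF S s fh2])
  moreover have "(\<lambda>n. F (real n) * cnj (g (real n)) - cnj (f (real n)) * G (real n)) \<longlonglongrightarrow> 0"
  proof (rule tendsto_eventually)
    obtain n0 where n0: "c < real n0" using reals_Archimedean2 by blast
    show "eventually (\<lambda>n. F (real n) * cnj (g (real n)) - cnj (f (real n)) * G (real n) = 0) sequentially"
      using eventually_ge_at_top[of n0]
    proof eventually_elim
      fix n assume "n0 \<le> n"
      then have "c < real n" using n0 by simp
      then show "F (real n) * cnj (g (real n)) - cnj (f (real n)) * G (real n) = 0" using c by simp
    qed
  qed
  ultimately have "ip H f - ip F h = 0" by (rule LIMSEQ_unique)
  then show ?thesis by simp
qed

text \<open>The function \<open>v\<close> solves \<tau> v = w. Testing the adjoint relation with
  those \<open>h\<close> on (0, c) that belong to a solution vanishing beyond \<open>c\<close>,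
  namely those orthogonal to \<open>cnj s\<close>, shows that they are orthogonal to u - v. Hence u
  - v is a multiple of \<open>cnj s\<close> on (0, c).\<close>

lemma T0_adjoint_local:
  assumes s: "sol (\<lambda>_. 0) s \<sigma> 0 1" and v: "sol w v vg 0 0"
    and u: "u \<in> borel_measurable borel" "u \<in> L2" and w: "w \<in> borel_measurable borel" "w \<in> L2"
    and adj: "\<And>f h. (f, h) \<in> T0 \<Longrightarrow> ip h u = ip f w" and c: "0 < c"
  shows "\<exists>\<alpha>. AE t in lborel. 0 < t \<and> t < c \<longrightarrow> u t = v t + \<alpha> * cnj (s t)"
proof -
  have [measurable]: "s \<in> borel_measurable borel" "u \<in> borel_measurable borel"
    "w \<in> borel_measurable borel" "v \<in> borel_measurable borel"
    using solD[OF s] solD[OF v] u w by auto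
  have [measurable]: "(\<lambda>t. cnj (s t)) \<in> borel_measurable borel"
    "(\<lambda>t. cnj (u t)) \<in> borel_measurable borel"
     "(\<lambda>t. cnj (v t)) \<in> borel_measurable borel" by (auto intro: borel_measurable_cnj)
  have key: "prim lborel (\<lambda>t. h t * cnj (u t - v t)) c = 0"
    if h: "h \<in> borel_measurable borel"
      "h \<in> L2" and hz: "\<And>t. c \<le> t \<Longrightarrow> h t = 0" and hs: "prim lborel (\<lambda>t. h t * s t) c = 0" for h
  proof -
    have [measurable]: "h \<in> borel_measurable borel" by (rule h)
    have hh: "(\<lambda>t. if t < c then h t else 0) = h" using hz by fastforce
    obtain f g b where f: "sol h f g 0 b" "\<And>t. t > c \<Longrightarrow> f t = 0" "\<And>t. t > c \<Longrightarrow> g t = 0"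
      using sol_zero_init_compact[OF s h(1) L2_loc(2)[OF h] c hs] unfolding hh by blast
    have T: "(f, h) \<in> T0" unfolding T0_def using f h hz c by blast
    then have fL: "f \<in> borel_measurable borel" "f \<in> L2" using T0_subset_D0 D0_borel by blast+
    note l1 = ip_lim[OF h u] and l2 = ip_lim[OF fL w]
    \<comment> \<open>\<open>f\<close> and \<open>g\<close> are known to vanish only beyond
      \<open>c\<close>, hence the endpoint \<open>c + 1\<close>.\<close>
    have "ip h u = prim lborel (\<lambda>t. h t * cnj (u t)) (c + 1)"
      by (rule LIMSEQ_unique[OF l1(2) prim_vanishing_lim]) (use hz in auto)
    moreover have "ip f w = prim lborel (\<lambda>t. f t * cnj (w t)) (c + 1)"
      by (rule LIMSEQ_unique[OF l2(2) prim_vanishing_lim]) (use f in auto)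
    moreover have "prim lborel (\<lambda>t. cnj (v t) * h t - f t * cnj (w t)) (c + 1) = 0"
      using sol_green(2)[OF f(1) sol_cnj[OF v], of "c + 1"] f(2,3)[of "c + 1"] by simp
    moreover have hv: "loc lborel (\<lambda>t. cnj (v t) * h t)"
    proof -
      have "loc lborel (\<lambda>t. h t * cnj (v t))"
        using sol_locally_bounded(1)[OF v] h L2_loc(2)[OF h]
        by (intro loc_times_locally_bounded locally_bounded_cnj)
      then show ?thesis by (simp add: mult.commute)
    qed
    ultimately have "prim lborel (\<lambda>t. h t * cnj (u t)) (c + 1) - prim lborel (\<lambda>t. cnj (v t) * h t) (c + 1) = 0"
      using adj[OF T] prim_diff[OF hv l2(1)] by simp
    then have "prim lborel (\<lambda>t. h t * cnj (u t) - cnj (v t) * h t) (c + 1) = 0"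
      using prim_diff[OF l1(1) hv] by simp
    moreover have "(\<lambda>t. h t * cnj (u t) - cnj (v t) * h t) = (\<lambda>t. h t * cnj (u t - v t))"
      by (simp add: algebra_simps)
    moreover have "prim lborel (\<lambda>t. h t * cnj (u t - v t)) (c + 1) = prim lborel (\<lambda>t. h t * cnj (u t - v t)) c"
      by (rule prim_vanishing) (use hz in auto)
    ultimately show ?thesis by simp
  qed
  define d where "d t = (if 0 < t \<and> t < c then u t - v t else 0)" for t
  define s' where "s' t = (if 0 < t \<and> t < c then s t else 0)" for t
  have lb_trunc: "(\<lambda>t. if 0 < t \<and> t < c then f t else 0) \<in> L2" if f: "locally_bounded f" for f
  proof (rule locally_bounded_compact_L2[where c = c])
    have [measurable]: "f \<in> borel_measurable borel" using f unfolding locally_bounded_def by simp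
    show "locally_bounded (\<lambda>t. if 0 < t \<and> t < c then f t else 0)"
      unfolding locally_bounded_def
    proof (intro conjI allI)
      fix e
      obtain K where "\<And>t. 0 < t \<Longrightarrow> t \<le> e \<Longrightarrow> norm (f t) \<le> K" using f unfolding locally_bounded_def by meson
      then show "\<exists>K. \<forall>t. 0 < t \<longrightarrow> t \<le> e \<longrightarrow> norm (if 0 < t \<and> t < c then f t else 0) \<le> K"
        by (intro exI[of _ "max K 0"]) (auto simp: le_max_iff_disj)
    qed measurable
  qed auto
  have s'L: "s' \<in> L2" unfolding s'_def using lb_trunc[OF sol_locally_bounded(1)[OF s]] by simp
  have v'L: "(\<lambda>t. if 0 < t \<and> t < c then v t else 0) \<in> L2"
    using lb_trunc[OF sol_locally_bounded(1)[OF v]] .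
  have u'L: "(\<lambda>t. if 0 < t \<and> t < c then u t else 0) \<in> L2"
  proof -
    have "integrable half_line (\<lambda>t. (norm (u t))\<^sup>2)" using u unfolding L2_def by simp
    then have "integrable half_line (\<lambda>t. (norm (if 0 < t \<and> t < c then u t else 0))\<^sup>2)"
      by (rule Bochner_Integration.integrable_bound) (auto intro!: measurable_half_line)
    then show ?thesis unfolding L2_def by (auto intro!: measurable_half_line)
  qed
  have dL: "d \<in> L2"
  proof -
    have "d = (\<lambda>t. (if 0 < t \<and> t < c then u t else 0) - (if 0 < t \<and> t < c then v t else 0))"
      unfolding d_def by auto
    then show ?thesis using u'L v'L sqint_diff unfolding L2_iff_sqint by simp
  qed
  have [measurable]: "d \<in> borel_measurable borel" "s' \<in> borel_measurable borel" unfolding d_def s'_def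
    by measurable
  have cs'L: "(\<lambda>t. cnj (s' t)) \<in> L2" using s'L sqint_cnj unfolding L2_iff_sqint by blast
  have cs'm [measurable]: "(\<lambda>t. cnj (s' t)) \<in> borel_measurable borel"
    by (auto intro: borel_measurable_cnj)
  define n where "n = prim lborel (\<lambda>t. (norm (s' t))\<^sup>2) c"
  \<comment> \<open>The coefficient of the projection of \<open>d\<close> onto
    \<open>cnj s'\<close>. If n = 0, the division gives \<alpha> = 0, and Cauchy-Schwarz shows that
    \<open>ds0\<close> still holds.\<close>
  define \<alpha> where "\<alpha> = prim lborel (\<lambda>t. d t * s' t) c / of_real n"
  define h where "h t = d t - \<alpha> * cnj (s' t)" for t
  have [measurable]: "h \<in> borel_measurable borel" unfolding h_def by measurable
  have hL: "h \<in> L2" using dL cs'L sqint_diff sqint_mult unfolding h_def L2_iff_sqint by blast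
  have hz: "h t = 0" if "c \<le> t" for t unfolding h_def d_def s'_def using that by simp
  have loc_ds: "loc lborel (\<lambda>t. d t * s' t)" 
    using ip_lim(1)[OF _ dL _ cs'L] by simp
  have loc_ss: "loc lborel (\<lambda>t. cnj (s' t) * s' t)" using ip_lim(1)[OF _ cs'L _ cs'L] by simp
  have ss: "prim lborel (\<lambda>t. cnj (s' t) * s' t) c = of_real n"
    unfolding n_def prim_of_real[symmetric]
    by (simp add: complex_norm_square mult.commute del: of_real_power)
  have ds0: "prim lborel (\<lambda>t. d t * s' t) c = \<alpha> * of_real n"
  proof (cases "n = 0")
    case True
    have "(norm (prim lborel (\<lambda>t. d t * s' t) c))\<^sup>2 \<le> prim lborel (\<lambda>t. (norm (d t))\<^sup>2) c * n"
      unfolding n_def using dL s'L by (intro prim_cauchy_schwarz L2_loc) auto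
    then show ?thesis using True by simp
  next
    case False
    then show ?thesis unfolding \<alpha>_def by simp
  qed
  have hs': "prim lborel (\<lambda>t. h t * s' t) c = 0"
  proof -
    have "(\<lambda>t. h t * s' t) = (\<lambda>t. d t * s' t - \<alpha> * (cnj (s' t) * s' t))" unfolding h_def
      by (simp add: algebra_simps)
    then show ?thesis using ds0 ss by (simp add: prim_diff[OF loc_ds loc_mult[OF loc_ss]] prim_mult)
  qed
  have "prim lborel (\<lambda>t. h t * s t) c = prim lborel (\<lambda>t. h t * s' t) c"
    by (rule prim_cong) (auto simp: s'_def)
  then have "prim lborel (\<lambda>t. h t * cnj (u t - v t)) c = 0"
    using key[of h] hL hz hs' by simp
  moreover have "prim lborel (\<lambda>t. h t * cnj (u t - v t)) c = prim lborel (\<lambda>t. h t * cnj (d t)) c"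
    by (rule prim_cong) (auto simp: d_def)
  ultimately have hd: "prim lborel (\<lambda>t. h t * cnj (d t)) c = 0" by simp
  \<comment> \<open>\<open>h\<close> is orthogonal to both \<open>d\<close> and
    \<open>cnj s'\<close>, of which it is a combination, so its norm vanishes.\<close>
  have hh: "(\<lambda>t. complex_of_real ((norm (h t))\<^sup>2)) = (\<lambda>t. h t * cnj (d t) - cnj \<alpha> * (h t * s' t))"
  proof
    fix t
    have "complex_of_real ((norm (h t))\<^sup>2) = h t * cnj (h t)" by (rule complex_norm_square)
    also have "cnj (h t) = cnj (d t) - cnj \<alpha> * s' t" unfolding h_def by simp
    finally show "complex_of_real ((norm (h t))\<^sup>2) = h t * cnj (d t) - cnj \<alpha> * (h t * s' t)"
      by (simp add: algebra_simps)
  qed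
  have "loc lborel (\<lambda>t. h t * cnj (d t))" "loc lborel (\<lambda>t. h t * s' t)"
    using ip_lim(1)[OF _ hL _ dL] ip_lim(1)[OF _ hL _ cs'L] by simp_all
  then have "complex_of_real (prim lborel (\<lambda>t. (norm (h t))\<^sup>2) c) = 0"
    unfolding prim_of_real[symmetric] hh using hd hs' by (simp add: prim_diff loc_mult prim_mult)
  then have "prim lborel (\<lambda>t. (norm (h t))\<^sup>2) c = 0" by simp
  then have "AE t in lborel. indicator {0<..<c} t *\<^sub>R (norm (h t))\<^sup>2 = 0"
    using locD[OF L2_loc(1)[OF _ hL], of c]
    unfolding prim_def set_lebesgue_integral_def set_integrable_def
    by (subst (asm) integral_nonneg_eq_0_iff_AE) auto
  then have "AE t in lborel. 0 < t \<and> t < c \<longrightarrow> u t = v t + \<alpha> * cnj (s t)"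
    by eventually_elim (auto simp: h_def d_def s'_def diff_eq_eq add.commute)
  then show ?thesis by blast
qed

text \<open>The constants found on the intervals (0, n) agree as soon as \<open>s\<close> is not
  almost everywhere zero on the smaller interval. Then \<open>v + \<alpha> * cnj s\<close> is the
  representative of \<open>u\<close> that satisfies the integral equations with initial value
  0.\<close>

lemma T0_adjoint:
  assumes u: "u \<in> borel_measurable borel" "u \<in> L2" and w: "w \<in> borel_measurable borel" "w \<in> L2"
    and adj: "\<And>f h. (f, h) \<in> T0 \<Longrightarrow> ip h u = ip f w"
  shows "\<exists>f. (f, w) \<in> D0 \<and> (AE x in half_line. u x = f x)"
proof -
  obtain s \<sigma> where s: "sol (\<lambda>_. 0) s \<sigma> 0 1"
    using sol_exists[of "\<lambda>_. 0" 0 1] loc_const[OF loc_finite_lborel, of 0] by auto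
  obtain v vg where v: "sol w v vg 0 0" using sol_exists[OF w(1) L2_loc(2)[OF w], of 0 0] by blast
  have "\<exists>\<alpha>. AE t in lborel. 0 < t \<and> t < real (Suc n) \<longrightarrow> u t = v t + \<alpha> * cnj (s t)" for n
    by (rule T0_adjoint_local[OF s v u w adj]) auto
  then obtain A where A: "\<And>n. AE t in lborel. 0 < t \<and> t < real (Suc n) \<longrightarrow> u t = v t + A n * cnj (s t)"
    by metis
  have "\<exists>\<alpha>. \<forall>n. AE t in lborel. 0 < t \<and> t < real (Suc n) \<longrightarrow> u t = v t + \<alpha> * cnj (s t)"
  \<comment> \<open>If \<open>s\<close> vanishes almost everywhere, every \<alpha> serves; otherwise
    an interval on which it does not fixes \<alpha>.\<close>
  proof (cases "\<forall>n. AE t in lborel. 0 < t \<and> t < real (Suc n) \<longrightarrow> s t = 0")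
    case True
    have "AE t in lborel. 0 < t \<and> t < real (Suc n) \<longrightarrow> u t = v t + 0 * cnj (s t)" for n
      using A[of n] True[rule_format, of n] by eventually_elim auto
    then show ?thesis by blast
  next
    case False
    then obtain m where m: "\<not> (AE t in lborel. 0 < t \<and> t < real (Suc m) \<longrightarrow> s t = 0)" by blast
    have eq: "A n = A m" if "m \<le> n" for n
    proof (rule ccontr)
      assume ne: "A n \<noteq> A m"
      have "AE t in lborel. 0 < t \<and> t < real (Suc m) \<longrightarrow> s t = 0"
        using A[of n] A[of m]
      proof eventually_elim
        fix t
        assume "0 < t \<and> t < real (Suc n) \<longrightarrow> u t = v t + A n * cnj (s t)"
          "0 < t \<and> t < real (Suc m) \<longrightarrow> u t = v t + A m * cnj (s t)"
        then show "0 < t \<and> t < real (Suc m) \<longrightarrow> s t = 0" using that ne by auto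
      qed
      with m show False by blast
    qed
    have "AE t in lborel. 0 < t \<and> t < real (Suc n) \<longrightarrow> u t = v t + A m * cnj (s t)" for n
      using A[of "max m n"] unfolding eq[of "max m n", OF max.cobounded1]
      by eventually_elim (auto simp: max_def)
    then show ?thesis by blast
  qed
  then obtain \<alpha> where \<alpha>: "\<And>n. AE t in lborel. 0 < t \<and> t < real (Suc n) \<longrightarrow> u t = v t + \<alpha> * cnj (s t)"
    by blast
  define f where "f t = v t + \<alpha> * cnj (s t)" for t
  have "AE t in lborel. \<forall>n. 0 < t \<and> t < real (Suc n) \<longrightarrow> u t = v t + \<alpha> * cnj (s t)"
    by (rule iffD2[OF AE_all_countable]) (use \<alpha> in blast)
  then have ae: "AE t in half_line. u t = f t"
    unfolding AE_half_line
  proof eventually_elim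
    fix t assume *: "\<forall>n. 0 < t \<and> t < real (Suc n) \<longrightarrow> u t = v t + \<alpha> * cnj (s t)"
    obtain n where "t < real n" using reals_Archimedean2 by blast
    then have "t < real (Suc n)" by simp
    with * show "0 < t \<longrightarrow> u t = f t" unfolding f_def by blast
  qed
  have "sol (\<lambda>t. w t + \<alpha> * cnj 0) f (\<lambda>t. vg t + \<alpha> * cnj (\<sigma> t)) (0 + \<alpha> * cnj 0) (0 + \<alpha> * cnj 1)"
    unfolding f_def by (rule sol_lincomb[OF v sol_cnj[OF s]])
  then have sf: "sol w f (\<lambda>t. vg t + \<alpha> * cnj (\<sigma> t)) 0 \<alpha>" by simp
  have "f \<in> L2"
    using sqint_cong_AE(1)[OF measurable_half_line[OF u(1)] measurable_half_line[OF solD(3)[OF sf]] ae] u(2)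
    unfolding L2_iff_sqint by simp
  then have "(f, w) \<in> D0" unfolding D0_def using sf w by blast
  then show ?thesis using ae by blast
qed

end

section \<open>Continuity and uniqueness\<close>

text \<open>Dominated convergence for the truncations of \<open>u\<close> at \<open>S n\<close>. The
  hypotheses on \<open>S\<close> cover approach to \<open>x\<close> from the left, where an atom at
  \<open>x\<close> is never counted, as well as approach to 0 from the right.\<close>

lemma prim_lim:
  assumes N: "loc_finite N" and u: "loc N u" "u \<in> borel_measurable borel"
    and S: "\<And>n. S n \<le> c" "\<And>t. 0 < t \<Longrightarrow> t < c \<Longrightarrow> t \<noteq> x \<Longrightarrow> eventually (\<lambda>n. (t < S n) = (t < x)) sequentially"
    and x: "x \<le> c" "0 < x \<Longrightarrow> x < c \<Longrightarrow> eventually (\<lambda>n. \<not> x < S n) sequentially"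
  shows "(\<lambda>n. prim N u (S n)) \<longlonglongrightarrow> prim N u x"
proof -
  have [measurable]: "u \<in> borel_measurable borel" by (rule u)
  have "(\<lambda>n. prim N (\<lambda>t. if t < S n then u t else 0) c) \<longlonglongrightarrow> prim N (\<lambda>t. if t < x then u t else 0) c"
  proof (rule prim_dominated_convergence[OF loc_finiteD(1)[OF N] loc_norm[OF u(1)]])
    fix t assume t: "0 < t" "t < c"
    have "eventually (\<lambda>n. (t < S n) = (t < x)) sequentially"
      using S(2)[OF t] x(2) t by (cases "t = x") auto
    then have "eventually (\<lambda>n. (if t < S n then u t else 0) = (if t < x then u t else 0)) sequentially"
      by eventually_elim simp
    then show "(\<lambda>n. if t < S n then u t else 0) \<longlonglongrightarrow> (if t < x then u t else 0)"
      by (rule tendsto_eventually)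
  qed auto
  moreover have "prim N (\<lambda>t. if t < y then u t else 0) c = prim N u y" if "y \<le> c" for y
  proof -
    have "prim N (\<lambda>t. if t < y then u t else 0) c = prim N (\<lambda>t. if t < y then u t else 0) y"
      using that by (intro prim_vanishing) auto
    also have "\<dots> = prim N u y" by (rule prim_cong) auto
    finally show ?thesis .
  qed
  ultimately show ?thesis using S(1) x(1) by simp
qed

lemma prim_left_continuous:
  assumes N: "loc_finite N" and u: "loc N u" "u \<in> borel_measurable borel"
  shows "(prim N u \<longlongrightarrow> prim N u x) (at_left x)"
proof (rule tendsto_at_left_sequentially[of "x - 1"])
  fix S :: "nat \<Rightarrow> real" assume S: "\<And>n. S n < x" "S \<longlonglongrightarrow> x"
  show "(\<lambda>n. prim N u (S n)) \<longlonglongrightarrow> prim N u x"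
  proof (rule prim_lim[OF N u, of S x])
    fix t assume "t < x"
    then have "eventually (\<lambda>n. t < S n) sequentially" using order_tendstoD(1)[OF S(2)] by blast
    then show "eventually (\<lambda>n. (t < S n) = (t < x)) sequentially"
      by eventually_elim (use \<open>t < x\<close> in simp)
  qed (use S(1) in \<open>auto simp: less_imp_le\<close>)
qed simp

lemma prim_at_right_0:
  assumes N: "loc_finite N" and u: "loc N u" "u \<in> borel_measurable borel"
  shows "(prim N u \<longlongrightarrow> 0) (at_right 0)"
proof (rule tendsto_at_right_sequentially[of 0 1])
  fix S :: "nat \<Rightarrow> real" assume S: "\<And>n. 0 < S n" "\<And>n. S n < 1" "S \<longlonglongrightarrow> 0"
  have "(\<lambda>n. prim N u (S n)) \<longlonglongrightarrow> prim N u 0"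
  proof (rule prim_lim[OF N u, of S 1])
    fix t :: real assume t: "0 < t" "t < 1" "t \<noteq> 0"
    have "eventually (\<lambda>n. S n < t) sequentially" using order_tendstoD(2)[OF S(3) t(1)] .
    then show "eventually (\<lambda>n. (t < S n) = (t < 0)) sequentially"
      by eventually_elim (use t in simp)
  qed (use S(2) in \<open>auto simp: less_imp_le\<close>)
  then show "(\<lambda>n. prim N u (S n)) \<longlonglongrightarrow> 0" by simp
qed simp

text \<open>A nonzero value would persist on an interval to the left, which has positive
  measure.\<close>

lemma left_continuous_AE_zero:
  fixes f :: "real \<Rightarrow> complex"
  assumes f: "(f \<longlongrightarrow> f x) (at_left x)" and ae: "AE t in lborel. 0 < t \<longrightarrow> f t = 0" and x: "0 < x"
  shows "f x = 0"
proof (rule ccontr)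
  assume "f x \<noteq> 0"
  then have "eventually (\<lambda>t. f t \<noteq> 0) (at_left x)" using tendsto_imp_eventually_ne[OF f] by blast
  then obtain b where b: "b < x" "\<And>t. b < t \<Longrightarrow> t < x \<Longrightarrow> f t \<noteq> 0" unfolding eventually_at_left_field
    by blast
  have "AE t in lborel. t \<notin> {max b 0<..<x}"
    using ae by eventually_elim (use b(2) in auto)
  then have "emeasure lborel {max b 0<..<x} = 0"
    using AE_iff_null_sets[of "{max b 0<..<x}" lborel] null_setsD1 by auto
  then show False using b(1) x by simp
qed

text \<open>Equality on the half lines \<open>{..<x}\<close>, an intersection-stable generator,
  extends to all Borel sets. Cutting with (0, c) makes the functions integrable, as complements and
  countable unions require.\<close>

lemma set_integral_eq_if_prim_eq:
  fixes u1 u2 :: "real \<Rightarrow> 'a::{banach, second_countable_topology}"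
  assumes N: "sets N1 = sets borel" "sets N2 = sets borel" and u: "loc N1 u1" "loc N2 u2"
    and eq: "\<And>x. prim N1 u1 x = prim N2 u2 x" and A: "A \<in> sets borel"
  shows "(LINT t:A \<inter> {0<..<c}|N1. u1 t) = (LINT t:A \<inter> {0<..<c}|N2. u2 t)"
proof -
  let ?P = "\<lambda>A. (LINT t:A \<inter> {0<..<c}|N1. u1 t) = (LINT t:A \<inter> {0<..<c}|N2. u2 t)"
  have bor: "sets (borel :: real measure) = sigma_sets UNIV (range lessThan)"
    by (subst borel_Iio) simp
  have sI: "set_integrable N (B \<inter> {0<..<c}) v" if "B \<in> sets borel" "sets N = sets borel"
    "loc N v" for N B and v :: "real \<Rightarrow> 'a"
    using that by (intro set_integrable_subset[OF locD[of N v c]]) auto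
  have "Int_stable (range lessThan :: real set set)"
    unfolding Int_stable_def
  proof safe
    fix a b :: real
    have "{..<a} \<inter> {..<b} = {..<min a b}" by auto
    then show "{..<a} \<inter> {..<b} \<in> range lessThan" by blast
  qed
  moreover have "range lessThan \<subseteq> Pow (UNIV :: real set)" by simp
  moreover have "A \<in> sigma_sets UNIV (range lessThan)" using A unfolding bor .
  ultimately show "?P A"
  proof (induction rule: sigma_sets_induct_disjoint)
    case (basic A)
    then obtain x where "A = {..<x}" by auto
    then have "A \<inter> {0<..<c} = {0<..<min x c}" by auto
    then show ?case using eq[of "min x c"] unfolding prim_def by simp
  next
    case empty
    then show ?case by (simp add: set_lebesgue_integral_def)
  next
    case (compl A)
    then have A: "A \<in> sets borel" unfolding bor by blast
    have split: "(LINT t:{0<..<c}|N. v t) = (LINT t:A \<inter> {0<..<c}|N. v t) + (LINT t:(UNIV - A) \<inter> {0<..<c}|N. v t)"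
      if "sets N = sets borel" "loc N v" for N and v :: "real \<Rightarrow> 'a"
    proof -
      have "{0<..<c} = (A \<inter> {0<..<c}) \<union> ((UNIV - A) \<inter> {0<..<c})" by auto
      then have "(LINT t:{0<..<c}|N. v t) = (LINT t:(A \<inter> {0<..<c}) \<union> ((UNIV - A) \<inter> {0<..<c})|N. v t)"
        by simp
      also have "\<dots> = (LINT t:A \<inter> {0<..<c}|N. v t) + (LINT t:(UNIV - A) \<inter> {0<..<c}|N. v t)"
        using A that by (intro set_integral_Un sI) auto
      finally show ?thesis .
    qed
    have "(LINT t:{0<..<c}|N1. u1 t) = (LINT t:{0<..<c}|N2. u2 t)" using eq[of c] unfolding prim_def .
    then show ?case using compl.IH unfolding split[OF N(1) u(1)] split[OF N(2) u(2)] by simp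
  next
    case (union A)
    have A: "A i \<in> sets borel" for i using union(2) unfolding bor by blast
    have split: "(LINT t:(\<Union>i. A i) \<inter> {0<..<c}|N. v t) = (\<Sum>i. LINT t:A i \<inter> {0<..<c}|N. v t)"
      if "sets N = sets borel" "loc N v" for N and v :: "real \<Rightarrow> 'a"
    proof -
      have "(LINT t:(\<Union>i. A i \<inter> {0<..<c})|N. v t) = (\<Sum>i. LINT t:A i \<inter> {0<..<c}|N. v t)"
      proof (rule lebesgue_integral_countable_add)
        show "set_integrable N (\<Union>i. A i \<inter> {0<..<c}) v"
          using sI[of "\<Union>i. A i" N v] A that by (simp add: Int_UN_distrib2)
        show "A i \<inter> {0<..<c} \<in> sets N" for i using A that by simp
        show "A i \<inter> {0<..<c} \<inter> (A j \<inter> {0<..<c}) = {}" if "i \<noteq> j" for i j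
          using union(1) that unfolding disjoint_family_on_def by blast
      qed
      then show ?thesis by (simp add: Int_UN_distrib2)
    qed
    show ?case unfolding split[OF N(1) u(1)] split[OF N(2) u(2)] using union(3) by simp
  qed
qed

lemma prim_zero_AE:
  assumes u: "loc lborel u" and z: "\<And>x. prim lborel u x = 0"
  shows "AE t in lborel. 0 < t \<longrightarrow> u t = 0"
proof -
  have "AE t in lborel. indicator {0<..<real n} t *\<^sub>R u t = 0" for n
  proof (rule sigma_finite_measure.density_zero[OF lborel.sigma_finite_measure_axioms])
    show "integrable lborel (\<lambda>t. indicator {0<..<real n} t *\<^sub>R u t)" using locD[OF u]
      unfolding set_integrable_def .
    fix A :: "real set" assume A: "A \<in> sets lborel"
    have "(LINT t:A|lborel. indicator {0<..<real n} t *\<^sub>R u t) = (LINT t:A \<inter> {0<..<real n}|lborel. u t)"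
      unfolding set_lebesgue_integral_def
      by (intro Bochner_Integration.integral_cong) (auto simp: indicator_def)
    also have "\<dots> = (LINT t:A \<inter> {0<..<real n}|lborel. 0)"
    proof (rule set_integral_eq_if_prim_eq[OF _ _ u])
      show "loc lborel (\<lambda>_. 0)" by (rule loc_const[OF loc_finite_lborel])
      show "prim lborel u x = prim lborel (\<lambda>_. 0) x" for x using z by (simp add: prim_def)
    qed (use A in auto)
    finally show "(LINT t:A|lborel. indicator {0<..<real n} t *\<^sub>R u t) = 0" by simp
  qed
  then have "AE t in lborel. \<forall>n::nat. indicator {0<..<real n} t *\<^sub>R u t = 0"
    by (intro iffD2[OF AE_all_countable]) blast
  then show ?thesis
  proof eventually_elim
    fix t assume *: "\<forall>n::nat. indicator {0<..<real n} t *\<^sub>R u t = 0"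
    obtain n where "t < real n" using reals_Archimedean2 by blast
    then show "0 < t \<longrightarrow> u t = 0" using *[rule_format, of n] by auto
  qed
qed

text \<open>Singularity of d\<nu> enters the analysis through this condition. For d\<nu> = -dx, for
  example, dP would be 0 and \<open>f\<close> would carry no information on
  \<open>g\<close>.\<close>

locale sl_nondegenerate = sl_system +
  assumes nondegenerate: "\<And>g. locally_bounded g \<Longrightarrow> (\<And>x. IP g x = 0) \<Longrightarrow> AE t in lborel. 0 < t \<longrightarrow> g t = 0"
begin

lemma IP_left_continuous:
  assumes g: "locally_bounded g" shows "(IP g \<longlongrightarrow> IP g x) (at_left x)"
proof -
  have "loc M1 g" "loc M2 g" "g \<in> borel_measurable borel"
    using locally_bounded_locP[OF g] g unfolding locP_def locally_bounded_def by auto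
  then show ?thesis unfolding IP_def[abs_def] by (intro tendsto_diff prim_left_continuous M1 M2)
qed

lemma IP_at_right_0:
  assumes g: "locally_bounded g" shows "(IP g \<longlongrightarrow> 0) (at_right 0)"
proof -
  have g12: "loc M1 g" "loc M2 g" "g \<in> borel_measurable borel"
    using locally_bounded_locP[OF g] g unfolding locP_def locally_bounded_def by auto
  have "((\<lambda>x. prim M1 g x - prim M2 g x) \<longlongrightarrow> 0 - 0) (at_right 0)"
    using g12 by (intro tendsto_diff prim_at_right_0 M1 M2)
  then show ?thesis unfolding IP_def[abs_def] by simp
qed

text \<open>From f = 0 nondegeneracy gives g = 0 almost everywhere, and left-continuity gives it at
  every x > 0. Thus the integral of \<open>h\<close> over (0, x) equals \<open>b\<close> for all x >
  0, and x tending to 0 gives b = 0. So \<tau> is single-valued, and a solution with slope 1 at 0 is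
  not zero.\<close>

lemma sol_trivial:
  assumes s: "sol h f g 0 b" and z: "AE t in lborel. 0 < t \<longrightarrow> f t = 0"
  shows "b = 0" "AE t in lborel. 0 < t \<longrightarrow> h t = 0"
proof -
  have feq: "f = IP g" and geq: "g = (\<lambda>x. b + prim lborel (\<lambda>t. of_real (q t) * f t - h t) x)"
    using solD(5)[OF s] solD(6)[OF s] by auto
  have lg: "locally_bounded g" by (rule sol_locally_bounded(2)[OF s])
  have fz: "f x = 0" if "0 < x" for x
    using IP_left_continuous[OF lg] z that by (intro left_continuous_AE_zero) (auto simp: feq)
  have "IP g x = 0" for x
    using fz[of x] unfolding feq by (cases "0 < x") (auto simp: IP_def)
  then have gz: "AE t in lborel. 0 < t \<longrightarrow> g t = 0" by (rule nondegenerate[OF lg])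
  have "(g \<longlongrightarrow> g x) (at_left x)" for x
    by (subst (1 2) geq) (intro tendsto_add tendsto_const prim_left_continuous loc_finite_lborel sol_q[OF s])
  then have gz': "g x = 0" if "0 < x" for x using gz that by (intro left_continuous_AE_zero) auto
  have "g x = b - prim lborel h x" for x
  proof -
    have "prim lborel (\<lambda>t. of_real (q t) * f t - h t) x = prim lborel (\<lambda>t. (-1) * h t) x"
      by (rule prim_cong) (simp add: fz)
    then show ?thesis using solD(6)[OF s, of x] unfolding prim_mult by simp
  qed
  then have hb: "prim lborel h x = b" if "0 < x" for x using gz'[OF that] by simp
  have "(prim lborel h \<longlongrightarrow> 0) (at_right 0)"
    using solD(1,2)[OF s] by (intro prim_at_right_0 loc_finite_lborel)
  moreover have "(prim lborel h \<longlongrightarrow> b) (at_right 0)"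
    by (rule tendsto_eventually) (use hb in \<open>auto simp: eventually_at_right_field intro: exI[of _ 1]\<close>)
  ultimately show b: "b = 0" using tendsto_unique[of "at_right (0::real)"] by force
  have "prim lborel h x = 0" for x using hb[of x] b by (cases "0 < x") auto
  then show "AE t in lborel. 0 < t \<longrightarrow> h t = 0" by (rule prim_zero_AE[OF solD(2)[OF s]])
qed

lemma T0_lincomb:
  assumes "(f1, h1) \<in> T0" "(f2, h2) \<in> T0"
  shows "(\<lambda>x. f1 x + c * f2 x, \<lambda>x. h1 x + c * h2 x) \<in> T0"
proof -
  obtain g1 b1 c1 where 1: "0 < c1" "sol h1 f1 g1 0 b1" "\<forall>t>c1. f1 t = 0 \<and> g1 t = 0" "\<forall>t\<ge>c1. h1 t = 0"
    "h1 \<in> L2"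
    using assms(1) unfolding T0_def by blast
  obtain g2 b2 c2 where 2: "0 < c2" "sol h2 f2 g2 0 b2" "\<forall>t>c2. f2 t = 0 \<and> g2 t = 0" "\<forall>t\<ge>c2. h2 t = 0"
    "h2 \<in> L2"
    using assms(2) unfolding T0_def by blast
  have "sol (\<lambda>t. h1 t + c * h2 t) (\<lambda>t. f1 t + c * f2 t) (\<lambda>t. g1 t + c * g2 t) 0 (b1 + c * b2)"
    using sol_lincomb[OF 1(2) 2(2), of c] by simp
  moreover have "(\<lambda>t. h1 t + c * h2 t) \<in> L2" using 1(5) 2(5) sqint_add sqint_mult unfolding L2_iff_sqint
    by blast
  moreover have "\<forall>t>max c1 c2. f1 t + c * f2 t = 0 \<and> g1 t + c * g2 t = 0"
    "\<forall>t\<ge>max c1 c2. h1 t + c * h2 t = 0" "0 < max c1 c2"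
    using 1 2 by auto
  ultimately show ?thesis unfolding T0_def by blast
qed

lemma T0_zero: "(\<lambda>_. 0, \<lambda>_. 0) \<in> T0"
proof -
  have "sol (\<lambda>_. 0) (\<lambda>_. 0) (\<lambda>_. 0) 0 0"
    unfolding sol_def using loc_const[OF loc_finite_lborel, of 0]
    by (simp add: IP_def prim_def set_lebesgue_integral_def)
  moreover have "(\<lambda>_. 0) \<in> L2" unfolding L2_iff_sqint by (rule sqint_zero)
  ultimately show ?thesis
    unfolding T0_def by (auto intro!: exI[of _ "\<lambda>_. 0"] exI[of _ "0::complex"] exI[of _ "1::real"])
qed

text \<open>If \<open>v\<close> is orthogonal to the domain of \<open>T0\<close>, the pair (0, v)
  belongs to the adjoint of \<open>T0\<close>; so v = \<tau> 0 almost everywhere, which is 0 by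
  \<open>sol_trivial\<close>.\<close>

lemma T0_dense:
  assumes u: "u \<in> L2" and e: "0 < e"
  shows "\<exists>(f, h)\<in>T0. L2_norm (\<lambda>x. u x - f x) < e"
proof -
  have "\<exists>f\<in>Domain T0. nsq half_line (\<lambda>x. u x - f x) < e\<^sup>2"
  proof (rule dense_if_orthogonal_trivial[OF sigma_finite_half_line])
    show "sqint half_line f" if "f \<in> Domain T0" for f
      using that T0_subset_D0 D0_borel unfolding L2_iff_sqint[symmetric] by blast
    show "(\<lambda>_. 0) \<in> Domain T0" using T0_zero by blast
    show "(\<lambda>x. f x + c * g x) \<in> Domain T0" if "f \<in> Domain T0" "g \<in> Domain T0" for f g c
      using that T0_lincomb by blast
    fix v assume v: "sqint half_line v" and orth: "\<And>f. f \<in> Domain T0 \<Longrightarrow> (LINT x|half_line. v x * cnj (f x)) = 0"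
    have vm: "v \<in> borel_measurable half_line" using v unfolding sqint_def by simp
    obtain w where w: "w \<in> borel_measurable borel" "AE x in half_line. v x = w x"
      using half_line_borel_rep[OF vm] by blast
    have wL: "w \<in> L2" using sqint_cong_AE(1)[OF vm measurable_half_line[OF w(1)] w(2)] v
      unfolding L2_iff_sqint by simp
    have z: "(\<lambda>_. 0) \<in> L2" unfolding L2_iff_sqint by (rule sqint_zero)
    have "ip h (\<lambda>_. 0) = ip f w" if fh: "(f, h) \<in> T0" for f h
    proof -
      have fL: "f \<in> L2" using fh T0_subset_D0 D0_borel by blast
      have "ip f w = cnj (ip w f)" by (simp add: ip_cnj)
      also have "ip w f = ip v f"
        using w(2) by (intro ip_cong_AE measurable_half_line[OF w(1)] vm L2_measurable[OF fL]) auto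
      also have "ip v f = 0" unfolding ip_def using orth fh by blast
      finally show ?thesis by (simp add: ip_def)
    qed
    then obtain f where f: "(f, w) \<in> D0" "AE x in half_line. 0 = f x"
      using T0_adjoint[OF _ z w(1) wL] by auto
    obtain g b where s: "sol w f g 0 b" using f(1) unfolding D0_def by blast
    have "AE t in lborel. 0 < t \<longrightarrow> f t = 0" using f(2) unfolding AE_half_line by eventually_elim auto
    then have "AE t in lborel. 0 < t \<longrightarrow> w t = 0" by (rule sol_trivial(2)[OF s])
    then have "AE x in half_line. w x = 0" unfolding AE_half_line .
    with w(2) show "AE x in half_line. v x = 0" by eventually_elim simp
  qed (use u e in \<open>auto simp: L2_iff_sqint\<close>)
  then obtain f h where fh: "(f, h) \<in> T0" and n: "nsq half_line (\<lambda>x. u x - f x) < e\<^sup>2" by blast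
  have "L2_norm (\<lambda>x. u x - f x) < e"
    unfolding L2_norm_nsq(2) using n e by (metis real_sqrt_less_mono real_sqrt_abs abs_of_pos)
  then show ?thesis using fh by blast
qed

end

section \<open>The limit point case\<close>

lemma integral_half_line_at_top:
  fixes w :: "real \<Rightarrow> 'a::{banach, second_countable_topology}"
  assumes w: "w \<in> borel_measurable borel" "integrable half_line w"
  shows "(prim lborel w \<longlongrightarrow> integral\<^sup>L half_line w) at_top"
  unfolding integral_half_line(2)[OF w(1)] prim_def[abs_def] set_lebesgue_integral_def
proof (rule integral_dominated_convergence_at_top)
  show "integrable lborel (\<lambda>t. indicator {0<..} t *\<^sub>R norm (w t))"
    using w integral_half_line(1)[OF w(1)] integrable_norm[of lborel "\<lambda>t. indicator {0<..} t *\<^sub>R w t"]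
    unfolding set_integrable_def by simp
  show "eventually (\<lambda>x. AE t in lborel. norm (indicator {0<..<x} t *\<^sub>R w t) \<le> indicator {0<..} t *\<^sub>R norm (w t)) at_top"
    by (intro always_eventually allI AE_I2) (auto simp: indicator_def)
  show "AE t in lborel. ((\<lambda>x. indicator {0<..<x} t *\<^sub>R w t) \<longlongrightarrow> indicator {0<..} t *\<^sub>R w t) at_top"
  proof (rule AE_I2)
    fix t
    show "((\<lambda>x. indicator {0<..<x} t *\<^sub>R w t) \<longlongrightarrow> indicator {0<..} t *\<^sub>R w t) at_top"
      by (rule tendsto_eventually, rule eventually_mono[OF eventually_gt_at_top[of t]]) (auto simp: indicator_def)
  qed
qed (use w in auto)

lemma prim_le_nsq:
  assumes w: "w \<in> borel_measurable borel" "w \<in> L2"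
  shows "prim lborel (\<lambda>t. (norm (w t))\<^sup>2) x \<le> nsq half_line w"
    and "(prim lborel (\<lambda>t. (norm (w t))\<^sup>2) \<longlongrightarrow> nsq half_line w) at_top"
proof -
  have [measurable]: "w \<in> borel_measurable borel" by (rule w)
  show lim: "(prim lborel (\<lambda>t. (norm (w t))\<^sup>2) \<longlongrightarrow> nsq half_line w) at_top"
    unfolding nsq_def by (rule integral_half_line_at_top) (use w in \<open>auto simp: L2_def\<close>)
  have "eventually (\<lambda>y. prim lborel (\<lambda>t. (norm (w t))\<^sup>2) x \<le> prim lborel (\<lambda>t. (norm (w t))\<^sup>2) y) at_top"
    by (rule eventually_mono[OF eventually_ge_at_top[of x]])
       (intro prim_mono_bound L2_loc(1)[OF w], auto)
  then show "prim lborel (\<lambda>t. (norm (w t))\<^sup>2) x \<le> nsq half_line w"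
    by (intro tendsto_lowerbound[OF lim]) auto
qed

lemma L2_if_bounded:
  assumes w: "w \<in> borel_measurable borel" "loc lborel (\<lambda>t. (norm (w t))\<^sup>2)"
    and B: "\<And>x. prim lborel (\<lambda>t. (norm (w t))\<^sup>2) x \<le> B"
  shows "w \<in> L2"
proof -
  have [measurable]: "w \<in> borel_measurable borel" by (rule w)
  let ?I = "\<lambda>n. prim lborel (\<lambda>t. (norm (w t))\<^sup>2) (real n)"
  have inc: "incseq ?I" unfolding incseq_def by (intro allI impI prim_mono_bound w) auto
  obtain l where l: "?I \<longlonglongrightarrow> l" using incseq_convergent[OF inc, of B] B by blast
  have U: "(\<Union>n. {0<..<real n}) = {0<..}" by (auto intro: reals_Archimedean2)
  have "set_integrable lborel (\<Union>n. {0<..<real n}) (\<lambda>t. (norm (w t))\<^sup>2)"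
    by (rule pos_integrable_to_top[where l = l]) (use l locD[OF w(2)] in \<open>auto simp: mono_def prim_def\<close>)
  then have "integrable half_line (\<lambda>t. (norm (w t))\<^sup>2)" unfolding U by (subst integral_half_line) auto
  then show ?thesis unfolding L2_def using measurable_half_line[OF w(1)] by simp
qed

context sl_system
begin

lemma locally_bounded_loc_sq: "locally_bounded f \<Longrightarrow> loc lborel (\<lambda>t. (norm (f t))\<^sup>2)"
proof -
  assume f: "locally_bounded f"
  have "loc lborel (\<lambda>t. norm (f t * f t))"
    by (intro loc_norm locally_bounded_loc locally_bounded_mult f)
  then show ?thesis by (simp add: norm_mult power2_eq_square)
qed

text \<open>Absorbing \<mu> into the potential makes the equation homogeneous; as all coefficients
  are real, the real part of a solution is a solution.\<close>

lemma eigenfunction_exists: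
  fixes \<mu> :: real
  shows "\<exists>s \<sigma>. sol (\<lambda>t. of_real \<mu> * s t) s \<sigma> 0 1 \<and> (\<forall>t. cnj (s t) = s t)"
proof -
  interpret S: sl_system M1 M2 "\<lambda>t. q t - \<mu>"
    using M1 M2 q_meas q_loc loc_diff[OF q_loc loc_const[OF loc_finite_lborel]] by unfold_locales auto
  obtain s \<sigma> where s: "S.sol (\<lambda>_. 0) s \<sigma> 0 1"
    using S.sol_exists[of "\<lambda>_. 0" 0 1] loc_const[OF loc_finite_lborel, of 0] by auto
  have lb: "locally_bounded s" by (rule S.sol_locally_bounded(1)[OF s])
  have [measurable]: "s \<in> borel_measurable borel" using lb unfolding locally_bounded_def by simp
  have sol: "sol (\<lambda>t. of_real \<mu> * s t) s \<sigma> 0 1"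
    unfolding sol_def
  proof (intro conjI allI)
    show "loc lborel (\<lambda>t. of_real \<mu> * s t)" by (intro loc_mult locally_bounded_loc lb)
    show "loc lborel (\<lambda>t. of_real (q t) * s t)"
      by (intro loc_times_locally_bounded q_loc_complex lb) simp
    show "s x = 0 + IP \<sigma> x" for x by (rule S.solD(5)[OF s])
    have "(\<lambda>t. of_real (q t - \<mu>) * s t - 0) = (\<lambda>t. of_real (q t) * s t - of_real \<mu> * s t)"
      by (simp add: algebra_simps)
    then show "\<sigma> x = 1 + prim lborel (\<lambda>t. of_real (q t) * s t - of_real \<mu> * s t) x" for x
      using S.solD(6)[OF s, of x] by simp
  qed measurable
  \<comment> \<open>\<open>s + (cnj s - s) / 2\<close> is the real part of \<open>s\<close>, and the
    initial slope stays 1.\<close>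
  note d = sol_lincomb[OF sol_cnj[OF sol] sol, of "-1"]
  note e = sol_lincomb[OF sol d, of "1/2"]
  define r where "r t = s t + 1/2 * (cnj (s t) + (-1) * s t)" for t
  have "(\<lambda>t. of_real \<mu> * s t + 1/2 * (cnj (of_real \<mu> * s t) + (-1) * (of_real \<mu> * s t))) = (\<lambda>t. of_real \<mu> * r t)"
    unfolding r_def by (simp add: algebra_simps)
  then have "sol (\<lambda>t. of_real \<mu> * r t) r (\<lambda>t. \<sigma> t + 1/2 * (cnj (\<sigma> t) + (-1) * \<sigma> t)) 0 1"
    using e unfolding r_def[symmetric] by simp
  moreover have "cnj (r t) = r t" for t unfolding r_def by (simp add: complex_eq_iff)
  ultimately show ?thesis by blast
qed

text \<open>Weyl's alternative: \<open>s W(f, g) = f W(s, g) - g W(s, f)\<close> and Cauchy-Schwarz bound \<open>\<bar>s\<bar>\<^sup>2\<close>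
  by an integrable
  multiple of \<open>\<integral>\<bar>s\<bar>\<^sup>2\<close> wherever the Wronskian of \<open>f\<close> and \<open>g\<close> stays away from zero.\<close>

lemma limit_circle_eigenfunction:
  assumes s: "sol (\<lambda>t. of_real \<mu> * s t) s \<sigma> 0 1"
    and 1: "(f1, h1) \<in> D0" and 2: "(f2, h2) \<in> D0" and ne: "ip h1 f2 \<noteq> ip f1 h2"
  shows "s \<in> L2"
proof -
  obtain g1 b1 where s1: "sol h1 f1 g1 0 b1" and L1: "f1 \<in> L2" "h1 \<in> L2" using 1 unfolding D0_def
    by blast
  obtain g2 b2 where s2': "sol h2 f2 g2 0 b2" and L2': "f2 \<in> L2" "h2 \<in> L2" using 2 unfolding D0_def
    by blast
  \<comment> \<open>Conjugating the second function turns the sesquilinear pairing into the bilinear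
    Wronskian \<open>W\<close>.\<close>
  define F where "F t = cnj (f2 t)" for t
  define G where "G t = cnj (g2 t)" for t
  define H where "H t = cnj (h2 t)" for t
  have s2: "sol H F G 0 (cnj b2)" using sol_cnj[OF s2']
    unfolding F_def[symmetric] G_def[symmetric] H_def[symmetric] by simp
  have L2: "F \<in> L2" "H \<in> L2" unfolding F_def H_def using L2' sqint_cnj unfolding L2_iff_sqint by blast+
  note m1 = solD(1,3)[OF s1] and m2 = solD(1,3)[OF s2]
  have [measurable]: "s \<in> borel_measurable borel" "f1 \<in> borel_measurable borel"
    "F \<in> borel_measurable borel"
     "h1 \<in> borel_measurable borel" "H \<in> borel_measurable borel"
    using solD(3)[OF s] m1 m2 by auto
  define w0 where "w0 = ip h1 f2 - ip f1 h2"
  have w00: "w0 \<noteq> 0" unfolding w0_def using ne by simp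
  define W where "W x = f1 x * G x - F x * g1 x" for x
  have Wlim: "(W \<longlongrightarrow> w0) at_top"
  proof -
    have i: "integrable half_line (\<lambda>t. h1 t * F t)" "integrable half_line (\<lambda>t. f1 t * H t)"
      using L1 L2 sqint_mult_integrable unfolding L2_iff_sqint by blast+
    have l: "loc lborel (\<lambda>t. h1 t * F t)" "loc lborel (\<lambda>t. f1 t * H t)"
      using integral_half_line_lim(1)[OF _ i(1)] integral_half_line_lim(1)[OF _ i(2)] by auto
    have "W = (\<lambda>x. prim lborel (\<lambda>t. h1 t * F t) x - prim lborel (\<lambda>t. f1 t * H t) x)"
      unfolding W_def[abs_def] using sol_green(2)[OF s1 s2] prim_diff[OF l]
      by (simp add: mult.commute[of "F _"])
    moreover have "ip h1 f2 = integral\<^sup>L half_line (\<lambda>t. h1 t * F t)"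
      "ip f1 h2 = integral\<^sup>L half_line (\<lambda>t. f1 t * H t)"
      unfolding ip_def F_def H_def by simp_all
    ultimately show ?thesis unfolding w0_def using i
      by (auto intro!: tendsto_diff integral_half_line_at_top)
  qed
  define c0 where "c0 = norm w0 / 2"
  have c0: "0 < c0" unfolding c0_def using w00 by simp
  have "eventually (\<lambda>x. c0 < norm (W x)) at_top"
    using order_tendstoD(1)[OF tendsto_norm[OF Wlim], of c0] w00 unfolding c0_def by simp
  then obtain X0 where X0: "\<And>x. X0 \<le> x \<Longrightarrow> c0 < norm (W x)" unfolding eventually_at_top_linorder by blast
  define N where "N = prim lborel (\<lambda>t. (norm (s t))\<^sup>2)"
  have lbs: "locally_bounded s" by (rule sol_locally_bounded(1)[OF s])
  have ls: "loc lborel (\<lambda>t. (norm (s t))\<^sup>2)" by (rule locally_bounded_loc_sq[OF lbs])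
  have N_mono: "N x \<le> N y" if "x \<le> y" for x y unfolding N_def using ls that
    by (intro prim_mono_bound) auto
  have N0: "0 \<le> N x" for x unfolding N_def by (rule prim_nonneg) simp
  \<comment> \<open>\<open>s\<close> and \<open>f\<close> both vanish at 0, so their Wronskian at
    \<open>x\<close> is the integral of s (\<mu> f - h), which Cauchy-Schwarz bounds by the norm of
    \<open>s\<close> on (0, x).\<close>
  have wr: "(norm (s x * g x - f x * \<sigma> x))\<^sup>2 \<le> N x * nsq half_line (\<lambda>t. of_real \<mu> * f t - h t)"
    if sf: "sol h f g 0 b" and fL: "f \<in> L2" "h \<in> L2" for h f g b x
  proof -
    have [measurable]: "f \<in> borel_measurable borel" "h \<in> borel_measurable borel" using solD(1,3)[OF sf]
      by auto
    let ?w = "\<lambda>t. of_real \<mu> * f t - h t"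
    have wL: "?w \<in> L2" using fL sqint_diff sqint_mult unfolding L2_iff_sqint by blast
    have wm: "?w \<in> borel_measurable borel" by measurable
    have "(\<lambda>t. f t * (of_real \<mu> * s t) - s t * h t) = (\<lambda>t. s t * ?w t)" by (simp add: algebra_simps)
    then have "s x * g x - f x * \<sigma> x = prim lborel (\<lambda>t. s t * ?w t) x"
      using sol_green(2)[OF s sf, of x] by simp
    then have "(norm (s x * g x - f x * \<sigma> x))\<^sup>2 \<le> N x * prim lborel (\<lambda>t. (norm (?w t))\<^sup>2) x"
      unfolding N_def using prim_cauchy_schwarz[OF _ ls wm L2_loc(1)[OF wm wL], of x] by simp
    also have "\<dots> \<le> N x * nsq half_line ?w" by (intro mult_left_mono prim_le_nsq(1) wm wL N0)
    finally show ?thesis .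
  qed
  define C1 where "C1 = nsq half_line (\<lambda>t. of_real \<mu> * f1 t - h1 t)"
  define C2 where "C2 = nsq half_line (\<lambda>t. of_real \<mu> * F t - H t)"
  have C0: "0 \<le> C1" "0 \<le> C2" unfolding C1_def C2_def by (simp_all add: nsq_nonneg)
  define p where "p t = 2 * C2 / c0\<^sup>2 * (norm (f1 t))\<^sup>2 + 2 * C1 / c0\<^sup>2 * (norm (F t))\<^sup>2" for t
  have sp: "(norm (s x))\<^sup>2 \<le> p x * N x" if x: "X0 \<le> x" for x
  proof -
    let ?A1 = "s x * g1 x - f1 x * \<sigma> x" and ?A2 = "s x * G x - F x * \<sigma> x"
    have "s x * W x = f1 x * ?A2 + (- F x) * ?A1" unfolding W_def by (simp add: algebra_simps)
    then have "norm (s x) * norm (W x) \<le> norm (f1 x) * norm ?A2 + norm (F x) * norm ?A1"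
      by (metis norm_mult norm_triangle_ineq norm_minus_cancel)
    moreover have "norm (s x) * c0 \<le> norm (s x) * norm (W x)" using X0[OF x]
      by (intro mult_left_mono) auto
    ultimately have "(norm (s x) * c0)\<^sup>2 \<le> (norm (f1 x) * norm ?A2 + norm (F x) * norm ?A1)\<^sup>2"
      using c0 by (intro power_mono) auto
    also have "\<dots> \<le> 2 * ((norm (f1 x))\<^sup>2 * (norm ?A2)\<^sup>2) + 2 * ((norm (F x))\<^sup>2 * (norm ?A1)\<^sup>2)"
      using sum_squares_ge_zero[of "norm (f1 x) * norm ?A2 - norm (F x) * norm ?A1" 0]
      by (simp add: power2_eq_square algebra_simps)
    also have "\<dots> \<le> 2 * ((norm (f1 x))\<^sup>2 * (N x * C2)) + 2 * ((norm (F x))\<^sup>2 * (N x * C1))"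
      unfolding C1_def C2_def by (intro add_mono mult_left_mono wr[OF s1 L1] wr[OF s2 L2]) auto
    also have "\<dots> = (p x * c0\<^sup>2) * N x"
    proof -
      have "p x * c0\<^sup>2 = 2 * C2 * (norm (f1 x))\<^sup>2 + 2 * C1 * (norm (F x))\<^sup>2"
        unfolding p_def using c0 by (simp add: distrib_right)
      then show ?thesis by (simp add: algebra_simps)
    qed
    finally have "(norm (s x))\<^sup>2 * c0\<^sup>2 \<le> (p x * N x) * c0\<^sup>2"
      by (simp add: power_mult_distrib algebra_simps)
    then show ?thesis using c0 by simp
  qed
  have p0: "0 \<le> p t" for t unfolding p_def using C0 by simp
  have pint: "integrable half_line p" and pm: "p \<in> borel_measurable borel"
    unfolding p_def[abs_def] using L1(1) L2(1) unfolding L2_def by auto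
  have plim: "(prim lborel p \<longlongrightarrow> integral\<^sup>L half_line p) at_top"
    by (rule integral_half_line_at_top[OF pm pint])
  have pl: "loc lborel p" by (rule integral_half_line_lim(1)[OF pm pint])
  have "eventually (\<lambda>x. integral\<^sup>L half_line p - 1/2 < prim lborel p x) at_top"
    using order_tendstoD(1)[OF plim, of "integral\<^sup>L half_line p - 1/2"] by simp
  then have "eventually (\<lambda>x. X0 \<le> x \<and> 0 < x \<and> integral\<^sup>L half_line p - 1/2 < prim lborel p x) at_top"
    using eventually_ge_at_top[of X0] eventually_gt_at_top[of 0] by eventually_elim auto
  \<comment> \<open>Beyond \<open>X\<close> the integral of \<open>p\<close> is at most 1/2, so the
    term with \<open>N y\<close> in \<open>Nb\<close> can be absorbed on the left.\<close>
  then obtain X where X: "X0 \<le> X" "0 < X" "integral\<^sup>L half_line p - 1/2 < prim lborel p X"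
    using eventually_happens'[of "at_top :: real filter"] by auto
  have small: "prim lborel p y - prim lborel p X \<le> 1/2" for y
  proof -
    have "prim lborel p y \<le> integral\<^sup>L half_line p"
    proof (rule tendsto_lowerbound[OF plim])
      show "eventually (\<lambda>x. prim lborel p y \<le> prim lborel p x) at_top"
        by (rule eventually_mono[OF eventually_ge_at_top[of y]]) (intro prim_mono_bound pl p0, auto)
    qed simp
    then show ?thesis using X(3) by simp
  qed
  have Nb: "N y \<le> 2 * N X" if y: "X \<le> y" for y
  proof -
    have "N y - N X = (LINT t:{X..<y}|lborel. (norm (s t))\<^sup>2)"
      unfolding N_def by (rule prim_incr[OF ls _ X(2) y]) simp
    also have "\<dots> \<le> (LINT t:{X..<y}|lborel. p t * N y)"
    proof (rule set_integral_mono)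
      show "set_integrable lborel {X..<y} (\<lambda>t. (norm (s t))\<^sup>2)"
        by (rule set_integrable_subset[OF locD[OF ls, of y]]) (use X in auto)
      have "set_integrable lborel {X..<y} p"
        by (rule set_integrable_subset[OF locD[OF pl, of y]]) (use X in auto)
      then show "set_integrable lborel {X..<y} (\<lambda>t. p t * N y)" by simp
      fix t assume t: "t \<in> {X..<y}"
      then have "(norm (s t))\<^sup>2 \<le> p t * N t" using X by (intro sp) auto
      also have "\<dots> \<le> p t * N y" using t by (intro mult_left_mono N_mono p0) auto
      finally show "(norm (s t))\<^sup>2 \<le> p t * N y" .
    qed
    also have "\<dots> = (prim lborel p y - prim lborel p X) * N y"
      using prim_incr[OF pl _ X(2) y] by simp
    also have "\<dots> \<le> 1/2 * N y" by (intro mult_right_mono small N0)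
    finally show ?thesis by simp
  qed
  show ?thesis
  proof (rule L2_if_bounded)
    show "prim lborel (\<lambda>t. (norm (s t))\<^sup>2) x \<le> 2 * N X" for x
      using Nb[of "max x X"] N_mono[of x "max x X"] unfolding N_def by simp
  qed (use ls in auto)
qed

text \<open>The cutoff function is \<open>\<phi> = 1 - prim lborel \<psi>\<close>, so that \<open>\<phi>' = - \<psi>\<close> and \<open>\<phi>'' = - \<eta>\<close>. The last
  condition says that \<open>dP\<close> and Lebesgue measure agree where \<open>\<phi>' \<noteq> 0\<close>.\<close>

definition cutoff :: "real \<Rightarrow> real \<Rightarrow> (real \<Rightarrow> real) \<Rightarrow> (real \<Rightarrow> real) \<Rightarrow> real \<Rightarrow> bool" where
  "cutoff K X \<psi> \<eta> c \<longleftrightarrow> 0 < c \<and> X \<le> c \<and> \<eta> \<in> borel_measurable borel \<and> (\<exists>B. \<forall>t. \<bar>\<eta> t\<bar> \<le> B) \<and> (\<forall>t\<ge>c. \<eta> t = 0)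
     \<and> (\<forall>x. \<psi> x = prim lborel \<eta> x) \<and> (\<forall>t. 0 \<le> \<psi> t \<and> \<psi> t \<le> K) \<and> (\<forall>t\<le>X. \<psi> t = 0) \<and> (\<forall>t\<ge>c. \<psi> t = 0)
     \<and> prim lborel \<psi> c = 1
     \<and> (\<forall>u x. locally_bounded u \<longrightarrow> IP (\<lambda>t. of_real (\<psi> t) * u t) x = prim lborel (\<lambda>t. of_real (\<psi> t) * u t) x)"

text \<open>Where \<phi>' is not 0, dP is dx and \<sigma> is the derivative of \<open>s\<close>;
  hence \<tau>(\<phi> s) = \<mu> \<phi> s + 2 \<psi> \<sigma> + \<eta> s. The last two terms
  contribute exactly the integral of \<psi>^2 s^2 to the inner product with \<phi> s, because the
  derivative of \<phi> \<psi> s^2 integrates to zero.\<close>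

lemma wienholtz_inequality:
  assumes cut: "cutoff K X \<psi> \<eta> c"
    and s: "sol (\<lambda>t. of_real \<mu> * s t) s \<sigma> 0 1" and real: "\<And>t. cnj (s t) = s t"
    and bound: "\<And>f h. (f, h) \<in> T0 \<Longrightarrow> (\<mu> + 1) * (L2_norm f)\<^sup>2 \<le> Re (ip h f)"
  shows "prim lborel (\<lambda>t. (norm (s t))\<^sup>2) X \<le> prim lborel (\<lambda>t. (\<psi> t)\<^sup>2 * (norm (s t))\<^sup>2) c"
proof -
  have c: "0 < c" "X \<le> c" and [measurable]: "\<eta> \<in> borel_measurable borel" and \<eta>c: "\<And>t. c \<le> t \<Longrightarrow> \<eta> t = 0"
    and \<psi>: "\<And>x. \<psi> x = prim lborel \<eta> x" "\<And>t. 0 \<le> \<psi> t" "\<And>t. \<psi> t \<le> K" "\<And>t. t \<le> X \<Longrightarrow> \<psi> t = 0"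
      "\<And>t. c \<le> t \<Longrightarrow> \<psi> t = 0"
      "prim lborel \<psi> c = 1"
    and gap: "\<And>u x. locally_bounded u \<Longrightarrow> IP (\<lambda>t. of_real (\<psi> t) * u t) x = prim lborel (\<lambda>t. of_real (\<psi> t) * u t) x"
    using cut unfolding cutoff_def by auto
  obtain B where B: "\<And>t. \<bar>\<eta> t\<bar> \<le> B" using cut unfolding cutoff_def by blast
  define \<Psi> where "\<Psi> t = complex_of_real (\<psi> t)" for t
  define \<Xi> where "\<Xi> t = complex_of_real (\<eta> t)" for t
  define \<Phi> where "\<Phi> t = 1 + prim lborel (\<lambda>t. - \<Psi> t) t" for t
  have lbX: "locally_bounded \<Xi>" unfolding locally_bounded_def \<Xi>_def using B by auto
  have \<Psi>eq: "\<Psi> x = 0 + prim lborel \<Xi> x" for x unfolding \<Psi>_def \<Xi>_def \<psi>(1) prim_of_real by simp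
  have lb\<Psi>: "locally_bounded \<Psi>"
  proof -
    have "locally_bounded (prim lborel \<Xi>)"
      by (rule locally_bounded_prim[OF loc_finite_lborel locally_bounded_loc[OF lbX]]) (use lbX in \<open>simp add: locally_bounded_def\<close>)
    moreover have "\<Psi> = prim lborel \<Xi>" using \<Psi>eq by auto
    ultimately show ?thesis by simp
  qed
  have lbm\<Psi>: "locally_bounded (\<lambda>t. - \<Psi> t)"
    using locally_bounded_mult[OF locally_bounded_const[of "-1"] lb\<Psi>] by simp
  have lb\<Phi>: "locally_bounded \<Phi>"
    unfolding \<Phi>_def using lbm\<Psi>
    by (intro locally_bounded_add locally_bounded_const locally_bounded_prim loc_finite_lborel locally_bounded_loc) (auto simp: locally_bounded_def)
  note lbs = sol_locally_bounded[OF s]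
  note eqs = solD(5)[OF s] solD(6)[OF s]
  let ?k = "\<lambda>t. of_real (q t) * s t - of_real \<mu> * s t"
  have lk: "loc lborel ?k" by (rule sol_q(1)[OF s])
  have l\<Psi>: "loc lborel (\<lambda>t. - \<Psi> t)" and lX: "loc lborel \<Xi>" by (intro locally_bounded_loc lbm\<Psi> lbX)+
  have lb: "locally_bounded (\<lambda>t. u t * v t)" if "locally_bounded u" "locally_bounded v" for u v
    by (rule locally_bounded_mult[OF that])
  have sub: "locally_bounded (\<lambda>t. u t - v t)" if "locally_bounded u" "locally_bounded v" for u v
    using locally_bounded_add[OF that(1) locally_bounded_mult[OF locally_bounded_const[of "-1"] that(2)]]
    by simp
  define f where "f t = \<Phi> t * s t" for t
  \<comment> \<open>This is \<phi> \<sigma> + \<phi>' s, the quasi-derivative of \<phi> s.\<close>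
  define g where "g t = \<Phi> t * \<sigma> t - \<Psi> t * s t" for t
  define h where "h t = of_real \<mu> * (\<Phi> t * s t) + (2 * (\<Psi> t * \<sigma> t) + \<Xi> t * s t)" for t
  define k2 where "k2 t = \<Psi> t * \<sigma> t + \<Xi> t * s t" for t
  have lbk2: "locally_bounded k2" unfolding k2_def by (intro locally_bounded_add lb lb\<Psi> lbX lbs)
  have lbf: "locally_bounded f" unfolding f_def by (intro lb lb\<Phi> lbs)
  have lbh: "locally_bounded h" unfolding h_def
    by (intro locally_bounded_add lb lb\<Phi> lb\<Psi> lbX lbs locally_bounded_const)
  have gap': "IP (\<lambda>t. \<Psi> t * u t) x = prim lborel (\<lambda>t. \<Psi> t * u t) x" if "locally_bounded u" for u x
    unfolding \<Psi>_def by (rule gap[OF that])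
  have f_eq: "f x = 0 + IP g x" for x
  proof -
    have "s x * \<Phi> x = 0 * 1 + IP (\<lambda>t. \<sigma> t * \<Phi> t) x + prim lborel (\<lambda>t. s t * - \<Psi> t) x"
      by (rule IP_product(3)[OF eqs(1) locally_bounded_locP[OF lbs(2)] \<Phi>_def l\<Psi>])
    also have "prim lborel (\<lambda>t. s t * - \<Psi> t) x = - prim lborel (\<lambda>t. \<Psi> t * s t) x"
      using prim_mult[of lborel "-1" "\<lambda>t. \<Psi> t * s t" x] by (simp add: mult.commute)
    \<comment> \<open>Reading the Lebesgue integral of \<psi> s as an integral against dP lets this
      term enter the quasi-derivative.\<close>
    also have "prim lborel (\<lambda>t. \<Psi> t * s t) x = IP (\<lambda>t. \<Psi> t * s t) x" using gap'[OF lbs(1)] by simp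
    finally have "f x = IP (\<lambda>t. \<Phi> t * \<sigma> t) x - IP (\<lambda>t. \<Psi> t * s t) x"
      unfolding f_def by (simp add: mult.commute)
    also have "\<dots> = IP g x"
      unfolding g_def by (rule IP_diff[symmetric]) (intro locally_bounded_locP lb lb\<Phi> lb\<Psi> lbs)+
    finally show ?thesis by simp
  qed
  \<comment> \<open>Although \<open>s\<close> need not be absolutely continuous, \<psi> s is:
    \<open>gap'\<close> turns the dP-part of its increment into a Lebesgue integral.\<close>
  have \<Psi>s: "\<Psi> x * s x = 0 + prim lborel k2 x" for x
  proof -
    have "s x * \<Psi> x = 0 * 0 + IP (\<lambda>t. \<sigma> t * \<Psi> t) x + prim lborel (\<lambda>t. s t * \<Xi> t) x"
      by (rule IP_product(3)[OF eqs(1) locally_bounded_locP[OF lbs(2)] \<Psi>eq lX])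
    also have "IP (\<lambda>t. \<sigma> t * \<Psi> t) x = prim lborel (\<lambda>t. \<Psi> t * \<sigma> t) x"
      using gap'[OF lbs(2), of x] by (simp add: mult.commute)
    also have "0 * 0 + prim lborel (\<lambda>t. \<Psi> t * \<sigma> t) x + prim lborel (\<lambda>t. s t * \<Xi> t) x = prim lborel k2 x"
      unfolding k2_def
      by (subst prim_add) (auto intro!: locally_bounded_loc lb lb\<Psi> lbX lbs simp: mult.commute)
    finally show ?thesis by (simp add: mult.commute)
  qed
  have \<Phi>\<sigma>: "\<Phi> x * \<sigma> x = 1 + prim lborel (\<lambda>t. - \<Psi> t * \<sigma> t + \<Phi> t * ?k t) x" for x
    using leb_product(3)[OF \<Phi>_def l\<Psi> eqs(2) lk] by simp
  have lk2: "loc lborel k2" by (rule locally_bounded_loc[OF lbk2])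
  have l3: "loc lborel (\<lambda>t. - \<Psi> t * \<sigma> t + \<Phi> t * ?k t)"
    using leb_product(1,2)[OF \<Phi>_def l\<Psi> eqs(2) lk] by (rule loc_add)
  have g_eq: "g x = 1 + prim lborel (\<lambda>t. of_real (q t) * f t - h t) x" for x
  proof -
    have "(\<lambda>t. of_real (q t) * f t - h t) = (\<lambda>t. (- \<Psi> t * \<sigma> t + \<Phi> t * ?k t) - k2 t)"
      unfolding f_def h_def k2_def by (simp add: algebra_simps)
    then show ?thesis unfolding g_def \<Phi>\<sigma>[of x] \<Psi>s[of x] using prim_diff[OF l3 lk2, of x] by simp
  qed
  have sf: "sol h f g 0 1"
    unfolding sol_def
  proof (intro conjI allI f_eq g_eq)
    show "loc lborel h" by (rule locally_bounded_loc[OF lbh])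
    show "loc lborel (\<lambda>t. of_real (q t) * f t)"
      by (intro loc_times_locally_bounded q_loc_complex lbf) simp
  qed (use lbf lbh in \<open>auto simp: locally_bounded_def\<close>)
  have \<Phi>z: "\<Phi> t = 0" if "c \<le> t" for t
  proof -
    have "prim lborel (\<lambda>t. - \<Psi> t) t = prim lborel (\<lambda>t. - \<Psi> t) c"
      by (rule prim_vanishing) (use \<psi>(5) that in \<open>auto simp: \<Psi>_def\<close>)
    also have "\<dots> = - prim lborel \<Psi> c" using prim_mult[of lborel "-1" \<Psi> c] by simp
    also have "prim lborel \<Psi> c = 1" unfolding \<Psi>_def prim_of_real \<psi>(6) by simp
    finally show ?thesis unfolding \<Phi>_def by simp
  qed
  have \<Psi>z: "\<Psi> t = 0" "\<Xi> t = 0" if "c \<le> t" for t using \<psi>(5) \<eta>c that unfolding \<Psi>_def \<Xi>_def by auto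
  have hz: "h t = 0" and fz: "f t = 0" and gz: "g t = 0" if "c \<le> t" for t
    using \<Phi>z[OF that] \<Psi>z[OF that] unfolding h_def f_def g_def by auto
  have hL: "h \<in> L2" by (rule locally_bounded_compact_L2[OF lbh, of c]) (simp add: hz)
  have fL: "f \<in> L2" by (rule locally_bounded_compact_L2[OF lbf, of c]) (simp add: fz)
  have T: "(f, h) \<in> T0" 
  proof -
    have "\<forall>t>c. f t = 0 \<and> g t = 0" "\<forall>t\<ge>c. h t = 0" using hz fz gz by auto
    then show ?thesis unfolding T0_def using c(1) sf hL by blast
  qed
  have fm: "f \<in> borel_measurable borel" "h \<in> borel_measurable borel" using lbf lbh
    unfolding locally_bounded_def by auto
  have real\<Phi>: "cnj (\<Phi> t) = \<Phi> t" for t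
  proof -
    have "prim lborel (\<lambda>t. - \<Psi> t) t = of_real (prim lborel (\<lambda>t. - \<psi> t) t)"
      unfolding \<Psi>_def of_real_minus[symmetric] by (rule prim_of_real)
    then show ?thesis unfolding \<Phi>_def by simp
  qed
  have realf: "cnj (f t) = f t" for t unfolding f_def using real\<Phi> real by simp
  have "ip h f = prim lborel (\<lambda>t. h t * cnj (f t)) c"
    by (rule LIMSEQ_unique[OF ip_lim(2)[OF fm(2) hL fm(1) fL] prim_vanishing_lim]) (simp add: hz)
  then have ip_eq: "ip h f = prim lborel (\<lambda>t. h t * f t) c" unfolding realf .
  have n_eq: "nsq half_line f = prim lborel (\<lambda>t. (norm (f t))\<^sup>2) c"
  proof -
    have "(\<lambda>n. prim lborel (\<lambda>t. (norm (f t))\<^sup>2) (real n)) \<longlonglongrightarrow> nsq half_line f"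
      using filterlim_compose[OF prim_le_nsq(2)[OF fm(1) fL] filterlim_real_sequentially] .
    then show ?thesis by (rule LIMSEQ_unique[OF _ prim_vanishing_lim]) (simp add: fz)
  qed
  define k3 where "k3 t = - \<Psi> t * (\<Psi> t * s t) + \<Phi> t * k2 t" for t
  have lk3: "loc lborel k3" unfolding k3_def
    using leb_product(1,2)[OF \<Phi>_def l\<Psi> \<Psi>s lk2] by (rule loc_add)
  have \<Phi>\<Psi>s: "\<Phi> x * (\<Psi> x * s x) = 0 + prim lborel k3 x" for x
    using leb_product(3)[OF \<Phi>_def l\<Psi> \<Psi>s lk2, of x] unfolding k3_def by simp
  \<comment> \<open>The product of \<open>s\<close> with \<phi> \<psi> s vanishes at 0 and at
    \<open>c\<close>, so the two terms of its derivative integrate to zero together.\<close>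
  note p5 = IP_product[OF eqs(1) locally_bounded_locP[OF lbs(2)] \<Phi>\<Psi>s lk3]
  have "s c * (\<Phi> c * (\<Psi> c * s c)) = 0" using \<Phi>z[of c] by simp
  then have "IP (\<lambda>t. \<sigma> t * (\<Phi> t * (\<Psi> t * s t))) c + prim lborel (\<lambda>t. s t * k3 t) c = 0"
    using p5(3)[of c] by simp
  moreover have "IP (\<lambda>t. \<sigma> t * (\<Phi> t * (\<Psi> t * s t))) c = prim lborel (\<lambda>t. \<Psi> t * (\<sigma> t * \<Phi> t * s t)) c"
  proof -
    have "(\<lambda>t. \<sigma> t * (\<Phi> t * (\<Psi> t * s t))) = (\<lambda>t. \<Psi> t * (\<sigma> t * \<Phi> t * s t))" by (simp add: algebra_simps)
    then show ?thesis using gap'[of "\<lambda>t. \<sigma> t * \<Phi> t * s t" c] lbs lb\<Phi> by (simp add: lb)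
  qed
  moreover have l6: "loc lborel (\<lambda>t. \<Psi> t * (\<sigma> t * \<Phi> t * s t))"
    by (intro locally_bounded_loc lb lb\<Psi> lb\<Phi> lbs)
  ultimately have zero: "prim lborel (\<lambda>t. \<Psi> t * (\<sigma> t * \<Phi> t * s t) + s t * k3 t) c = 0"
    using prim_add[OF l6 p5(2)] by simp
  have lff: "loc lborel (\<lambda>t. f t * f t)" and lpp: "loc lborel (\<lambda>t. (\<Psi> t * s t) * (\<Psi> t * s t))"
    by (intro locally_bounded_loc lb lb\<Psi> lbs lbf)+
  have "(\<lambda>t. h t * f t) = (\<lambda>t. (\<Psi> t * (\<sigma> t * \<Phi> t * s t) + s t * k3 t) + (of_real \<mu> * (f t * f t) + (\<Psi> t * s t) * (\<Psi> t * s t)))"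
    unfolding h_def f_def k3_def k2_def by (simp add: algebra_simps)
  then have "ip h f = of_real \<mu> * prim lborel (\<lambda>t. f t * f t) c + prim lborel (\<lambda>t. (\<Psi> t * s t) * (\<Psi> t * s t)) c"
    unfolding ip_eq using zero l6 p5(2) lff lpp by (simp add: prim_add loc_add loc_mult prim_mult)
  also have "(\<lambda>t. f t * f t) = (\<lambda>t. complex_of_real ((norm (f t))\<^sup>2))"
    using complex_norm_square[of "f _"] unfolding realf by (simp add: fun_eq_iff del: of_real_power)
  also have "(\<lambda>t. (\<Psi> t * s t) * (\<Psi> t * s t)) = (\<lambda>t. complex_of_real ((\<psi> t)\<^sup>2 * (norm (s t))\<^sup>2))"
  proof
    fix t
    have "complex_of_real ((norm (s t))\<^sup>2) = s t * s t" using complex_norm_square[of "s t"]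
      unfolding real .
    then show "(\<Psi> t * s t) * (\<Psi> t * s t) = complex_of_real ((\<psi> t)\<^sup>2 * (norm (s t))\<^sup>2)"
      unfolding \<Psi>_def of_real_mult by (simp add: power2_eq_square)
  qed
  finally have "Re (ip h f) = \<mu> * nsq half_line f + prim lborel (\<lambda>t. (\<psi> t)\<^sup>2 * (norm (s t))\<^sup>2) c"
    unfolding prim_of_real n_eq by simp
  \<comment> \<open>The bound \<mu> + 1 exceeds the eigenvalue by one, which leaves one copy of
    \<open>nsq half_line f\<close>.\<close>
  then have le: "nsq half_line f \<le> prim lborel (\<lambda>t. (\<psi> t)\<^sup>2 * (norm (s t))\<^sup>2) c"
    using bound[OF T] unfolding L2_norm_nsq(1) by (simp add: algebra_simps)
  have "prim lborel (\<lambda>t. (norm (s t))\<^sup>2) X = prim lborel (\<lambda>t. (norm (f t))\<^sup>2) X"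
  proof (rule prim_cong)
    fix t assume t: "0 < t" "t < X"
    have "prim lborel (\<lambda>t. - \<Psi> t) t = prim lborel (\<lambda>_. 0) t"
      by (rule prim_cong) (use t \<psi>(4) in \<open>auto simp: \<Psi>_def\<close>)
    then have "\<Phi> t = 1" unfolding \<Phi>_def by (simp add: prim_def)
    then show "(norm (s t))\<^sup>2 = (norm (f t))\<^sup>2" unfolding f_def by simp
  qed
  also have "\<dots> \<le> prim lborel (\<lambda>t. (norm (f t))\<^sup>2) c"
    by (rule prim_mono_bound[OF locally_bounded_loc_sq[OF lbf] _ _ c(2)]) auto
  finally show ?thesis using le n_eq by simp
qed

end

context sl_nondegenerate
begin

lemma eigenfunction_not_L2:
  assumes cut: "\<And>X. \<exists>\<psi> \<eta> c. cutoff K X \<psi> \<eta> c"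
    and s: "sol (\<lambda>t. of_real \<mu> * s t) s \<sigma> 0 1" and real: "\<And>t. cnj (s t) = s t"
    and bound: "\<And>f h. (f, h) \<in> T0 \<Longrightarrow> (\<mu> + 1) * (L2_norm f)\<^sup>2 \<le> Re (ip h f)"
  shows "s \<notin> L2"
proof
  assume sL: "s \<in> L2"
  have sm: "s \<in> borel_measurable borel" by (rule solD(3)[OF s])
  have [measurable]: "s \<in> borel_measurable borel" by (rule sm)
  let ?N = "prim lborel (\<lambda>t. (norm (s t))\<^sup>2)"
  have ls: "loc lborel (\<lambda>t. (norm (s t))\<^sup>2)" by (rule L2_loc(1)[OF sm sL])
  note lim = prim_le_nsq[OF sm sL]
  have ineq: "?N X \<le> K\<^sup>2 * (nsq half_line s - ?N X)" for X
  proof -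
    obtain \<psi> \<eta> c where c: "cutoff K X \<psi> \<eta> c" using cut by blast
    have \<psi>: "\<And>t. 0 \<le> \<psi> t" "\<And>t. \<psi> t \<le> K" "\<And>t. t \<le> X \<Longrightarrow> \<psi> t = 0" "X \<le> c" "\<And>x. \<psi> x = prim lborel \<eta> x" 
      and \<eta>m: "\<eta> \<in> borel_measurable borel"
      using c unfolding cutoff_def by auto
    have "\<psi> = prim lborel \<eta>" using \<psi>(5) by auto
    then have [measurable]: "\<psi> \<in> borel_measurable borel"
      using borel_measurable_prim[OF loc_finite_lborel \<eta>m] by simp
    \<comment> \<open>Primitives start at 0; subtracting the part below \<open>X\<close> expresses
      an integral over [X, c).\<close>
    let ?v = "\<lambda>t. if t < X then (norm (s t))\<^sup>2 else 0"
    have lv: "loc lborel ?v"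
      by (rule loc_bound[OF ls]) (auto intro!: exI[of _ 1])
    have K0: "0 \<le> K" using \<psi>(1,2)[of 0] by linarith
    have "?N X \<le> prim lborel (\<lambda>t. (\<psi> t)\<^sup>2 * (norm (s t))\<^sup>2) c"
      by (rule wienholtz_inequality[OF c s real bound])
    also have "\<dots> \<le> prim lborel (\<lambda>t. K\<^sup>2 * ((norm (s t))\<^sup>2 - ?v t)) c"
    proof (rule prim_real_mono)
      have b: "(\<psi> t)\<^sup>2 \<le> K\<^sup>2" for t using \<psi>(1,2)[of t] by (intro power_mono) auto
      show "loc lborel (\<lambda>t. K\<^sup>2 * ((norm (s t))\<^sup>2 - ?v t))" by (intro loc_mult loc_diff ls lv)
      show "loc lborel (\<lambda>t. (\<psi> t)\<^sup>2 * (norm (s t))\<^sup>2)"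
        by (rule loc_bound[OF ls]) (auto intro!: exI[of _ "K\<^sup>2"] mult_right_mono b)
      show "(\<psi> t)\<^sup>2 * (norm (s t))\<^sup>2 \<le> K\<^sup>2 * ((norm (s t))\<^sup>2 - ?v t)" for t
        using \<psi>(3)[of t] by (auto intro: mult_right_mono b)
    qed
    also have "\<dots> = K\<^sup>2 * (?N c - prim lborel ?v c)"
      unfolding prim_mult prim_diff[OF ls lv] ..
    also have "prim lborel ?v c = ?N X"
    proof -
      have "prim lborel ?v c = prim lborel ?v X" by (rule prim_vanishing) (use \<psi>(4) in auto)
      also have "\<dots> = ?N X" by (rule prim_cong) auto
      finally show ?thesis .
    qed
    also have "K\<^sup>2 * (?N c - ?N X) \<le> K\<^sup>2 * (nsq half_line s - ?N X)"
      by (intro mult_left_mono diff_right_mono lim) auto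
    finally show ?thesis .
  qed
  have "((\<lambda>X. K\<^sup>2 * (nsq half_line s - ?N X)) \<longlongrightarrow> K\<^sup>2 * (nsq half_line s - nsq half_line s)) at_top"
    by (intro tendsto_mult tendsto_diff tendsto_const lim)
  then have "nsq half_line s \<le> K\<^sup>2 * (nsq half_line s - nsq half_line s)"
    using tendsto_le[OF trivial_limit_at_top_linorder _ lim(2)] ineq by (simp add: always_eventually)
  then have "nsq half_line s = 0" using nsq_nonneg[of half_line s] by simp
  then have "AE x in half_line. s x = 0" using nsq_zero_AE sL unfolding L2_iff_sqint by blast
  then have "AE t in lborel. 0 < t \<longrightarrow> s t = 0" unfolding AE_half_line .
  from sol_trivial(1)[OF s this] show False by simp
qed

theorem D0_symmetric:
  assumes cut: "\<And>X. \<exists>\<psi> \<eta> c. cutoff K X \<psi> \<eta> c"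
    and bound: "\<And>f h. (f, h) \<in> T0 \<Longrightarrow> \<gamma> * (L2_norm f)\<^sup>2 \<le> Re (ip h f)"
    and 1: "(f1, h1) \<in> D0" and 2: "(f2, h2) \<in> D0"
  shows "ip h1 f2 = ip f1 h2"
proof (rule ccontr)
  assume ne: "ip h1 f2 \<noteq> ip f1 h2"
  obtain s \<sigma> where s: "sol (\<lambda>t. of_real (\<gamma> - 1) * s t) s \<sigma> 0 1" "\<And>t. cnj (s t) = s t"
    using eigenfunction_exists[of "\<gamma> - 1"] by blast
  have "s \<in> L2" by (rule limit_circle_eigenfunction[OF s(1) 1 2 ne])
  moreover have "s \<notin> L2" by (rule eigenfunction_not_L2[OF cut s]) (use bound in auto)
  ultimately show False by simp
qed

end

section \<open>Cutoff functions in the gaps\<close>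

text \<open>The densities with the indicator of \<open>A\<close> are equal as measures. This serves
  to replace Jordan parts by Lebesgue measure where the two agree.\<close>

lemma set_integral_agree:
  fixes u :: "real \<Rightarrow> 'a::{banach, second_countable_topology}"
  assumes N: "sets N1 = sets borel" "sets N2 = sets borel" and A: "A \<in> sets borel"
    and agree: "\<And>B. B \<in> sets borel \<Longrightarrow> B \<subseteq> A \<Longrightarrow> emeasure N1 B = emeasure N2 B"
    and u: "u \<in> borel_measurable borel"
  shows "(LINT t:A|N1. u t) = (LINT t:A|N2. u t)" "set_integrable N1 A u \<longleftrightarrow> set_integrable N2 A u"
proof -
  have d: "density N1 (\<lambda>t. ennreal (indicator A t)) = density N2 (\<lambda>t. ennreal (indicator A t))"
  proof (rule measure_eqI)
    fix B assume "B \<in> sets (density N1 (\<lambda>t. ennreal (indicator A t)))"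
    then have B: "B \<in> sets borel" using N by simp
    have "emeasure (density N (\<lambda>t. ennreal (indicator A t))) B = emeasure N (A \<inter> B)" if "sets N = sets borel" for N
    proof -
      have "emeasure (density N (\<lambda>t. ennreal (indicator A t))) B = (\<integral>\<^sup>+t. ennreal (indicator A t) * indicator B t \<partial>N)"
        using A B that by (intro emeasure_density) auto
      also have "\<dots> = (\<integral>\<^sup>+t. indicator (A \<inter> B) t \<partial>N)"
        by (intro nn_integral_cong) (auto simp: indicator_def)
      also have "\<dots> = emeasure N (A \<inter> B)" using A B that by (intro nn_integral_indicator) auto
      finally show ?thesis .
    qed
    then show "emeasure (density N1 (\<lambda>t. ennreal (indicator A t))) B = emeasure (density N2 (\<lambda>t. ennreal (indicator A t))) B"
      using N agree[of "A \<inter> B"] A B by simp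
  qed (use N in simp)
  have i: "(LINT t:A|N. u t) = integral\<^sup>L (density N (\<lambda>t. ennreal (indicator A t))) u"
    "set_integrable N A u \<longleftrightarrow> integrable (density N (\<lambda>t. ennreal (indicator A t))) u"
    if "sets N = sets borel" for N
  proof -
    have [measurable]: "u \<in> borel_measurable N" "A \<in> sets N" using u A that
      by (simp_all cong: measurable_cong_sets)
    show "(LINT t:A|N. u t) = integral\<^sup>L (density N (\<lambda>t. ennreal (indicator A t))) u"
      unfolding set_lebesgue_integral_def by (rule integral_density[symmetric]) auto
    show "set_integrable N A u \<longleftrightarrow> integrable (density N (\<lambda>t. ennreal (indicator A t))) u"
      unfolding set_integrable_def by (rule integrable_density[symmetric]) auto
  qed
  show "(LINT t:A|N1. u t) = (LINT t:A|N2. u t)" "set_integrable N1 A u \<longleftrightarrow> set_integrable N2 A u"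
    unfolding i[OF N(1)] i[OF N(2)] d by (rule refl)+
qed

lemma set_integral_null:
  assumes "A \<in> sets N" "emeasure N A = 0" shows "(LINT t:A|N. u t) = 0"
proof -
  have "AE t in N. t \<notin> A" by (rule AE_not_in) (use assms in auto)
  then have "AE t in N. indicator A t *\<^sub>R u t = 0" by eventually_elim simp
  then show ?thesis unfolding set_lebesgue_integral_def by (rule integral_eq_zero_AE)
qed

text \<open>A parabola of height 1. It has to be a primitive of a bounded Borel function, so jumps
  of the derivative at the ends of the interval are allowed.\<close>

definition bump :: "real \<Rightarrow> real \<Rightarrow> real \<Rightarrow> real" where
  "bump \<alpha> \<beta> t = (if \<alpha> \<le> t \<and> t \<le> \<beta> then 4 * (t - \<alpha>) * (\<beta> - t) / (\<beta> - \<alpha>)\<^sup>2 else 0)"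

definition bump_deriv :: "real \<Rightarrow> real \<Rightarrow> real \<Rightarrow> real" where
  "bump_deriv \<alpha> \<beta> t = (if \<alpha> \<le> t \<and> t \<le> \<beta> then 4 * (\<alpha> + \<beta> - 2 * t) / (\<beta> - \<alpha>)\<^sup>2 else 0)"

lemma prim_FTC:
  fixes F f :: "real \<Rightarrow> real"
  assumes ab: "0 < \<alpha>"
    "\<alpha> \<le> \<beta>" and F: "\<And>t. (F has_real_derivative f t) (at t)" and f: "continuous_on UNIV f"
  shows "prim lborel (\<lambda>t. if \<alpha> \<le> t \<and> t \<le> \<beta> then f t else 0) x = (if x \<le> \<alpha> then 0 else F (min x \<beta>) - F \<alpha>)"
proof (cases "x \<le> \<alpha>")
  case True
  have "prim lborel (\<lambda>t. if \<alpha> \<le> t \<and> t \<le> \<beta> then f t else 0) x = prim lborel (\<lambda>_. 0) x"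
    by (rule prim_cong) (use True in auto)
  then show ?thesis using True by (simp add: prim_def)
next
  case False
  have "has_bochner_integral lborel (\<lambda>t. indicator {\<alpha>..min x \<beta>} t *\<^sub>R f t) (F (min x \<beta>) - F \<alpha>)"
  proof (rule has_bochner_integral_FTC_Icc)
    show "\<alpha> \<le> min x \<beta>" using False ab by simp
    show "(F has_vector_derivative f t) (at t within {\<alpha>..min x \<beta>})" for t
      using F[of t]
      by (simp add: has_real_derivative_iff_has_vector_derivative has_vector_derivative_at_within)
    show "continuous_on {\<alpha>..min x \<beta>} f" using f by (rule continuous_on_subset) simp
  qed
  then have "(LINT t|lborel. indicator {\<alpha>..min x \<beta>} t *\<^sub>R f t) = F (min x \<beta>) - F \<alpha>"
    by (rule has_bochner_integral_integral_eq)
  moreover have "prim lborel (\<lambda>t. if \<alpha> \<le> t \<and> t \<le> \<beta> then f t else 0) x = (LINT t|lborel. indicator {\<alpha>..min x \<beta>} t *\<^sub>R f t)"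
    unfolding prim_def set_lebesgue_integral_def
  proof (rule integral_cong_AE)
    have [measurable]: "f \<in> borel_measurable borel" using f by (rule borel_measurable_continuous_onI)
    show "(\<lambda>t. indicator {0<..<x} t *\<^sub>R (if \<alpha> \<le> t \<and> t \<le> \<beta> then f t else 0)) \<in> borel_measurable lborel"
      by measurable
    show "(\<lambda>t. indicator {\<alpha>..min x \<beta>} t *\<^sub>R f t) \<in> borel_measurable lborel" by measurable
    have "AE t in lborel. t \<noteq> x" by (rule AE_lborel_singleton)
    then show "AE t in lborel. indicator {0<..<x} t *\<^sub>R (if \<alpha> \<le> t \<and> t \<le> \<beta> then f t else 0) = indicator {\<alpha>..min x \<beta>} t *\<^sub>R f t"
      by eventually_elim (use ab in \<open>auto simp: indicator_def\<close>)
  qed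
  ultimately show ?thesis using False by simp
qed

lemma prim_bump_deriv:
  assumes ab: "0 < \<alpha>" "\<alpha> < \<beta>"
  shows "prim lborel (bump_deriv \<alpha> \<beta>) x = bump \<alpha> \<beta> x"
proof -
  have "prim lborel (\<lambda>t. if \<alpha> \<le> t \<and> t \<le> \<beta> then 4 * (\<alpha> + \<beta> - 2 * t) / (\<beta> - \<alpha>)\<^sup>2 else 0) x =
    (if x \<le> \<alpha> then 0 else 4 * (min x \<beta> - \<alpha>) * (\<beta> - min x \<beta>) / (\<beta> - \<alpha>)\<^sup>2 - 4 * (\<alpha> - \<alpha>) * (\<beta> - \<alpha>) / (\<beta> - \<alpha>)\<^sup>2)"
    using ab by (intro prim_FTC) (auto intro!: derivative_eq_intros continuous_intros simp: field_simps)
  then show ?thesis unfolding bump_deriv_def[abs_def] bump_def by (auto simp: min_def)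
qed

text \<open>The area under a parabolic arc is two thirds of its bounding box; this is the source of
  the factor 3/2 in the slope bound of the cutoff functions.\<close>

lemma prim_bump:
  assumes ab: "0 < \<alpha>" "\<alpha> < \<beta>" and x: "\<beta> \<le> x"
  shows "prim lborel (bump \<alpha> \<beta>) x = 2/3 * (\<beta> - \<alpha>)"
proof -
  \<comment> \<open>The antiderivative in powers of t - \<alpha>, found from \<beta> - t = (\<beta>
    - \<alpha>) - (t - \<alpha>) and normalized to vanish at \<alpha>.\<close>
  define F where "F t = (4 / (\<beta> - \<alpha>)\<^sup>2) * ((\<beta> - \<alpha>) * (t - \<alpha>)^2 / 2 - (t - \<alpha>)^3 / 3)" for t
  have "prim lborel (\<lambda>t. if \<alpha> \<le> t \<and> t \<le> \<beta> then 4 * (t - \<alpha>) * (\<beta> - t) / (\<beta> - \<alpha>)\<^sup>2 else 0) x =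
    (if x \<le> \<alpha> then 0 else F (min x \<beta>) - F \<alpha>)"
  proof (rule prim_FTC)
    show "(F has_real_derivative 4 * (t - \<alpha>) * (\<beta> - t) / (\<beta> - \<alpha>)\<^sup>2) (at t)" for t
    proof -
      have "(F has_real_derivative (4 / (\<beta> - \<alpha>)\<^sup>2) * ((\<beta> - \<alpha>) * (2 * (t - \<alpha>)) / 2 - (3 * (t - \<alpha>)^2) / 3)) (at t)"
        unfolding F_def by (rule derivative_eq_intros refl | simp)+
      moreover have "(4 / (\<beta> - \<alpha>)\<^sup>2) * ((\<beta> - \<alpha>) * (2 * (t - \<alpha>)) / 2 - (3 * (t - \<alpha>)^2) / 3) = 4 * (t - \<alpha>) * (\<beta> - t) / (\<beta> - \<alpha>)\<^sup>2"
      proof -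
        have "(\<beta> - \<alpha>) * (2 * (t - \<alpha>)) / 2 - (3 * (t - \<alpha>)^2) / 3 = (t - \<alpha>) * (\<beta> - t)"
          by (simp add: power2_eq_square field_simps)
        then show ?thesis by (simp only:) simp
      qed
      ultimately show ?thesis by (simp only:)
    qed
  qed (use ab in \<open>auto intro!: continuous_intros\<close>)
  also have "\<dots> = F \<beta> - F \<alpha>" using ab x by (simp add: min_def)
  also have "\<dots> = (4 / (\<beta> - \<alpha>)\<^sup>2) * ((\<beta> - \<alpha>)^3 / 6)" unfolding F_def
    by (simp add: power2_eq_square power3_eq_cube)
  also have "\<dots> = 2/3 * (\<beta> - \<alpha>)" using ab by (simp add: power2_eq_square power3_eq_cube)
  finally show ?thesis unfolding bump_def[abs_def] .
qed

lemma bump_bounds: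
  assumes "\<alpha> < \<beta>" shows "0 \<le> bump \<alpha> \<beta> t" "bump \<alpha> \<beta> t \<le> 1"
proof -
  show "0 \<le> bump \<alpha> \<beta> t" unfolding bump_def by auto
  have "0 \<le> (2 * t - \<alpha> - \<beta>)\<^sup>2" by simp
  then have "4 * (t - \<alpha>) * (\<beta> - t) \<le> (\<beta> - \<alpha>)\<^sup>2" by (simp add: power2_eq_square algebra_simps)
  then show "bump \<alpha> \<beta> t \<le> 1" unfolding bump_def using assms by auto
qed

lemma bump_outside: "t \<notin> {\<alpha><..<\<beta>} \<Longrightarrow> bump \<alpha> \<beta> t = 0"
  unfolding bump_def by auto

lemma bump_measurable [measurable]: "bump \<alpha> \<beta> \<in> borel_measurable borel"
  "bump_deriv \<alpha> \<beta> \<in> borel_measurable borel"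
  unfolding bump_def[abs_def] bump_deriv_def[abs_def] by measurable

lemma bump_deriv_bounded: "\<exists>B. \<forall>t. \<bar>bump_deriv \<alpha> \<beta> t\<bar> \<le> B"
proof (intro exI allI)
  fix t
  show "\<bar>bump_deriv \<alpha> \<beta> t\<bar> \<le> 4 * \<bar>\<beta> - \<alpha>\<bar> / (\<beta> - \<alpha>)\<^sup>2"
    unfolding bump_deriv_def by (auto simp: abs_mult intro!: divide_right_mono)
qed

lemma prim_sum:
  assumes "finite J" "\<And>j. j \<in> J \<Longrightarrow> loc N (u j)"
  shows "loc N (\<lambda>t. \<Sum>j\<in>J. u j t) \<and> prim N (\<lambda>t. \<Sum>j\<in>J. u j t) x = (\<Sum>j\<in>J. prim N (u j) x)"
  using assms
proof (induction J rule: finite_induct)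
  case empty
  have "loc N (\<lambda>_. 0)" unfolding loc_def set_integrable_def by simp
  then show ?case by (simp add: prim_def)
next
  case (insert j J)
  then show ?case by (simp add: loc_add prim_add)
qed

context sl_system
begin

text \<open>One bump in each cell, divided by the total area \<open>Z\<close>. As the cells are
  disjoint, the sum of the bumps is at most 1 and \<psi> at most 1/Z: the bound depends on the total
  length of the cells, not on their number or individual size.\<close>

lemma cutoff_of_cells:
  fixes \<alpha> \<beta> :: "nat \<Rightarrow> real"
  assumes J: "finite J" and cell: "\<And>j. j \<in> J \<Longrightarrow> 0 < \<alpha> j \<and> X \<le> \<alpha> j \<and> \<alpha> j < \<beta> j \<and> \<beta> j < c"
    and disj: "\<And>i j. i \<in> J \<Longrightarrow> j \<in> J \<Longrightarrow> i \<noteq> j \<Longrightarrow> {\<alpha> i<..<\<beta> i} \<inter> {\<alpha> j<..<\<beta> j} = {}"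
    and L: "0 < L" "L \<le> (\<Sum>j\<in>J. \<beta> j - \<alpha> j)"
    and gap: "\<And>w x. w \<in> borel_measurable borel \<Longrightarrow> (\<And>t. (\<forall>j\<in>J. t \<notin> {\<alpha> j<..<\<beta> j}) \<Longrightarrow> w t = 0) \<Longrightarrow> IP w x = prim lborel w x"
  shows "\<exists>\<psi> \<eta>. cutoff (3 / (2 * L)) X \<psi> \<eta> c"
proof -
  define Z where "Z = 2/3 * (\<Sum>j\<in>J. \<beta> j - \<alpha> j)"
  have Z0: "0 < Z" and ZL: "1 / Z \<le> 3 / (2 * L)" unfolding Z_def using L by (auto simp: field_simps)
  define \<psi> where "\<psi> t = 1 / Z * (\<Sum>j\<in>J. bump (\<alpha> j) (\<beta> j) t)" for t
  define \<eta> where "\<eta> t = 1 / Z * (\<Sum>j\<in>J. bump_deriv (\<alpha> j) (\<beta> j) t)" for t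
  have Jne: "J \<noteq> {}" using L by auto
  then obtain j0 where j0: "j0 \<in> J" by blast
  have c: "0 < c" "X \<le> c" using cell[OF j0] by auto
  have ld: "loc lborel (bump_deriv (\<alpha> j) (\<beta> j))" for j
    using bump_deriv_bounded[of "\<alpha> j" "\<beta> j"] by (intro loc_locally_bounded loc_finite_lborel) auto
  have lb: "loc lborel (bump (\<alpha> j) (\<beta> j))" if "j \<in> J" for j
  proof (rule loc_locally_bounded[OF loc_finite_lborel])
    show "\<exists>K. \<forall>t. 0 < t \<longrightarrow> t < c \<longrightarrow> norm (bump (\<alpha> j) (\<beta> j) t) \<le> K" for c
      using bump_bounds[of "\<alpha> j" "\<beta> j"] cell[OF that] by (intro exI[of _ 1]) auto
  qed simp
  have [measurable]: "\<psi> \<in> borel_measurable borel" "\<eta> \<in> borel_measurable borel" unfolding \<psi>_def \<eta>_def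
    by measurable
  have sum1: "(\<Sum>j\<in>J. bump (\<alpha> j) (\<beta> j) t) \<le> 1" for t
  proof (cases "\<exists>i\<in>J. t \<in> {\<alpha> i<..<\<beta> i}")
    case True
    then obtain i where i: "i \<in> J" "t \<in> {\<alpha> i<..<\<beta> i}" by blast
    have "bump (\<alpha> j) (\<beta> j) t = 0" if "j \<in> J - {i}" for j
      by (rule bump_outside) (use disj[OF i(1), of j] that i(2) in blast)
    then have "(\<Sum>j\<in>J. bump (\<alpha> j) (\<beta> j) t) = bump (\<alpha> i) (\<beta> i) t"
      unfolding sum.remove[OF J i(1)] by simp
    then show ?thesis using bump_bounds(2)[of "\<alpha> i" "\<beta> i" t] cell[OF i(1)] by simp
  next
    case False
    then have "(\<Sum>j\<in>J. bump (\<alpha> j) (\<beta> j) t) = 0"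
      by (intro sum.neutral ballI bump_outside) (use False in blast)
    then show ?thesis by simp
  qed
  have sum0: "0 \<le> (\<Sum>j\<in>J. bump (\<alpha> j) (\<beta> j) t)" for t
    using bump_bounds(1) cell by (intro sum_nonneg) auto
  have b0: "0 \<le> \<psi> t" for t unfolding \<psi>_def using sum0 Z0 by simp
  have b1: "\<psi> t \<le> 3 / (2 * L)" for t
  proof -
    have "\<psi> t \<le> 1 / Z * 1" unfolding \<psi>_def using sum1[of t] Z0 by (intro mult_left_mono) auto
    then show ?thesis using ZL by simp
  qed
  have out: "\<psi> t = 0" if "\<forall>j\<in>J. t \<notin> {\<alpha> j<..<\<beta> j}" for t
  proof -
    have "(\<Sum>j\<in>J. bump (\<alpha> j) (\<beta> j) t) = 0" by (rule sum.neutral) (use that bump_outside in auto)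
    then show ?thesis unfolding \<psi>_def by simp
  qed
  have psi_left: "\<psi> t = 0" if "t \<le> X" for t
  proof (rule out, rule ballI)
    fix j assume "j \<in> J"
    then show "t \<notin> {\<alpha> j<..<\<beta> j}" using cell[of j] that by auto
  qed
  have psi_right: "\<psi> t = 0" if "c \<le> t" for t
  proof (rule out, rule ballI)
    fix j assume "j \<in> J"
    then show "t \<notin> {\<alpha> j<..<\<beta> j}" using cell[of j] that by auto
  qed
  have prim\<eta>: "\<psi> x = prim lborel \<eta> x" for x
    using prim_sum[OF J, of lborel "\<lambda>j. bump_deriv (\<alpha> j) (\<beta> j)" x] ld cell
    unfolding \<psi>_def \<eta>_def prim_mult by (simp add: prim_bump_deriv)
  have prim\<psi>: "prim lborel \<psi> c = 1"
  proof -
    have "prim lborel \<psi> c = 1 / Z * (\<Sum>j\<in>J. prim lborel (bump (\<alpha> j) (\<beta> j)) c)"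
      using prim_sum[OF J, of lborel "\<lambda>j. bump (\<alpha> j) (\<beta> j)" c] lb unfolding \<psi>_def prim_mult by simp
    also have "(\<Sum>j\<in>J. prim lborel (bump (\<alpha> j) (\<beta> j)) c) = (\<Sum>j\<in>J. 2/3 * (\<beta> j - \<alpha> j))"
      using cell by (intro sum.cong refl prim_bump) (auto simp: less_imp_le)
    also have "\<dots> = Z" unfolding Z_def by (rule sum_distrib_left[symmetric])
    finally show ?thesis using Z0 by simp
  qed
  have \<eta>b: "\<exists>B. \<forall>t. \<bar>\<eta> t\<bar> \<le> B"
  proof -
    have "\<forall>j. \<exists>B. \<forall>t. \<bar>bump_deriv (\<alpha> j) (\<beta> j) t\<bar> \<le> B" by (intro allI bump_deriv_bounded)
    then obtain B where B: "\<And>j t. \<bar>bump_deriv (\<alpha> j) (\<beta> j) t\<bar> \<le> B j" unfolding choice_iff by blast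
    have "\<bar>\<eta> t\<bar> \<le> 1 / Z * (\<Sum>j\<in>J. B j)" for t
      unfolding \<eta>_def abs_mult using Z0
      by (intro mult_mono order_trans[OF sum_abs] sum_mono B) auto
    then show ?thesis by blast
  qed
  have \<eta>0: "\<eta> t = 0" if "c \<le> t" for t
  proof -
    have "bump_deriv (\<alpha> j) (\<beta> j) t = 0" if "j \<in> J" for j
      unfolding bump_deriv_def using cell[OF that] \<open>c \<le> t\<close> by auto
    then show ?thesis unfolding \<eta>_def by simp
  qed
  have gap\<psi>: "IP (\<lambda>t. of_real (\<psi> t) * u t) x = prim lborel (\<lambda>t. of_real (\<psi> t) * u t) x" if "locally_bounded u" for u x
    by (rule gap) (use that out in \<open>auto simp: locally_bounded_def\<close>)
  show ?thesis
    unfolding cutoff_def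
    by (intro exI[of _ \<psi>] exI[of _ \<eta>] conjI allI impI c b0 b1 psi_left psi_right prim\<eta> prim\<psi> \<eta>b \<eta>0 gap\<psi>) measurable
qed

end

section \<open>Quasi-derivatives as integral equations\<close>

lemma quasi_deriv_increment:
  assumes "quasi_deriv \<mu> f g" "0 < c" "c < d"
  shows "f d - f c = charge_integral \<mu> {c..<d} g"
  using assms rc_borel_interval[of c d] unfolding quasi_deriv_def is_df_def by metis

lemma set_integral_UN_lim:
  fixes u :: "real \<Rightarrow> 'a::{banach, second_countable_topology}"
  assumes A: "\<And>n. A n \<in> sets N" "disjoint_family A" and u: "set_integrable N (\<Union>n. A n) u"
  shows "(\<lambda>n. LINT t:A n|N. u t) sums (LINT t:(\<Union>n. A n)|N. u t)"
  unfolding sums_def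
proof -
  define B where "B n = (\<Union>i<n. A i)" for n
  have B: "B n \<in> sets N" for n unfolding B_def using A by auto
  have U: "(\<Union>n. B n) = (\<Union>n. A n)" unfolding B_def by auto
  have "(\<lambda>n. LINT t:B n|N. u t) \<longlonglongrightarrow> (LINT t:(\<Union>n. B n)|N. u t)"
  proof (rule set_integral_cont_up)
    show "incseq B" unfolding B_def incseq_def by (intro allI impI UN_mono) auto
  qed (use B u U in auto)
  moreover have "(LINT t:B n|N. u t) = (\<Sum>i<n. LINT t:A i|N. u t)" for n
    unfolding B_def
    by (rule set_integral_finite_Union)
       (use A u in \<open>auto simp: disjoint_family_on_def intro: set_integrable_subset[OF u]\<close>)
  ultimately show "(\<lambda>n. \<Sum>i<n. LINT t:A i|N. u t) \<longlonglongrightarrow> (LINT t:(\<Union>n. A n)|N. u t)"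
    unfolding U by simp
qed

text \<open>The charge df is obtained by integrating \<open>u\<close> against the two Jordan parts.
  Sums of increments are bounded by integrals of |u| over adjacent intervals, which add up; this
  bounds the variation.\<close>

lemma quasi_derivI:
  assumes u: "L1_loc \<mu> u" and left: "\<And>x. 0 < x \<Longrightarrow> (f \<longlongrightarrow> f x) (at_left x)"
    and incr: "\<And>c d. 0 < c \<Longrightarrow> c < d \<Longrightarrow> f d - f c = charge_integral \<mu> {c..<d} u"
  shows "quasi_deriv \<mu> f u"
proof -
  let ?m = "\<lambda>A. charge_integral \<mu> A u"
  have int: "set_integrable (pos_part \<mu>) A u"
    "set_integrable (neg_part \<mu>) A u" if A: "A \<in> rc_borel" for A
  proof -
    obtain c d where "0 < c" "A \<subseteq> {c..d}" "A \<in> sets borel" using A unfolding rc_borel_def by blast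
    moreover have "set_integrable (pos_part \<mu>) {c..d} u" "set_integrable (neg_part \<mu>) {c..d} u"
      using u \<open>0 < c\<close> unfolding L1_loc_def by auto
    ultimately show "set_integrable (pos_part \<mu>) A u" "set_integrable (neg_part \<mu>) A u"
      by (auto elim: set_integrable_subset)
  qed
  have "is_charge ?m"
    unfolding is_charge_def
  proof (intro allI impI)
    fix A :: "nat \<Rightarrow> real set"
    assume A: "range A \<subseteq> rc_borel \<and> disjoint_family A \<and> (\<Union>n. A n) \<in> rc_borel"
    then have "A n \<in> sets borel" for n by (auto dest: rc_borelD)
    then show "(\<lambda>n. ?m (A n)) sums ?m (\<Union>n. A n)"
      unfolding charge_integral_def using A int by (intro sums_diff set_integral_UN_lim) auto
  qed
  then have df: "is_df f ?m" unfolding is_df_def using incr by simp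
  have null: "?m A = 0" if "A \<in> rc_borel" "total_var \<mu> A = 0" for A
    using that rc_borelD[OF that(1)] unfolding charge_integral_def total_var_def
    by (simp add: set_integral_null)
  have bv: "BV_loc f"
    unfolding BV_loc_def
  proof (intro allI impI)
    fix c d :: real assume c: "0 < c"
    define \<Phi> where "\<Phi> A = (LINT x:A|pos_part \<mu>. norm (u x)) + (LINT x:A|neg_part \<mu>. norm (u x))" for A
    have ni: "set_integrable (pos_part \<mu>) A (\<lambda>x. norm (u x))"
      "set_integrable (neg_part \<mu>) A (\<lambda>x. norm (u x))" if "A \<in> rc_borel" for A
      using int[OF that, unfolded set_integrable_def, THEN integrable_norm] unfolding set_integrable_def
      by auto
    have \<Phi>0: "0 \<le> \<Phi> A" for A unfolding \<Phi>_def set_lebesgue_integral_def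
      by (intro add_nonneg_nonneg Bochner_Integration.integral_nonneg) auto
    have inc: "norm (f y - f x) \<le> \<Phi> {x..<y}" if "0 < x" "x \<le> y" for x y
    proof (cases "x = y")
      case False
      have *: "norm (LINT t:{x..<y}|N. u t) \<le> (LINT t:{x..<y}|N. norm (u t))" for N
        using integral_norm_bound[of N "\<lambda>t. indicator {x..<y} t *\<^sub>R u t"]
        unfolding set_lebesgue_integral_def by simp
      show ?thesis
        using incr[of x y] that False norm_triangle_ineq4[of "LINT t:{x..<y}|pos_part \<mu>. u t"
        "LINT t:{x..<y}|neg_part \<mu>. u t"]
          *[of "pos_part \<mu>"] *[of "neg_part \<mu>"]
        unfolding charge_integral_def \<Phi>_def by simp
    qed (use \<Phi>0 in simp)
    have add: "\<Phi> {x..<y} + \<Phi> {y..<z} = \<Phi> {x..<z}" if "0 < x" "x \<le> y" "y \<le> z" for x y z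
    proof -
      have U: "{x..<z} = {x..<y} \<union> {y..<z}" "{x..<y} \<inter> {y..<z} = {}" using that by auto
      have r: "{x..<y} \<in> rc_borel" "{y..<z} \<in> rc_borel" using that by (auto intro: rc_borel_interval)
      show ?thesis unfolding \<Phi>_def U(1) using ni[OF r(1)] ni[OF r(2)]
        by (simp add: set_integral_Un[OF U(2)])
    qed
    show "\<exists>K. \<forall>(t::nat \<Rightarrow> real) n. mono t \<and> range t \<subseteq> {c..d} \<longrightarrow> (\<Sum>i<n. norm (f (t (Suc i)) - f (t i))) \<le> K"
    proof (intro exI allI impI)
      fix t :: "nat \<Rightarrow> real" and n assume t: "mono t \<and> range t \<subseteq> {c..d}"
      have "t i \<in> {c..d}" for i using t by blast
      then have tc: "c \<le> t i" "t i \<le> d" for i by auto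
      have tm: "t i \<le> t j" if "i \<le> j" for i j using t that by (simp add: monoD)
      have "(\<Sum>i<n. norm (f (t (Suc i)) - f (t i))) \<le> \<Phi> {t 0..<t n}"
      proof (induction n)
        case 0
        then show ?case using \<Phi>0 by simp
      next
        case (Suc n)
        have "(\<Sum>i<Suc n. norm (f (t (Suc i)) - f (t i))) \<le> \<Phi> {t 0..<t n} + \<Phi> {t n..<t (Suc n)}"
          using Suc.IH inc[of "t n" "t (Suc n)"] tc[of n] c tm[of n "Suc n"] by simp
        also have "\<dots> = \<Phi> {t 0..<t (Suc n)}" by (rule add) (use tc[of 0] c tm in auto)
        finally show ?case .
      qed
      also have "\<dots> \<le> \<Phi> {c..<t 0} + \<Phi> {t 0..<t n} + \<Phi> {t n..<d}" using \<Phi>0 by simp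
      also have "\<dots> = \<Phi> {c..<d}" using add[of c "t 0" "t n"] add[of c "t n" d] c tc tm[of 0 n]
        by (simp add: order_trans[OF _ tm[of 0 n]])
      finally show "(\<Sum>i<n. norm (f (t (Suc i)) - f (t i))) \<le> \<Phi> {c..<d}" .
    qed
  qed
  have "AC_loc \<mu> f"
    unfolding AC_loc_def using bv left df null by (auto simp: continuous_within)
  then show ?thesis unfolding quasi_deriv_def using u df by blast
qed

lemma set_integral_leb:
  fixes u :: "real \<Rightarrow> 'a::{banach, second_countable_topology}"
  assumes u: "u \<in> borel_measurable borel" and A: "A \<in> sets borel" "A \<subseteq> {0<..}"
  shows "(LINT t:A|pos_part leb. u t) = (LINT t:A|lborel. u t)"
    and "set_integrable (pos_part leb) A u \<longleftrightarrow> set_integrable lborel A u"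
proof -
  have "emeasure (pos_part leb) B = emeasure lborel B" if "B \<in> sets borel" "B \<subseteq> A" for B
    using that A by (simp add: emeasure_pos_part_leb Int_absorb2)
  then show "(LINT t:A|pos_part leb. u t) = (LINT t:A|lborel. u t)"
    "set_integrable (pos_part leb) A u \<longleftrightarrow> set_integrable lborel A u"
    using set_integral_agree[of "pos_part leb" lborel A u] u A by auto
qed

lemma set_integrable_neg_part_leb:
  fixes u :: "real \<Rightarrow> 'a::{banach, second_countable_topology}"
  assumes "u \<in> borel_measurable borel" "A \<in> sets borel"
  shows "set_integrable (neg_part leb) A u"
  unfolding set_integrable_def
proof (rule integrableI_bounded)
  have [measurable]: "u \<in> borel_measurable (neg_part leb)" "A \<in> sets (neg_part leb)"
    using assms by (simp_all cong: measurable_cong_sets)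
  show "(\<lambda>x. indicator A x *\<^sub>R u x) \<in> borel_measurable (neg_part leb)" by measurable
  have "AE x in neg_part leb. x \<notin> UNIV"
    by (rule AE_not_in) (simp add: null_sets_def emeasure_neg_part_leb)
  then have "(\<integral>\<^sup>+x. ennreal (norm (indicator A x *\<^sub>R u x)) \<partial>neg_part leb) = 0"
    by (subst nn_integral_0_iff_AE) auto
  then show "(\<integral>\<^sup>+x. ennreal (norm (indicator A x *\<^sub>R u x)) \<partial>neg_part leb) < \<infinity>" by simp
qed

lemma charge_integral_leb:
  assumes "u \<in> borel_measurable borel" "A \<in> sets borel" "A \<subseteq> {0<..}"
  shows "charge_integral leb A u = (LINT t:A|lborel. u t)"
  unfolding charge_integral_def using assms
  by (simp add: set_integral_leb set_integral_null emeasure_neg_part_leb)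

lemma charge_integral_cong:
  "(\<And>t. t \<in> A \<Longrightarrow> u t = v t) \<Longrightarrow> charge_integral \<mu> A u = charge_integral \<mu> A v"
  unfolding charge_integral_def set_lebesgue_integral_def
  by (intro arg_cong2[where f = minus] Bochner_Integration.integral_cong) (auto simp: indicator_def)

text \<open>Integrability gives measurability on each compact interval, and these exhaust the half
  line.\<close>

lemma L1_loc_measurable:
  assumes "L1_loc \<mu> u"
  shows "(\<lambda>x. if 0 < x then u x else 0) \<in> borel_measurable borel"
proof (rule borel_measurable_LIMSEQ_metric)
  fix n :: nat
  have "set_integrable (pos_part \<mu>) {1 / real (Suc n)..real n} u" using assms unfolding L1_loc_def
    by simp
  then have "(\<lambda>x. indicator {1 / real (Suc n)..real n} x *\<^sub>R u x) \<in> borel_measurable (pos_part \<mu>)"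
    unfolding set_integrable_def by (rule borel_measurable_integrable)
  then show "(\<lambda>x. indicator {1 / real (Suc n)..real n} x *\<^sub>R u x) \<in> borel_measurable borel"
    using measurable_cong_sets[OF sets_pos_part refl] by blast
next
  fix x :: real
  show "(\<lambda>n. indicator {1 / real (Suc n)..real n} x *\<^sub>R u x) \<longlonglongrightarrow> (if 0 < x then u x else 0)"
  proof (cases "0 < x")
    case True
    obtain n0 where n0: "max x (1 / x) < real n0" using reals_Archimedean2 by blast
    have "indicator {1 / real (Suc n)..real n} x *\<^sub>R u x = u x" if "n0 \<le> n" for n
    proof -
      have "x \<le> real n" "1 / x < real (Suc n)" using n0 that by auto
      then have "x \<in> {1 / real (Suc n)..real n}" using True by (simp add: field_simps)
      then show ?thesis by simp
    qed
    then show ?thesis using True by (intro tendsto_eventually) (auto simp: eventually_sequentially)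
  next
    case False
    have "indicator {1 / real (Suc n)..real n} x *\<^sub>R u x = 0" for n
    proof -
      have "0 < 1 / real (Suc n)" by simp
      then have "x \<notin> {1 / real (Suc n)..real n}" using False by (meson atLeastAtMost_iff less_le_trans)
      then show ?thesis by simp
    qed
    then have "(\<lambda>n. indicator {1 / real (Suc n)..real n} x *\<^sub>R u x) = (\<lambda>n. 0)" by blast
    then show ?thesis using False by (simp only: if_False tendsto_const)
  qed
qed

text \<open>\<open>q'\<close> is a Borel version of \<open>q\<close>: the integral system uses
  \<open>q'\<close> and the operators use \<open>q\<close>, a change on a null set that
  \<open>tau\<close> does not see.\<close>

locale sl_problem =
  fixes \<nu> :: "real set \<Rightarrow> real" and q q' :: "real \<Rightarrow> real"
  assumes charge: "is_charge \<nu>" and singular: "singular_leb \<nu>"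
    and finite_var: "\<And>c. 0 < c \<Longrightarrow> total_var \<nu> {0<..<c} < \<infinity>"
    and q'_meas: "q' \<in> borel_measurable borel" and q'_loc: "loc lborel q'"
    and q'_eq: "AE x in half_line. q x = q' x"
begin

abbreviation "P1 \<equiv> pos_part (dP \<nu>)"
abbreviation "P2 \<equiv> neg_part (dP \<nu>)"

text \<open>Charges live on the half line, so the nonpositive axis has mass zero and can join the
  intervals (0, n) in a countable cover.\<close>

lemma loc_finite_parts: "loc_finite P1" "loc_finite P2"
proof -
  have fin: "emeasure P1 {0<..<c} < \<infinity>" "emeasure P2 {0<..<c} < \<infinity>" for c
    using dP_parts_finite[OF charge finite_var, of c] by (cases "0 < c", auto)+
  have "{..0::real} \<inter> {0<..} = {}" by auto
  then have zero: "emeasure P1 {..0} = 0" "emeasure P2 {..0} = 0"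
    using pos_part_negative_axis[OF is_charge_dP[OF charge], of "{..0}"]
      pos_part_negative_axis[OF is_charge_uminus[OF is_charge_dP[OF charge]], of "{..0}"]
    unfolding neg_part_def by auto
  have sf: "sigma_finite_measure N" 
    if N: "sets N = sets borel" "\<And>c. emeasure N {0<..<c} < \<infinity>"
      "emeasure N {..0} = 0" for N :: "real measure"
  proof
    have sp: "space N = UNIV" using sets_eq_imp_space_eq[OF N(1)] by simp
    define A where "A = insert {..0} (range (\<lambda>n::nat. {0<..<real n}))"
    have "\<Union>A = UNIV"
    proof -
      have "x \<in> \<Union>A" for x
      proof -
        obtain n where "x < real n" using reals_Archimedean2 by blast
        then show ?thesis unfolding A_def by (cases "x \<le> 0") auto
      qed
      then show ?thesis by blast
    qed
    then show "\<exists>A. countable A \<and> A \<subseteq> sets N \<and> \<Union> A = space N \<and> (\<forall>a\<in>A. emeasure N a \<noteq> \<infinity>)"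
      unfolding sp using N by (intro exI[of _ A]) (auto simp: A_def less_top[symmetric])
  qed
  show "loc_finite P1" "loc_finite P2"
    unfolding loc_finite_def using fin zero by (auto intro!: sf)
qed

sublocale sl_system P1 P2 q'
  using loc_finite_parts q'_meas q'_loc by unfold_locales

text \<open>On a |d\<nu>|-null set in the half line \<open>P1\<close> is Lebesgue measure and
  \<open>P2\<close> is zero. This is applied to the complement of a null set carrying d\<nu> and to
  the complement of the support.\<close>

lemma IP_off_support:
  assumes A: "A \<in> sets borel" "total_var \<nu> A = 0" and u: "u \<in> borel_measurable borel" 
    and z: "\<And>t. 0 < t \<Longrightarrow> t \<notin> A \<Longrightarrow> u t = 0"
  shows "IP u x = prim lborel u x"
proof -
  let ?B = "A \<inter> {0<..<x}"
  have B: "?B \<in> sets borel" using A by simp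
  have r: "prim N u x = (LINT t:?B|N. u t)" for N
    unfolding prim_def set_lebesgue_integral_def
    by (intro Bochner_Integration.integral_cong) (use z in \<open>auto simp: indicator_def\<close>)
  have pos: "?B \<subseteq> {0<..}" by auto
  have "(LINT t:?B|P1. u t) = (LINT t:?B|lborel. u t)"
    by (rule set_integral_agree(1)[OF _ _ B _ u]) (use dP_parts_off_support(1)[OF charge A(2,1)] pos in auto)
  moreover have "(LINT t:?B|P2. u t) = 0"
    by (rule set_integral_null) (use dP_parts_off_support(2)[OF charge A(2,1) B _ pos] B in auto)
  ultimately show ?thesis unfolding IP_def r by simp
qed

text \<open>d\<nu> is carried by a Lebesgue null set \<open>N\<close>. That all primitives of
  \<open>g\<close> against dP vanish passes to integrals over Borel sets, in particular over those
  off \<open>N\<close>, where dP is Lebesgue measure.\<close>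

sublocale sl_nondegenerate P1 P2 q'
proof
  fix g assume lb: "locally_bounded g" and z: "\<And>x. IP g x = 0"
  obtain N where N: "N \<in> null_sets lborel" "total_var \<nu> ({0<..} - N) = 0" using singular
    unfolding singular_leb_def by blast
  have Nb: "N \<in> sets borel" using N(1) by auto
  have gm [measurable]: "g \<in> borel_measurable borel" using lb unfolding locally_bounded_def by simp
  have l12: "loc P1 g" "loc P2 g" using locally_bounded_locP[OF lb] unfolding locP_def by auto
  define v where "v t = (if t \<in> N then 0 else g t)" for t
  have vm: "v \<in> borel_measurable borel" unfolding v_def using Nb by measurable
  have lv: "loc lborel v"
  proof (rule loc_locally_bounded[OF loc_finite_lborel vm])
    fix c
    obtain K where "\<And>t. 0 < t \<Longrightarrow> t \<le> c \<Longrightarrow> norm (g t) \<le> K" using lb unfolding locally_bounded_def by meson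
    then show "\<exists>K. \<forall>t. 0 < t \<longrightarrow> t < c \<longrightarrow> norm (v t) \<le> K"
      by (intro exI[of _ "max K 0"]) (auto simp: v_def le_max_iff_disj)
  qed
  have "prim lborel v x = 0" for x
  proof -
    have "prim lborel v x = IP v x"
      by (rule IP_off_support[symmetric, OF _ N(2) vm]) (use Nb in \<open>auto simp: v_def\<close>)
    also have "IP v x = (LINT t:({0<..} - N) \<inter> {0<..<x}|P1. g t) - (LINT t:({0<..} - N) \<inter> {0<..<x}|P2. g t)"
      unfolding IP_def prim_def set_lebesgue_integral_def
      by (intro arg_cong2[where f = minus] Bochner_Integration.integral_cong) (auto simp: v_def indicator_def)
    also have "(LINT t:({0<..} - N) \<inter> {0<..<x}|P1. g t) = (LINT t:({0<..} - N) \<inter> {0<..<x}|P2. g t)"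
      by (rule set_integral_eq_if_prim_eq[OF _ _ l12]) (use z Nb in \<open>auto simp: IP_def\<close>)
    finally show ?thesis by simp
  qed
  then have "AE t in lborel. 0 < t \<longrightarrow> v t = 0" by (rule prim_zero_AE[OF lv])
  moreover have "AE t in lborel. t \<notin> N" by (rule AE_not_in[OF N(1)])
  ultimately show "AE t in lborel. 0 < t \<longrightarrow> g t = 0" by eventually_elim (auto simp: v_def)
qed

lemma D0_imp_H_D:
  assumes fh: "(f, h) \<in> D0" and h': "h' \<in> L2" "AE x in half_line. h' x = h x"
  shows "(f, h') \<in> H_D \<nu> q"
proof -
  obtain g b where s: "sol h f g 0 b" and L: "f \<in> L2" "h \<in> L2" using fh unfolding D0_def by blast
  have feq: "f = IP g" and geq: "g = (\<lambda>x. b + prim lborel (\<lambda>t. of_real (q' t) * f t - h t) x)"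
    using solD(5)[OF s] solD(6)[OF s] by auto
  have lg: "locally_bounded g" by (rule sol_locally_bounded(2)[OF s])
  have gm: "g \<in> borel_measurable borel" using lg unfolding locally_bounded_def by simp
  have l12: "loc P1 g" "loc P2 g" using locally_bounded_locP[OF lg] unfolding locP_def by auto
  define k where "k t = of_real (q' t) * f t - h t" for t
  have k: "loc lborel k" "k \<in> borel_measurable borel" unfolding k_def using sol_q[OF s] by auto
  have sub: "set_integrable N {c..d} u" if "loc N u" "sets N = sets borel"
    "0 < c" for N c d and u :: "real \<Rightarrow> complex"
    using that by (intro set_integrable_subset[OF locD[OF that(1), of "d + 1"]]) auto
  have 1: "quasi_deriv (dP \<nu>) f g"
  proof (rule quasi_derivI)
    show "L1_loc (dP \<nu>) g" unfolding L1_loc_def using sub l12 by auto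
    show "(f \<longlongrightarrow> f x) (at_left x)" for x unfolding feq by (rule IP_left_continuous[OF lg])
    fix c d :: real assume "0 < c" "c < d"
    then show "f d - f c = charge_integral (dP \<nu>) {c..<d} g"
      unfolding feq IP_def charge_integral_def
      using prim_incr[OF l12(1) _ , of c d, symmetric] prim_incr[OF l12(2) _ , of c d, symmetric] by simp
  qed
  have 2: "quasi_deriv leb g k"
  proof (rule quasi_derivI)
    show "L1_loc leb k" unfolding L1_loc_def
    proof (intro allI impI conjI)
      fix c d :: real assume c: "0 < c"
      then have "{c..d} \<subseteq> {0<..}" by auto
      then show "set_integrable (pos_part leb) {c..d} k"
        using set_integral_leb(2)[OF k(2), of "{c..d}"] sub[OF k(1) _ c] by simp
      show "set_integrable (neg_part leb) {c..d} k" by (rule set_integrable_neg_part_leb[OF k(2)]) simp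
    qed
    show "(g \<longlongrightarrow> g x) (at_left x)" for x
      by (subst (1 2) geq) (intro tendsto_add tendsto_const prim_left_continuous loc_finite_lborel sol_q[OF s])
    fix c d :: real assume cd: "0 < c" "c < d"
    then have "{c..<d} \<subseteq> {0<..}" by auto
    then have "charge_integral leb {c..<d} k = (LINT t:{c..<d}|lborel. k t)"
      by (intro charge_integral_leb k) auto
    also have "\<dots> = prim lborel k d - prim lborel k c" using prim_incr[OF k(1) _ cd(1)] cd by simp
    also have "\<dots> = g d - g c" unfolding k_def[abs_def] using solD(6)[OF s, of d] solD(6)[OF s, of c]
      by simp
    finally show "g d - g c = charge_integral leb {c..<d} k" by simp
  qed
  have 3: "AE x in half_line. h' x = - k x + of_real (q x) * f x"
    using h'(2) q'_eq by eventually_elim (simp add: k_def)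
  have "(f \<longlongrightarrow> 0) (at_right 0)" unfolding feq by (rule IP_at_right_0[OF lg])
  then show ?thesis unfolding H_D_def H_max_def tau_def using L h'(1) 1 2 3 by auto
qed

text \<open>The definitions control \<open>g\<close> and \<open>k\<close> on compact subintervals of
  the half line only. Integrability of \<open>k\<close> down to 0 comes from k = q f - h and the
  boundedness of \<open>f\<close> near 0; then \<open>g\<close> has a limit at 0, and the integral
  equations can be started there.\<close>

lemma H_D_imp_D0:
  assumes fh: "(f, h) \<in> H_D \<nu> q"
  shows "\<exists>F H. (F, H) \<in> D0 \<and> (AE x in half_line. f x = F x) \<and> (AE x in half_line. h x = H x)"
proof -
  obtain g k where qg: "quasi_deriv (dP \<nu>) f g" and qk: "quasi_deriv leb g k"
    and ae: "AE x in half_line. h x = - k x + of_real (q x) * f x" and L: "f \<in> L2"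
      "h \<in> L2" and f0: "(f \<longlongrightarrow> 0) (at_right 0)"
    using fh unfolding H_D_def H_max_def tau_def by auto
  obtain hb where hb: "hb \<in> borel_measurable borel" "AE x in half_line. h x = hb x"
    using half_line_borel_rep[OF L2_measurable[OF L(2)]] by blast
  have hbL: "hb \<in> L2"
    using sqint_cong_AE(1)[OF L2_measurable[OF L(2)] measurable_half_line[OF hb(1)] hb(2)] L(2)
    unfolding L2_iff_sqint by simp
  have hbl: "loc lborel hb" by (rule L2_loc(2)[OF hb(1) hbL])
  \<comment> \<open>The values of \<open>k\<close> off the half line are arbitrary;
    \<open>k0\<close> is a Borel function on the whole line.\<close>
  define k0 where "k0 x = (if 0 < x then k x else 0)" for x
  have k0m [measurable]: "k0 \<in> borel_measurable borel" unfolding k0_def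
    by (rule L1_loc_measurable) (use qk in \<open>auto simp: quasi_deriv_def\<close>)
  have k0ae: "AE x in lborel. 0 < x \<longrightarrow> k0 x = of_real (q' x) * f x - hb x"
    using ae hb(2) q'_eq unfolding AE_half_line by eventually_elim (auto simp: k0_def)
  have "eventually (\<lambda>x. norm (f x) < 1) (at_right 0)"
    using order_tendstoD(2)[OF tendsto_norm[OF f0], of 1] by simp
  then obtain \<delta> where \<delta>: "0 < \<delta>" "\<And>x. 0 < x \<Longrightarrow> x < \<delta> \<Longrightarrow> norm (f x) < 1" unfolding eventually_at_right_field
    by auto
  have k0l: "loc lborel k0"
    unfolding loc_def
  proof
    fix c
    have near: "set_integrable lborel {0<..<\<delta>} k0"
    proof (rule set_integrable_bound)
      show "set_integrable lborel {0<..<\<delta>} (\<lambda>t. \<bar>q' t\<bar> + norm (hb t))"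
        using locD[OF loc_add[OF loc_norm[OF q'_loc] loc_norm[OF hbl]], of \<delta>] by simp
      show "set_borel_measurable lborel {0<..<\<delta>} k0" unfolding set_borel_measurable_def by measurable
      show "AE x in lborel. x \<in> {0<..<\<delta>} \<longrightarrow> norm (k0 x) \<le> norm (\<bar>q' x\<bar> + norm (hb x))"
        using k0ae
      proof eventually_elim
        fix x assume *: "0 < x \<longrightarrow> k0 x = of_real (q' x) * f x - hb x"
        show "x \<in> {0<..<\<delta>} \<longrightarrow> norm (k0 x) \<le> norm (\<bar>q' x\<bar> + norm (hb x))"
        proof
          assume x: "x \<in> {0<..<\<delta>}"
          have "norm (k0 x) \<le> norm (of_real (q' x) * f x) + norm (hb x)" using * x
            by (simp add: norm_triangle_ineq4)
          also have "norm (of_real (q' x) * f x) \<le> \<bar>q' x\<bar> * 1"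
            unfolding norm_mult norm_of_real using \<delta>(2)[of x] x by (intro mult_left_mono) auto
          finally show "norm (k0 x) \<le> norm (\<bar>q' x\<bar> + norm (hb x))" by simp
        qed
      qed
    qed
    have "set_integrable (pos_part leb) {\<delta>..c} k" using qk \<delta>(1) unfolding quasi_deriv_def L1_loc_def
      by blast
    then have "set_integrable (pos_part leb) {\<delta>..c} k0"
      by (rule iffD1[OF set_integrable_cong, rotated -1]) (use \<delta>(1) in \<open>auto simp: k0_def\<close>)
    moreover have "{\<delta>..c} \<subseteq> {0<..}" using \<delta>(1) by auto
    ultimately have far: "set_integrable lborel {\<delta>..c} k0" using set_integral_leb(2)[OF k0m, of "{\<delta>..c}"]
      by simp
    have "set_integrable lborel ({0<..<\<delta>} \<union> {\<delta>..c}) k0" by (rule set_integrable_Un[OF near far]) auto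
    then show "set_integrable lborel {0<..<c} k0" by (rule set_integrable_subset) auto
  qed
  have ginc: "g d - g c = prim lborel k0 d - prim lborel k0 c" if cd: "0 < c" "c \<le> d" for c d
  proof (cases "c = d")
    case False
    have "{c..<d} \<subseteq> {0<..}" using cd by auto
    then have "charge_integral leb {c..<d} k0 = (LINT t:{c..<d}|lborel. k0 t)"
      by (intro charge_integral_leb k0m) auto
    moreover have "charge_integral leb {c..<d} k = charge_integral leb {c..<d} k0"
      by (rule charge_integral_cong) (use cd in \<open>auto simp: k0_def\<close>)
    ultimately show ?thesis using quasi_deriv_increment[OF qk, of c d] cd False prim_incr[OF k0l _ cd]
      by simp
  qed simp
  \<comment> \<open>With this constant \<open>G\<close> and \<open>g\<close> agree at 1, hence on
    the whole half line; \<open>b\<close> is the limit of \<open>g\<close> at 0.\<close>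
  define b where "b = g 1 - prim lborel k0 1"
  define G where "G x = b + prim lborel k0 x" for x
  have Gg: "G x = g x" if "0 < x" for x
    using ginc[of x 1] ginc[of 1 x] that unfolding G_def b_def
    by (cases "x \<le> 1") (auto simp: algebra_simps)
  have lG: "locally_bounded G" unfolding G_def
    by (intro locally_bounded_add locally_bounded_const locally_bounded_prim loc_finite_lborel k0l k0m)
  have l12: "loc P1 G" "loc P2 G" using locally_bounded_locP[OF lG] unfolding locP_def by auto
  have finc: "f d - f c = IP G d - IP G c" if cd: "0 < c" "c \<le> d" for c d
  proof (cases "c = d")
    case False
    have "charge_integral (dP \<nu>) {c..<d} g = charge_integral (dP \<nu>) {c..<d} G"
      by (rule charge_integral_cong) (use cd Gg in auto)
    also have "\<dots> = IP G d - IP G c"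
      unfolding charge_integral_def IP_def
      using prim_incr[OF l12(1) _ cd, symmetric] prim_incr[OF l12(2) _ cd, symmetric] by simp
    finally show ?thesis using quasi_deriv_increment[OF qg, of c d] cd False by simp
  qed simp
  \<comment> \<open>\<open>a\<close> is the limit of \<open>f\<close> at 0, which membership in
    \<open>H_D\<close> makes zero.\<close>
  define a where "a = f 1 - IP G 1"
  have fa: "f x = a + IP G x" if "0 < x" for x
    using finc[of x 1] finc[of 1 x] that unfolding a_def by (cases "x \<le> 1") (auto simp: algebra_simps)
  have "a = 0"
  proof -
    have "((\<lambda>x. a + IP G x) \<longlongrightarrow> a + 0) (at_right 0)"
      by (intro tendsto_add tendsto_const IP_at_right_0 lG)
    moreover have "eventually (\<lambda>x. a + IP G x = f x) (at_right 0)"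
      using fa by (auto simp: eventually_at_right_field intro!: exI[of _ 1])
    ultimately have "(f \<longlongrightarrow> a + 0) (at_right 0)" by (rule Lim_transform_eventually)
    then show ?thesis using tendsto_unique[OF _ f0] by force
  qed
  then have fF: "f x = IP G x" if "0 < x" for x using fa[OF that] by simp
  have lF: "locally_bounded (IP G)" by (rule locally_bounded_IP[OF lG])
  have Fm [measurable]: "IP G \<in> borel_measurable borel" using lF unfolding locally_bounded_def by simp
  define H where "H t = of_real (q' t) * IP G t - k0 t" for t
  have qF: "loc lborel (\<lambda>t. of_real (q' t) * IP G t)"
    by (intro loc_times_locally_bounded q_loc_complex lF) simp
  have Hm: "H \<in> borel_measurable borel" unfolding H_def by measurable
  have Hl: "loc lborel H" unfolding H_def by (rule loc_diff[OF qF k0l])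
  have "(\<lambda>t. of_real (q' t) * IP G t - H t) = k0" unfolding H_def by simp
  then have s: "sol H (IP G) G 0 b" unfolding sol_def using Hm Hl Fm qF G_def by simp
  have fae: "AE x in half_line. f x = IP G x" unfolding AE_half_line using fF by simp
  have hae: "AE x in half_line. h x = H x"
    using ae q'_eq unfolding AE_half_line by eventually_elim (auto simp: H_def k0_def fF)
  have "IP G \<in> L2" "H \<in> L2"
    using sqint_cong_AE(1)[OF L2_measurable[OF L(1)] measurable_half_line[OF Fm] fae]
      sqint_cong_AE(1)[OF L2_measurable[OF L(2)] measurable_half_line[OF Hm] hae] L
        unfolding L2_iff_sqint by auto
  then have "(IP G, H) \<in> D0" unfolding D0_def using s by blast
  then show ?thesis using fae hae by blast
qed

section \<open>Self-adjointness of \<open>H_min\<close>\<close>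

lemma H_min_iff:
  "(u, w) \<in> H_min \<nu> q \<longleftrightarrow> u \<in> L2 \<and> w \<in> L2 \<and> (\<forall>(f, h)\<in>D0. ip h u = ip f w)"
proof -
  have "(\<forall>(f, h)\<in>H_D \<nu> q. ip h u = ip f w) \<longleftrightarrow> (\<forall>(f, h)\<in>D0. ip h u = ip f w)" if uw: "u \<in> L2" "w \<in> L2"
  proof safe
    fix f h assume "\<forall>(f, h)\<in>H_D \<nu> q. ip h u = ip f w" "(f, h) \<in> D0"
    then show "ip h u = ip f w" using D0_imp_H_D[of f h h] D0_borel[of f h] by auto
  next
    fix f h assume *: "\<forall>(f, h)\<in>D0. ip h u = ip f w" and fh: "(f, h) \<in> H_D \<nu> q"
    obtain F H where FH: "(F, H) \<in> D0" "AE x in half_line. f x = F x" "AE x in half_line. h x = H x"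
      using H_D_imp_D0[OF fh] by blast
    have fhL: "f \<in> L2" "h \<in> L2" using fh unfolding H_D_def H_max_def by auto
    \<comment> \<open>Inner products depend on classes only, so an element of \<open>H_D\<close> may
      be replaced by its representative in \<open>D0\<close>.\<close>
    have "ip h u = ip H u"
      by (rule ip_cong_AE) (use L2_measurable fhL uw FH D0_borel[OF FH(1)] in auto)
    also have "\<dots> = ip F w" using * FH(1) by blast
    also have "\<dots> = ip f w"
      by (rule ip_cong_AE) (use L2_measurable fhL uw FH D0_borel[OF FH(1)] in \<open>auto elim: AE_mp\<close>)
    finally show "ip h u = ip f w" .
  qed
  then show ?thesis unfolding H_min_def adjoint_graph_def by blast
qed

lemma T0_subset_H_min: "T0 \<subseteq> H_min \<nu> q"
proof safe
  fix f h assume fh: "(f, h) \<in> T0"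
  then show "(f, h) \<in> H_min \<nu> q"
    unfolding H_min_iff using T0_symmetric[OF fh] D0_borel T0_subset_D0 by blast
qed

lemma adjoint_T0:
  assumes "(u, w) \<in> adjoint_graph T0"
  shows "\<exists>F H. (F, H) \<in> D0 \<and> (AE x in half_line. u x = F x) \<and> (AE x in half_line. w x = H x)"
proof -
  have L: "u \<in> L2" "w \<in> L2" and adj: "\<And>f h. (f, h) \<in> T0 \<Longrightarrow> ip h u = ip f w"
    using assms unfolding adjoint_graph_def by auto
  obtain u' where u': "u' \<in> borel_measurable borel" "AE x in half_line. u x = u' x"
    using half_line_borel_rep[OF L2_measurable[OF L(1)]] by blast
  obtain w' where w': "w' \<in> borel_measurable borel" "AE x in half_line. w x = w' x"
    using half_line_borel_rep[OF L2_measurable[OF L(2)]] by blast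
  have L': "u' \<in> L2" "w' \<in> L2"
    using sqint_cong_AE(1)[OF L2_measurable[OF L(1)] measurable_half_line[OF u'(1)] u'(2)]
      sqint_cong_AE(1)[OF L2_measurable[OF L(2)] measurable_half_line[OF w'(1)] w'(2)] L
        unfolding L2_iff_sqint by auto
  have "ip h u' = ip f w'" if fh: "(f, h) \<in> T0" for f h
  proof -
    have fhL: "f \<in> L2" "h \<in> L2" using fh T0_subset_D0 D0_borel by blast+
    have "ip h u = ip h u'" by (rule ip_cong_AE) (use L2_measurable fhL L L' u' in auto)
    moreover have "ip f w = ip f w'" by (rule ip_cong_AE) (use L2_measurable fhL L L' w' in auto)
    ultimately show ?thesis using adj[OF fh] by simp
  qed
  then obtain F where F: "(F, w') \<in> D0" "AE x in half_line. u' x = F x"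
    using T0_adjoint[OF u'(1) L'(1) w'(1) L'(2)] by blast
  have "AE x in half_line. u x = F x" using u'(2) F(2) by eventually_elim simp
  then show ?thesis using F(1) w'(2) by blast
qed

text \<open>Both \<open>H_min\<close> and its adjoint lie in the adjoint of \<open>T0\<close>, hence
  in \<open>D0\<close> up to representatives. The symmetry of \<open>D0\<close> places the adjoint
  inside \<open>H_min\<close>; the converse inclusion holds because \<open>H_min\<close> is the
  adjoint of \<open>D0\<close>.\<close>

lemma self_adjoint_H_min:
  assumes sym: "\<And>f1 h1 f2 h2. (f1, h1) \<in> D0 \<Longrightarrow> (f2, h2) \<in> D0 \<Longrightarrow> ip h1 f2 = ip f1 h2"
  shows "self_adjoint (H_min \<nu> q)"
proof -
  have dense: "densely_defined (H_min \<nu> q)"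
    unfolding densely_defined_def using T0_dense T0_subset_H_min by blast
  have anti: "adjoint_graph T \<subseteq> adjoint_graph S" if "S \<subseteq> T" for S T
    using that unfolding adjoint_graph_def by blast
  have ipc: "ip h u = ip h F" if "h \<in> L2" "u \<in> L2" "F \<in> L2" "AE x in half_line. u x = F x" for h u F
    by (rule ip_cong_AE) (use L2_measurable that in auto)
  have "adjoint_graph (H_min \<nu> q) \<subseteq> H_min \<nu> q"
  proof safe
    fix u w assume "(u, w) \<in> adjoint_graph (H_min \<nu> q)"
    then have uw: "(u, w) \<in> adjoint_graph T0" using anti[OF T0_subset_H_min] by blast
    then have L: "u \<in> L2" "w \<in> L2" unfolding adjoint_graph_def by auto
    obtain F H where FH: "(F, H) \<in> D0" "AE x in half_line. u x = F x" "AE x in half_line. w x = H x"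
      using adjoint_T0[OF uw] by blast
    have FL: "F \<in> L2" "H \<in> L2" using D0_borel[OF FH(1)] by auto
    have "ip h u = ip f w" if fh: "(f, h) \<in> D0" for f h
    proof -
      have fhL: "f \<in> L2" "h \<in> L2" using D0_borel[OF fh] by auto
      show ?thesis
        using ipc[OF fhL(2) L(1) FL(1) FH(2)] ipc[OF fhL(1) L(2) FL(2) FH(3)] sym[OF fh FH(1)] by simp
    qed
    then show "(u, w) \<in> H_min \<nu> q" unfolding H_min_iff using L by blast
  qed
  moreover have "H_min \<nu> q \<subseteq> adjoint_graph (H_min \<nu> q)"
  proof safe
    fix u w assume uw: "(u, w) \<in> H_min \<nu> q"
    then have L: "u \<in> L2" "w \<in> L2" unfolding H_min_iff by auto
    have "(u, w) \<in> adjoint_graph T0" using uw T0_subset_D0 unfolding H_min_iff adjoint_graph_def by blast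
    then obtain F H where FH: "(F, H) \<in> D0" "AE x in half_line. u x = F x" "AE x in half_line. w x = H x"
      using adjoint_T0 by blast
    have FL: "F \<in> L2" "H \<in> L2" using D0_borel[OF FH(1)] by auto
    have "ip h u = ip f w" if fh: "(f, h) \<in> H_min \<nu> q" for f h
    proof -
      have fhL: "f \<in> L2" "h \<in> L2" "ip H f = ip F h" using fh FH(1) unfolding H_min_iff by auto
      have "ip f H = ip h F" using arg_cong[OF fhL(3), of cnj] by (simp add: ip_cnj)
      then show ?thesis
        using ipc[OF fhL(2) L(1) FL(1) FH(2)] ipc[OF fhL(1) L(2) FL(2) FH(3)] by simp
    qed
    then show "(u, w) \<in> adjoint_graph (H_min \<nu> q)" unfolding adjoint_graph_def using L by auto
  qed
  ultimately show ?thesis unfolding self_adjoint_def using dense by blast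
qed

end

text \<open>A compact \<open>T\<close> inside \<open>E\<close> still has measure above 1/2 and has
  positive distance from the complement of \<open>E\<close>. Once the mesh is below this distance,
  every grid cell meeting \<open>T\<close> lies in \<open>E\<close>, and these cells cover
  \<open>T\<close>.\<close>

lemma open_inner_cells:
  assumes E: "open E" "E \<subseteq> {a<..<a + 1}" and m: "E \<in> lmeasurable" "1/2 < measure lebesgue E"
  shows "\<exists>n J. 0 < n \<and> J \<subseteq> {..<n} \<and> (\<forall>j\<in>J. {a + real j / real n..a + (real j + 1) / real n} \<subseteq> E) \<and> 1/2 \<le> real (card J) / real n"
proof -
  \<comment> \<open>The excess over 1/2 is the measure that may be lost in passing to a closed
    subset.\<close>
  have "0 < measure lebesgue E - 1/2" using m by simp
  then obtain T where T: "closed T" "T \<subseteq> E" "E - T \<in> lmeasurable"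
    and "emeasure lebesgue (E - T) < ennreal (measure lebesgue E - 1/2)"
    using sets_lebesgue_inner_closed[OF fmeasurableD[OF m(1)]] by blast
  then have T4: "measure lebesgue (E - T) < measure lebesgue E - 1/2"
    by (simp add: emeasure_eq_measure2 ennreal_less_iff)
  have "bounded T" using bounded_subset[OF compact_imp_bounded[OF compact_Icc], of T a "a + 1"] T(2) E(2)
    by force
  then have cT: "compact T" using T(1) by (simp add: compact_eq_bounded_closed)
  have "measure lebesgue E \<le> measure lebesgue T + measure lebesgue (E - T)"
    using measure_Un_le[of T lebesgue "E - T"] lmeasurable_compact[OF cT] T
    by (simp add: Un_absorb1 fmeasurable_def)
  then have mT: "1/2 < measure lebesgue T" using T4 by simp
  have "T \<inter> - E = {}" "closed (- E)" using T E by auto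
  then obtain d where d: "0 < d" "\<And>x y. x \<in> T \<Longrightarrow> y \<in> - E \<Longrightarrow> d \<le> dist x y"
    using separate_compact_closed[OF cT] by metis
  obtain n where n: "1 / d < real n" "0 < n" using reals_Archimedean2[of "max (1/d) 0"] by auto
  have nd: "1 / real n < d" using n d(1) by (simp add: field_simps)
  define cell where "cell j = {a + real j / real n..a + (real j + 1) / real n}" for j
  define J where "J = {j. j < n \<and> cell j \<inter> T \<noteq> {}}"
  have sub: "cell j \<subseteq> E" if j: "j \<in> J" for j
  proof
    fix y assume y: "y \<in> cell j"
    obtain x where x: "x \<in> cell j" "x \<in> T" using j unfolding J_def by blast
    have "(real j + 1) / real n = real j / real n + 1 / real n" by (simp add: add_divide_distrib)
    then have "dist x y \<le> 1 / real n" using x(1) y unfolding cell_def dist_real_def by auto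
    then have "dist x y < d" using nd by simp
    then show "y \<in> E" using d(2)[OF x(2), of y] by force
  qed
  have cover: "T \<subseteq> (\<Union>j\<in>J. cell j)"
  proof
    fix x assume x: "x \<in> T"
    then have xa: "a < x" "x < a + 1" using T E by auto
    define j where "j = nat \<lfloor>(x - a) * real n\<rfloor>"
    have 0: "0 \<le> (x - a) * real n" using xa by simp
    have j1: "real j \<le> (x - a) * real n" "(x - a) * real n < real j + 1" unfolding j_def using 0
      by linarith+
    have "(x - a) * real n < 1 * real n" using xa n by (intro mult_strict_right_mono) auto
    then have "j < n" using j1(1) by simp
    moreover have "x \<in> cell j" unfolding cell_def using j1 n(2) by (simp add: field_simps)
    ultimately show "x \<in> (\<Union>j\<in>J. cell j)" unfolding J_def using x by blast
  qed
  have fJ: "finite J" unfolding J_def by simp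
  have "measure lebesgue T \<le> measure lebesgue (\<Union>j\<in>J. cell j)"
  proof (rule measure_mono_fmeasurable[OF cover fmeasurableD[OF lmeasurable_compact[OF cT]]])
    show "(\<Union>j\<in>J. cell j) \<in> lmeasurable"
      unfolding cell_def by (intro lmeasurable_compact compact_UN fJ compact_Icc)
  qed
  also have "\<dots> \<le> (\<Sum>j\<in>J. measure lebesgue (cell j))"
    by (rule measure_UNION_le[OF fJ]) (auto simp: cell_def)
  also have "\<dots> = (\<Sum>j\<in>J. 1 / real n)"
    unfolding cell_def using n(2) by (intro sum.cong refl) (simp add: field_simps)
  also have "\<dots> = real (card J) / real n" by simp
  finally have "1/2 \<le> real (card J) / real n" using mT by linarith
  moreover have "J \<subseteq> {..<n}" unfolding J_def by auto
  ultimately show ?thesis using sub n(2) unfolding cell_def by blast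
qed

context sl_problem
begin

lemma cutoff_of_gaps:
  fixes \<alpha> \<beta> :: "nat \<Rightarrow> real"
  assumes J: "finite J" and cell: "\<And>j. j \<in> J \<Longrightarrow> 0 < \<alpha> j \<and> X \<le> \<alpha> j \<and> \<alpha> j < \<beta> j \<and> \<beta> j < c"
    and disj: "\<And>i j. i \<in> J \<Longrightarrow> j \<in> J \<Longrightarrow> i \<noteq> j \<Longrightarrow> {\<alpha> i<..<\<beta> i} \<inter> {\<alpha> j<..<\<beta> j} = {}"
    and L: "0 < L" "L \<le> (\<Sum>j\<in>J. \<beta> j - \<alpha> j)"
    and gap: "\<And>j. j \<in> J \<Longrightarrow> {\<alpha> j<..<\<beta> j} \<inter> charge_supp \<nu> = {}"
  shows "\<exists>\<psi> \<eta> c. cutoff (3 / (2 * L)) X \<psi> \<eta> c"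
proof -
  have "\<exists>\<psi> \<eta>. cutoff (3 / (2 * L)) X \<psi> \<eta> c"
  proof (rule cutoff_of_cells[OF J cell disj L])
    fix w :: "real \<Rightarrow> complex" and x 
    assume w: "w \<in> borel_measurable borel" and z: "\<And>t. \<forall>j\<in>J. t \<notin> {\<alpha> j<..<\<beta> j} \<Longrightarrow> w t = 0"
    show "IP w x = prim lborel w x"
    proof (rule IP_off_support[OF borel_open[OF total_var_off_charge_supp(1)[OF charge]] total_var_off_charge_supp(2)[OF charge] w])
      fix t :: real assume "0 < t" "t \<notin> {0<..} - charge_supp \<nu>"
      then have "t \<in> charge_supp \<nu>" by auto
      then show "w t = 0" using gap by (intro z) blast
    qed
  qed
  then show ?thesis by blast
qed

text \<open>The constant must not depend on \<open>X\<close>. Condition (iii) gives one gap of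
  length \<epsilon> beyond \<open>X\<close>, and (i) is reduced to it with \<epsilon> = 1 and points
  beyond the support. Under (ii) single gaps may be arbitrarily short, but in a window of length 1
  finitely many cells of total length at least 1/2 avoid the support.\<close>

lemma cutoffs_exist:
  assumes "bounded (charge_supp \<nu>)
       \<or> charge_supp \<nu> \<in> null_sets lebesgue
       \<or> (\<exists>\<epsilon>>0. \<exists>x :: nat \<Rightarrow> real. filterlim x at_top sequentially \<and>
            (\<forall>j. {x j<..<x j + \<epsilon>} \<inter> charge_supp \<nu> = {}))"
  shows "\<exists>K. \<forall>X. \<exists>\<psi> \<eta> c. cutoff K X \<psi> \<eta> c"
proof -
  have iii: ?thesis if \<epsilon>: "0 < \<epsilon>" and x: "filterlim x at_top sequentially"
    "\<And>j. {x j<..<x j + \<epsilon>} \<inter> charge_supp \<nu> = {}"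
    for \<epsilon> :: real and x :: "nat \<Rightarrow> real"
  proof (rule exI, rule allI)
    fix X
    have "eventually (\<lambda>j. max X 1 \<le> x j) sequentially" using x(1) unfolding filterlim_at_top by blast
    then obtain j where j: "max X 1 \<le> x j" using eventually_happens'[of sequentially] by auto
    show "\<exists>\<psi> \<eta> c. cutoff (3 / (2 * \<epsilon>)) X \<psi> \<eta> c"
      \<comment> \<open>A single cell; the added 1 is there because cells must end strictly before
        \<open>c\<close>.\<close>
      by (rule cutoff_of_gaps[of "{0}" "\<lambda>_. x j" X "\<lambda>_. x j + \<epsilon>" "x j + \<epsilon> + 1"]) (use j \<epsilon> x(2) in auto)
  qed
  have i: ?thesis if bdd: "bounded (charge_supp \<nu>)"
  proof -
    obtain b where b: "\<And>t. t \<in> charge_supp \<nu> \<Longrightarrow> \<bar>t\<bar> \<le> b" using bdd unfolding bounded_iff by auto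
    have "filterlim (\<lambda>j. b + real j) at_top sequentially"
      by (rule filterlim_tendsto_add_at_top[OF tendsto_const filterlim_real_sequentially])
    moreover have "{b + real j<..<b + real j + 1} \<inter> charge_supp \<nu> = {}" for j
      using b by fastforce
    ultimately show ?thesis using iii[of 1 "\<lambda>j. b + real j"] by simp
  qed
  have ii: ?thesis if null: "charge_supp \<nu> \<in> null_sets lebesgue"
  proof (rule exI, rule allI)
    fix X :: real
    define a where "a = max X 1"
    define E where "E = {a<..<a + 1} - charge_supp \<nu>"
    \<comment> \<open>The window lies in the half line, where the support is relatively closed, so
      \<open>E\<close> is open; removing a null set leaves it measure 1.\<close>
    have "E = {a<..<a + 1} \<inter> ({0<..} - charge_supp \<nu>)" unfolding E_def a_def by auto
    then have oE: "open E" using total_var_off_charge_supp(1)[OF charge] by auto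
    have mE: "measure lebesgue E = 1" unfolding E_def
      using measure_Diff_null_set[OF _ null, of "{a<..<a + 1}"] by simp
    have "bounded E" unfolding E_def
      using bounded_subset[OF compact_imp_bounded[OF compact_Icc], of _ a "a + 1"] by force
    then have "E \<in> lmeasurable" using oE by (rule lmeasurable_open)
    then obtain n J where nJ: "0 < n" "J \<subseteq> {..<n}"
      "\<And>j. j \<in> J \<Longrightarrow> {a + real j / real n..a + (real j + 1) / real n} \<subseteq> E" "1/2 \<le> real (card J) / real n"
      using open_inner_cells[of E a] oE mE unfolding E_def by auto
    let ?\<alpha> = "\<lambda>j::nat. a + real j / real n" and ?\<beta> = "\<lambda>j::nat. a + (real j + 1) / real n"
    show "\<exists>\<psi> \<eta> c. cutoff (3 / (2 * (1/2))) X \<psi> \<eta> c"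
    proof (rule cutoff_of_gaps[of J ?\<alpha> X ?\<beta> "a + 2"])
      show "finite J" using nJ(2) finite_subset by blast
      show "0 < ?\<alpha> j \<and> X \<le> ?\<alpha> j \<and> ?\<alpha> j < ?\<beta> j \<and> ?\<beta> j < a + 2" if j: "j \<in> J" for j
      proof -
        have "j < n" using j nJ(2) by auto
        then have "(real j + 1) / real n \<le> 1" by (simp add: field_simps)
        moreover have "0 \<le> real j / real n" "real j / real n < (real j + 1) / real n" using nJ(1)
          by (auto simp: field_simps)
        moreover have "X \<le> a" "1 \<le> a" unfolding a_def by auto
        ultimately show ?thesis by linarith
      qed
      show "{?\<alpha> i<..<?\<beta> i} \<inter> {?\<alpha> j<..<?\<beta> j} = {}" if "i \<noteq> j" for i j
      proof -
        have le: "?\<beta> i \<le> ?\<alpha> j" if "i < j" for i j :: nat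
        proof -
          have "real i + 1 \<le> real j" using that by simp
          then show ?thesis by (simp add: divide_right_mono)
        qed
        show ?thesis using le[of i j] le[of j i] that by (cases "i < j") auto
      qed
      show "1/2 \<le> (\<Sum>j\<in>J. ?\<beta> j - ?\<alpha> j)"
      proof -
        have "(\<Sum>j\<in>J. ?\<beta> j - ?\<alpha> j) = (\<Sum>j\<in>J. 1 / real n)"
          by (intro sum.cong refl) (simp add: add_divide_distrib)
        then show ?thesis using nJ(4) by simp
      qed
      show "{?\<alpha> j<..<?\<beta> j} \<inter> charge_supp \<nu> = {}" if "j \<in> J" for j
      proof -
        have "{?\<alpha> j<..<?\<beta> j} \<subseteq> {?\<alpha> j..?\<beta> j}" by auto
        then show ?thesis using nJ(3)[OF that] unfolding E_def by blast
      qed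
    qed simp
  qed
  show ?thesis using assms i ii iii by blast
qed

end

text \<open>\<open>q\<close> is only Lebesgue measurable on the half line, while the integral system
  asks for a Borel potential.\<close>

lemma borel_version_of_potential:
  fixes q :: "real \<Rightarrow> real"
  assumes q: "\<And>c. 0 < c \<Longrightarrow> q absolutely_integrable_on {0<..<c}"
  shows "\<exists>q'. q' \<in> borel_measurable borel \<and> loc lborel q' \<and> (AE x in half_line. q x = q' x)"
proof -
  have int: "integrable lebesgue (\<lambda>x. indicator {0<..<c} x *\<^sub>R q x)" if "0 < c" for c
    using q[OF that] unfolding set_integrable_def .
  have "(\<lambda>x. if 0 < x then q x else 0) \<in> borel_measurable lebesgue"
  proof (rule borel_measurable_LIMSEQ_metric)
    show "(\<lambda>x. indicator {0<..<real (Suc n)} x *\<^sub>R q x) \<in> borel_measurable lebesgue" for n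
      by (rule borel_measurable_integrable[OF int]) simp
    fix x :: real
    obtain n0 where n0: "x < real n0" using reals_Archimedean2 by blast
    show "(\<lambda>n. indicator {0<..<real (Suc n)} x *\<^sub>R q x) \<longlonglongrightarrow> (if 0 < x then q x else 0)"
    proof (rule tendsto_eventually)
      show "eventually (\<lambda>n. indicator {0<..<real (Suc n)} x *\<^sub>R q x = (if 0 < x then q x else 0)) sequentially"
        using eventually_ge_at_top[of n0] by eventually_elim (use n0 in \<open>auto simp: indicator_def\<close>)
    qed
  qed
  then obtain q' where q': "q' \<in> borel_measurable lborel"
    "AE x in lborel. (if 0 < x then q x else 0) = q' x"
    using completion_ex_borel_measurable_real by blast
  have [measurable]: "q' \<in> borel_measurable borel" using q'(1) by simp
  have "integrable lborel (\<lambda>x. indicator {0<..<c} x *\<^sub>R q' x)" for c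
  proof (cases "0 < c")
    case True
    have "AE x in lebesgue. indicator {0<..<c} x *\<^sub>R q x = indicator {0<..<c} x *\<^sub>R q' x"
      unfolding AE_completion_iff using q'(2) by eventually_elim (auto simp: indicator_def)
    moreover have "(\<lambda>x. indicator {0<..<c} x *\<^sub>R q' x) \<in> borel_measurable lebesgue"
      by (rule measurable_completion) measurable
    ultimately have "integrable lebesgue (\<lambda>x. indicator {0<..<c} x *\<^sub>R q' x)"
      using integrable_cong_AE_imp[OF int[OF True]] by blast
    then show ?thesis by (subst (asm) integrable_completion) auto
  qed simp
  then have "loc lborel q'" unfolding loc_def set_integrable_def by blast
  moreover have "AE x in half_line. q x = q' x" unfolding AE_half_line using q'(2)
    by eventually_elim auto
  ultimately show ?thesis using \<open>q' \<in> borel_measurable borel\<close> by blast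
qed

theorem theorem4p1:
  fixes \<nu> :: "real set \<Rightarrow> real" and q :: "real \<Rightarrow> real"
  assumes "is_charge \<nu>"
    and "singular_leb \<nu>"
    and "\<And>c. 0 < c \<Longrightarrow> total_var \<nu> {0<..<c} < \<infinity>"
    and "\<And>c. 0 < c \<Longrightarrow> q absolutely_integrable_on {0<..<c}"
    and "bounded (charge_supp \<nu>)
       \<or> charge_supp \<nu> \<in> null_sets lebesgue
       \<or> (\<exists>\<epsilon>>0. \<exists>x :: nat \<Rightarrow> real. filterlim x at_top sequentially \<and>
            (\<forall>j. {x j<..<x j + \<epsilon>} \<inter> charge_supp \<nu> = {}))"
    and "lower_semibounded (H_min \<nu> q)"
  shows "self_adjoint (H_min \<nu> q)"
proof -
  obtain q' where q': "q' \<in> borel_measurable borel" "loc lborel q'" "AE x in half_line. q x = q' x"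
    using borel_version_of_potential[OF assms(4)] by blast
  interpret sl_problem \<nu> q q'
    using assms(1-3) q' by unfold_locales
  obtain K where K: "\<And>X. \<exists>\<psi> \<eta> c. cutoff K X \<psi> \<eta> c" using cutoffs_exist[OF assms(5)] by blast
  obtain \<gamma> where \<gamma>: "\<And>f h. (f, h) \<in> H_min \<nu> q \<Longrightarrow> \<gamma> * (L2_norm f)\<^sup>2 \<le> Re (ip h f)"
    using assms(6) unfolding lower_semibounded_def by blast
  have bound: "\<gamma> * (L2_norm f)\<^sup>2 \<le> Re (ip h f)" if "(f, h) \<in> T0" for f h
    using \<gamma> T0_subset_H_min that by blast
  show ?thesis by (rule self_adjoint_H_min[OF D0_symmetric[OF K bound]])
qed

end
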